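(* Let $\Omega\subset\mathbb{R}^3$ be a bounded Lipschitz domain and let $\varepsilon:\Omega\to\mathbb{R}^{3\times3}$ be symmetric, essentially bounded and uniformly positive definite, with constants $\underline{\varepsilon},\overline{\varepsilon}>0$ satisfying $\underline{\varepsilon}^{-2}|E|_{\Omega}^2\le\langle\varepsilon E,E\rangle_{\Omega}\le\overline{\varepsilon}^{2}|E|_{\Omega}^2$ for all $E\in\mathsf{L}^2(\Omega)$. Then $$\frac{c_{p,\circ}}{\underline{\varepsilon}\,\overline{\varepsilon}^2}\le c_{m,t,\varepsilon},\qquad \frac{c_p}{\underline{\varepsilon}\,\overline{\varepsilon}^2}\le c_{m,n,\varepsilon}.$$
   Context: $\mathsf{L}^2(\Omega)$ denotes square integrable functions or vector fields, with scalar product $\langle\cdot,\cdot\rangle_{\Omega}$ and norm $|\cdot|_{\Omega}$; $|E|_{\Omega,\varepsilon}:=\langle\varepsilon E,E\rangle_{\Omega}^{1/2}$. $\mathsf{H}^1(\Omega)$ is the usual Sobolev space and $\overset{\circ}{\mathsf{H}}{}^1(\Omega)$ the closure of $\mathsf{C}_c^\infty(\Omega)$ in it. With weak derivatives, $\mathsf{D}(\Omega):=\{v\in\mathsf{L}^2(\Omega):\operatorname{div}v\in\mathsf{L}^2(\Omega)\}$ and $\mathsf{R}(\Omega):=\{v\in\mathsf{L}^2(\Omega):\operatorname{rot}v\in\mathsf{L}^2(\Omega)\}$ ($\operatorname{rot}=\nabla\times$), with their graph norms; $\overset{\circ}{\mathsf{D}}(\Omega)$ and $\overset{\circ}{\mathsf{R}}(\Omega)$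 are the closures of the compactly supported smooth vector fields in $\mathsf{D}(\Omega)$ and $\mathsf{R}(\Omega)$ (generalizing vanishing normal, resp. tangential, trace). A lower index $0$ denotes the subspace where the respective derivative ($\operatorname{div}$ or $\operatorname{rot}$) vanishes. For a space $X$ of vector fields, $\varepsilon^{-1}X=\{E\in\mathsf{L}^2(\Omega):\varepsilon E\in X\}$. Poincaré constants: $c_{p,\circ}>0$ is the best constant in $|u|_\Omega\le c_{p,\circ}|\nabla u|_\Omega$ for all $u\in\overset{\circ}{\mathsf{H}}{}^1(\Omega)$, and $c_p>0$ the best constant in $|u|_\Omega\le c_p|\nabla u|_\Omega$ for all $u\in\mathsf{H}^1(\Omega)$ with $\int_\Omega u=0$. Dirichlet and Neumann fields: $\mathcal{H}_{D,\varepsilon}(\Omega):=\overset{\circ}{\mathsf{R}}_0(\Omega)\cap\varepsilon^{-1}\mathsf{D}_0(\Omega)$, $\mathcal{H}_{N,\varepsilon}(\Omega):=\mathsf{R}_0(\Omega)\cap\varepsilon^{-1}\overset{\circ}{\mathsf{D}}_0(\Omega)$ (both finite dimensional); $\pi_D$, $\pi_N$ are the orthogonal projectors onto them with respect to $\langle\varepsilon\,\cdot,\cdot\rangle_\Omega$. Maxwell constants: $c_{m,t,\varepsilon}$ is the best constant in $|E-\pi_DE|_{\Omega,\varepsilon}\le c_{m,t,\varepsilon}(|\operatorname{rot}E|_\Omega^2+|\operatorname{div}\varepsilon E|_\Omega^2)^{1/2}$ for all $E\in\overset{\circ}{\mathsf{R}}(\Omega)\cap\varepsilon^{-1}\mathsf{D}(\Omega)$,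 and $c_{m,n,\varepsilon}$ the best constant in $|H-\pi_NH|_{\Omega,\varepsilon}\le c_{m,n,\varepsilon}(|\operatorname{rot}H|_\Omega^2+|\operatorname{div}\varepsilon H|_\Omega^2)^{1/2}$ for all $H\in\mathsf{R}(\Omega)\cap\varepsilon^{-1}\overset{\circ}{\mathsf{D}}(\Omega)$. (These constants exist and are finite for bounded Lipschitz domains.) *)

theory Defs
  imports "HOL-Analysis.Analysis"
begin

subsection \<open>Bounded Lipschitz domains\<close>

text \<open>Near every boundary point the set is, after an orthogonal change of coordinates,
  the strict epigraph of a Lipschitz function of two variables.\<close>

definition lipschitz_domain :: "(real^3) set \<Rightarrow> bool" where
  "lipschitz_domain \<Omega> \<longleftrightarrow>
     open \<Omega> \<and> connected \<Omega> \<and> \<Omega> \<noteq> {} \<and>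
     (\<forall>p\<in>frontier \<Omega>. \<exists>(T :: real^3 \<Rightarrow> real^3) (\<gamma> :: real \<times> real \<Rightarrow> real) L r.
        orthogonal_transformation T \<and> L-lipschitz_on UNIV \<gamma> \<and> r > 0 \<and>
        \<Omega> \<inter> ball p r = {x \<in> ball p r. \<gamma> (T x $ 1, T x $ 2) < T x $ 3})"

subsection \<open>Square integrable functions and vector fields\<close>

text \<open>Functions are defined on the whole space, but only their values in \<open>\<Omega>\<close> matter.
  Functions agreeing almost everywhere in \<open>\<Omega>\<close> are not identified; all spaces below
  are closed under changes on null sets.\<close>

definition L2 :: "(real^3) set \<Rightarrow> (real^3 \<Rightarrow> 'b::euclidean_space) set" where
  "L2 \<Omega> = {f. f \<in> borel_measurable (lebesgue_on \<Omega>) \<and>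
              integrable (lebesgue_on \<Omega>) (\<lambda>x. (norm (f x))\<^sup>2)}"

definition l2_inner :: "(real^3) set \<Rightarrow> (real^3 \<Rightarrow> 'b::euclidean_space) \<Rightarrow> (real^3 \<Rightarrow> 'b) \<Rightarrow> real" where
  "l2_inner \<Omega> f g = (LINT x|lebesgue_on \<Omega>. f x \<bullet> g x)"

definition l2_norm :: "(real^3) set \<Rightarrow> (real^3 \<Rightarrow> 'b::euclidean_space) \<Rightarrow> real" where
  "l2_norm \<Omega> f = sqrt (l2_inner \<Omega> f f)"

definition app :: "(real^3 \<Rightarrow> real^3^3) \<Rightarrow> (real^3 \<Rightarrow> real^3) \<Rightarrow> real^3 \<Rightarrow> real^3" where
  "app \<epsilon> E = (\<lambda>x. \<epsilon> x *v E x)"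

definition weighted_norm :: "(real^3) set \<Rightarrow> (real^3 \<Rightarrow> real^3^3) \<Rightarrow> (real^3 \<Rightarrow> real^3) \<Rightarrow> real" where
  "weighted_norm \<Omega> \<epsilon> E = sqrt (l2_inner \<Omega> (app \<epsilon> E) E)"

subsection \<open>Classical derivatives and test functions\<close>

definition partial :: "3 \<Rightarrow> (real^3 \<Rightarrow> 'b::real_normed_vector) \<Rightarrow> real^3 \<Rightarrow> 'b" where
  "partial i f x = frechet_derivative f (at x) (axis i 1)"

primrec iter_partial :: "3 list \<Rightarrow> (real^3 \<Rightarrow> 'b::real_normed_vector) \<Rightarrow> real^3 \<Rightarrow> 'b" where
  "iter_partial [] f = f"
| "iter_partial (i # is) f = partial i (iter_partial is f)"

text \<open>Differentiability of all iterated partial derivatives entails their continuity.\<close>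

definition smooth :: "(real^3 \<Rightarrow> 'b::real_normed_vector) \<Rightarrow> bool" where
  "smooth f \<longleftrightarrow> (\<forall>is x. iter_partial is f differentiable (at x))"

text \<open>Members of \<open>C\<^sub>c\<^sup>\<infinity>(\<Omega>)\<close> are extended by zero outside \<open>\<Omega>\<close>.\<close>

definition test_functions :: "(real^3) set \<Rightarrow> (real^3 \<Rightarrow> 'b::real_normed_vector) set" where
  "test_functions \<Omega> = {\<phi>. smooth \<phi> \<and> compact (closure {x. \<phi> x \<noteq> 0}) \<and> closure {x. \<phi> x \<noteq> 0} \<subseteq> \<Omega>}"

definition grad :: "(real^3 \<Rightarrow> real) \<Rightarrow> real^3 \<Rightarrow> real^3" where
  "grad u = (\<lambda>x. \<chi> i. partial i u x)"

definition divergence :: "(real^3 \<Rightarrow> real^3) \<Rightarrow> real^3 \<Rightarrow> real" where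
  "divergence v = (\<lambda>x. \<Sum>i\<in>UNIV. partial i (\<lambda>y. v y $ i) x)"

definition curl :: "(real^3 \<Rightarrow> real^3) \<Rightarrow> real^3 \<Rightarrow> real^3" where
  "curl v = (\<lambda>x. let D = (\<lambda>i j. partial i (\<lambda>y. v y $ j) x) in
     vector [D 2 3 - D 3 2, D 3 1 - D 1 3, D 1 2 - D 2 1])"

subsection \<open>Weak derivatives\<close>

text \<open>Weak derivatives are unique only almost everywhere, so they are given as relations
  between square integrable representatives.\<close>

definition has_weak_grad :: "(real^3) set \<Rightarrow> (real^3 \<Rightarrow> real) \<Rightarrow> (real^3 \<Rightarrow> real^3) \<Rightarrow> bool" where
  "has_weak_grad \<Omega> u g \<longleftrightarrow> u \<in> L2 \<Omega> \<and> g \<in> L2 \<Omega> \<and>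
     (\<forall>\<phi>\<in>test_functions \<Omega>. \<forall>i. l2_inner \<Omega> u (partial i \<phi>) = - l2_inner \<Omega> (\<lambda>x. g x $ i) \<phi>)"

definition has_weak_div :: "(real^3) set \<Rightarrow> (real^3 \<Rightarrow> real^3) \<Rightarrow> (real^3 \<Rightarrow> real) \<Rightarrow> bool" where
  "has_weak_div \<Omega> v d \<longleftrightarrow> v \<in> L2 \<Omega> \<and> d \<in> L2 \<Omega> \<and>
     (\<forall>\<phi>\<in>test_functions \<Omega>. l2_inner \<Omega> v (grad \<phi>) = - l2_inner \<Omega> d \<phi>)"

definition has_weak_rot :: "(real^3) set \<Rightarrow> (real^3 \<Rightarrow> real^3) \<Rightarrow> (real^3 \<Rightarrow> real^3) \<Rightarrow> bool" where
  "has_weak_rot \<Omega> v r \<longleftrightarrow> v \<in> L2 \<Omega> \<and> r \<in> L2 \<Omega> \<and>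
     (\<forall>\<Phi>\<in>test_functions \<Omega>. l2_inner \<Omega> v (curl \<Phi>) = l2_inner \<Omega> r \<Phi>)"

subsection \<open>The Sobolev spaces\<close>

definition H1 :: "(real^3) set \<Rightarrow> (real^3 \<Rightarrow> real) set" where
  "H1 \<Omega> = {u. \<exists>g. has_weak_grad \<Omega> u g}"

definition D :: "(real^3) set \<Rightarrow> (real^3 \<Rightarrow> real^3) set" where
  "D \<Omega> = {v. \<exists>d. has_weak_div \<Omega> v d}"

definition R :: "(real^3) set \<Rightarrow> (real^3 \<Rightarrow> real^3) set" where
  "R \<Omega> = {v. \<exists>r. has_weak_rot \<Omega> v r}"

definition graph_norm ::
  "(real^3) set \<Rightarrow> (real^3 \<Rightarrow> 'b::euclidean_space) \<Rightarrow> (real^3 \<Rightarrow> 'c::euclidean_space) \<Rightarrow> real" where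
  "graph_norm \<Omega> u f = sqrt ((l2_norm \<Omega> u)\<^sup>2 + (l2_norm \<Omega> f)\<^sup>2)"

text \<open>The pair \<open>(u, f)\<close>, with \<open>f\<close> the weak derivative of \<open>u\<close>, is approximated in the graph
  norm by test functions \<open>\<phi>\<close> with classical derivative \<open>A \<phi>\<close>.\<close>

definition approx_by_test ::
  "(real^3) set \<Rightarrow> ((real^3 \<Rightarrow> 'b::euclidean_space) \<Rightarrow> real^3 \<Rightarrow> 'c::euclidean_space) \<Rightarrow>
     (real^3 \<Rightarrow> 'b) \<Rightarrow> (real^3 \<Rightarrow> 'c) \<Rightarrow> bool" where
  "approx_by_test \<Omega> A u f \<longleftrightarrow>
     (\<forall>e>0. \<exists>\<phi>\<in>test_functions \<Omega>. graph_norm \<Omega> (\<lambda>x. u x - \<phi> x) (\<lambda>x. f x - A \<phi> x) < e)"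

definition H1_circ :: "(real^3) set \<Rightarrow> (real^3 \<Rightarrow> real) set" where
  "H1_circ \<Omega> = {u. \<exists>g. has_weak_grad \<Omega> u g \<and> approx_by_test \<Omega> grad u g}"

definition D_circ :: "(real^3) set \<Rightarrow> (real^3 \<Rightarrow> real^3) set" where
  "D_circ \<Omega> = {v. \<exists>d. has_weak_div \<Omega> v d \<and> approx_by_test \<Omega> divergence v d}"

definition R_circ :: "(real^3) set \<Rightarrow> (real^3 \<Rightarrow> real^3) set" where
  "R_circ \<Omega> = {v. \<exists>r. has_weak_rot \<Omega> v r \<and> approx_by_test \<Omega> curl v r}"

definition D0 :: "(real^3) set \<Rightarrow> (real^3 \<Rightarrow> real^3) set" where
  "D0 \<Omega> = {v \<in> D \<Omega>. has_weak_div \<Omega> v (\<lambda>x. 0)}"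

definition R0 :: "(real^3) set \<Rightarrow> (real^3 \<Rightarrow> real^3) set" where
  "R0 \<Omega> = {v \<in> R \<Omega>. has_weak_rot \<Omega> v (\<lambda>x. 0)}"

definition D_circ0 :: "(real^3) set \<Rightarrow> (real^3 \<Rightarrow> real^3) set" where
  "D_circ0 \<Omega> = {v \<in> D_circ \<Omega>. has_weak_div \<Omega> v (\<lambda>x. 0)}"

definition R_circ0 :: "(real^3) set \<Rightarrow> (real^3 \<Rightarrow> real^3) set" where
  "R_circ0 \<Omega> = {v \<in> R_circ \<Omega>. has_weak_rot \<Omega> v (\<lambda>x. 0)}"

definition eps_inv ::
  "(real^3) set \<Rightarrow> (real^3 \<Rightarrow> real^3^3) \<Rightarrow> (real^3 \<Rightarrow> real^3) set \<Rightarrow> (real^3 \<Rightarrow> real^3) set" where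
  "eps_inv \<Omega> \<epsilon> X = {E \<in> L2 \<Omega>. app \<epsilon> E \<in> X}"

subsection \<open>Dirichlet and Neumann fields, orthogonal projectors\<close>

definition dirichlet_fields :: "(real^3) set \<Rightarrow> (real^3 \<Rightarrow> real^3^3) \<Rightarrow> (real^3 \<Rightarrow> real^3) set" where
  "dirichlet_fields \<Omega> \<epsilon> = R_circ0 \<Omega> \<inter> eps_inv \<Omega> \<epsilon> (D0 \<Omega>)"

definition neumann_fields :: "(real^3) set \<Rightarrow> (real^3 \<Rightarrow> real^3^3) \<Rightarrow> (real^3 \<Rightarrow> real^3) set" where
  "neumann_fields \<Omega> \<epsilon> = R0 \<Omega> \<inter> eps_inv \<Omega> \<epsilon> (D_circ0 \<Omega>)"

text \<open>A representative of the projection of \<open>E\<close> onto the subspace \<open>X\<close>, orthogonal for the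
  \<open>\<epsilon>\<close>-weighted inner product; it is determined up to a null set.\<close>

definition eps_proj ::
  "(real^3) set \<Rightarrow> (real^3 \<Rightarrow> real^3^3) \<Rightarrow> (real^3 \<Rightarrow> real^3) set \<Rightarrow>
     (real^3 \<Rightarrow> real^3) \<Rightarrow> real^3 \<Rightarrow> real^3" where
  "eps_proj \<Omega> \<epsilon> X E =
     (SOME P. P \<in> X \<and> (\<forall>h\<in>X. l2_inner \<Omega> (app \<epsilon> (\<lambda>x. E x - P x)) h = 0))"

subsection \<open>Poincare and Maxwell constants\<close>

text \<open>The best constant is the infimum of the admissible ones, with value \<open>\<infinity>\<close> if there is none;
  by the lemma below a least admissible constant is the best constant.\<close>

definition best_constant :: "(real \<Rightarrow> bool) \<Rightarrow> ennreal" where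
  "best_constant P = (INF c\<in>{c. 0 \<le> c \<and> P c}. ennreal c)"

lemma best_constant_eqI:
  assumes "0 \<le> c" "P c" "\<And>c'. 0 \<le> c' \<Longrightarrow> P c' \<Longrightarrow> c \<le> c'"
  shows "best_constant P = ennreal c"
  unfolding best_constant_def using assms
  by (intro antisym INF_lower INF_greatest) (auto intro: ennreal_leI)

definition c_p_circ :: "(real^3) set \<Rightarrow> ennreal" where
  "c_p_circ \<Omega> = best_constant (\<lambda>c. \<forall>u\<in>H1_circ \<Omega>. \<forall>g. has_weak_grad \<Omega> u g \<longrightarrow>
     l2_norm \<Omega> u \<le> c * l2_norm \<Omega> g)"

definition c_p :: "(real^3) set \<Rightarrow> ennreal" where
  "c_p \<Omega> = best_constant (\<lambda>c. \<forall>u\<in>H1 \<Omega>. \<forall>g. has_weak_grad \<Omega> u g \<longrightarrow>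
     (LINT x|lebesgue_on \<Omega>. u x) = 0 \<longrightarrow> l2_norm \<Omega> u \<le> c * l2_norm \<Omega> g)"

definition c_mt :: "(real^3) set \<Rightarrow> (real^3 \<Rightarrow> real^3^3) \<Rightarrow> ennreal" where
  "c_mt \<Omega> \<epsilon> = best_constant (\<lambda>c. \<forall>E \<in> R_circ \<Omega> \<inter> eps_inv \<Omega> \<epsilon> (D \<Omega>). \<forall>r d.
     has_weak_rot \<Omega> E r \<longrightarrow> has_weak_div \<Omega> (app \<epsilon> E) d \<longrightarrow>
     weighted_norm \<Omega> \<epsilon> (\<lambda>x. E x - eps_proj \<Omega> \<epsilon> (dirichlet_fields \<Omega> \<epsilon>) E x)
       \<le> c * sqrt ((l2_norm \<Omega> r)\<^sup>2 + (l2_norm \<Omega> d)\<^sup>2))"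

definition c_mn :: "(real^3) set \<Rightarrow> (real^3 \<Rightarrow> real^3^3) \<Rightarrow> ennreal" where
  "c_mn \<Omega> \<epsilon> = best_constant (\<lambda>c. \<forall>H \<in> R \<Omega> \<inter> eps_inv \<Omega> \<epsilon> (D_circ \<Omega>). \<forall>r d.
     has_weak_rot \<Omega> H r \<longrightarrow> has_weak_div \<Omega> (app \<epsilon> H) d \<longrightarrow>
     weighted_norm \<Omega> \<epsilon> (\<lambda>x. H x - eps_proj \<Omega> \<epsilon> (neumann_fields \<Omega> \<epsilon>) H x)
       \<le> c * sqrt ((l2_norm \<Omega> r)\<^sup>2 + (l2_norm \<Omega> d)\<^sup>2))"

subsection \<open>Admissible coefficients\<close>

definition admissible_coeff :: "(real^3) set \<Rightarrow> (real^3 \<Rightarrow> real^3^3) \<Rightarrow> bool" where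
  "admissible_coeff \<Omega> \<epsilon> \<longleftrightarrow>
     \<epsilon> \<in> borel_measurable (lebesgue_on \<Omega>) \<and>
     (AE x in lebesgue_on \<Omega>. transpose (\<epsilon> x) = \<epsilon> x) \<and>
     (\<exists>K. AE x in lebesgue_on \<Omega>. norm (\<epsilon> x) \<le> K) \<and>
     (\<exists>c>0. AE x in lebesgue_on \<Omega>. \<forall>v. c * (norm v)\<^sup>2 \<le> (\<epsilon> x *v v) \<bullet> v)"

end

theory Submission
  imports Defs "HOL-Library.Function_Algebras"
begin

text \<open>
Write \<open>G\<close> for the gradient as a closed operator from \<open>L2\<close> to \<open>L2\<close>, with domain \<open>H1_circ\<close> for
the first inequality and \<open>H1\<close> for the second. With respect to \<open>\<langle>\<epsilon> \<cdot>, \<cdot>\<rangle>\<close> on the target, the adjoint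
of \<open>G\<close> is \<open>E \<mapsto> - div (\<epsilon> E)\<close>, with domain \<open>\<epsilon>\<^sup>-\<^sup>1 D\<close> in the first case and \<open>\<epsilon>\<^sup>-\<^sup>1 D_circ\<close> in the
second (\<open>adjoint_weak_grad\<close> for the latter). A gradient \<open>E = G \<phi>\<close> is rotation free, has the boundary condition
required of an admissible field, and is orthogonal to the Dirichlet, respectively Neumann, fields
(\<open>dirichlet_orthogonal\<close>, \<open>neumann_orthogonal\<close>); so the Maxwell inequality with constant \<open>c\<close> says
\<open>|E|\<^sub>\<epsilon> \<le> c |div (\<epsilon> E)|\<close> for such \<open>E\<close>, that is, the adjoint of \<open>G\<close> is bounded below on the range
of \<open>G\<close>. By duality \<open>G\<close> is then bounded below, with the same constant, on the orthogonal complement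
of its kernel: \<open>|u| \<le> c |G u|\<^sub>\<epsilon>\<close>.

The duality step is \<open>adjoint_bound_imp_bound\<close>. For \<open>\<delta> > 0\<close> the resolvent equation
\<open>\<delta> (\<psi> - u) + G\<^sup>* G \<psi> = 0\<close> is solved by projecting \<open>(u, 0)\<close> onto the graph of \<open>G\<close>. The field
\<open>E = G \<psi> / \<delta>\<close> satisfies \<open>G\<^sup>* E = u - \<psi>\<close>, whence \<open>|u - \<psi>|\<^sup>2 \<le> \<langle>\<epsilon> E, G u\<rangle> \<le> c |u - \<psi>| |G u|\<^sub>\<epsilon>\<close>. Since
\<open>E\<close> stays bounded, \<open>\<psi>\<close> converges for \<open>\<delta> \<rightarrow> 0\<close> to an element of the kernel of \<open>G\<close>, which vanishes
because \<open>u\<close> is orthogonal to the kernel. No compactness and no a priori Poincare inequality on \<open>H1\<close>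
are involved; if no \<open>c\<close> is admissible, there is nothing to show.

The kernel is trivial on \<open>H1_circ\<close> of a bounded domain (\<open>test_closure_grad_kernel\<close>, from the
inequality of Friedrichs for test functions), and it consists of the constants on \<open>H1\<close> of a
connected open set (\<open>weak_grad_zero_imp_const\<close>); functions of mean value zero are orthogonal to
these. Finally \<open>|g|\<^sub>\<epsilon> \<le> up |g| \<le> lo up\<^sup>2 |g|\<close>, as the two bounds on \<open>\<epsilon>\<close> force \<open>1 \<le> lo up\<close> when
\<open>g\<close> does not vanish (\<open>weighted_le_norm'\<close>).
\<close>

section \<open>Projections and a duality for closed operators\<close>

text \<open>Functions form a real vector space under pointwise operations, so that subspaces and products
  of function spaces are available without a quotient by null functions.\<close>

instantiation "fun" :: (type, real_vector) real_vector
begin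

definition scaleR_fun :: "real \<Rightarrow> ('a \<Rightarrow> 'b) \<Rightarrow> 'a \<Rightarrow> 'b" where
  "scaleR_fun c f = (\<lambda>x. c *\<^sub>R f x)"

instance
  by standard (auto simp: scaleR_fun_def fun_eq_iff algebra_simps)

end

lemma scaleR_fun_apply [simp]: "(c *\<^sub>R f) x = c *\<^sub>R f x"
  by (simp add: scaleR_fun_def)

text \<open>A subspace \<open>V\<close> with a positive semidefinite symmetric bilinear form \<open>B\<close>. The form is not
  required to be definite: functions that agree almost everywhere have distance zero without
  being equal.\<close>

locale semi_inner =
  fixes V :: "'v::real_vector set" and B :: "'v \<Rightarrow> 'v \<Rightarrow> real"
  assumes subspace_V: "subspace V"
    and sym: "x \<in> V \<Longrightarrow> y \<in> V \<Longrightarrow> B x y = B y x"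
    and add_left: "x \<in> V \<Longrightarrow> y \<in> V \<Longrightarrow> z \<in> V \<Longrightarrow> B (x + y) z = B x z + B y z"
    and scale_left: "x \<in> V \<Longrightarrow> z \<in> V \<Longrightarrow> B (c *\<^sub>R x) z = c * B x z"
    and nonneg: "x \<in> V \<Longrightarrow> 0 \<le> B x x"
begin

text \<open>The seminorm of \<open>B\<close>.\<close>

definition nrm :: "'v \<Rightarrow> real" where "nrm x = sqrt (B x x)"

text \<open>Every Cauchy sequence in \<open>W\<close> has a limit in \<open>W\<close>, unique only up to seminorm zero.\<close>

definition complete_on :: "'v set \<Rightarrow> bool" where
  "complete_on W \<longleftrightarrow> (\<forall>s. (\<forall>n. s n \<in> W) \<longrightarrow>
     (\<forall>e>0. \<exists>N::nat. \<forall>m\<ge>N. \<forall>n\<ge>N. nrm (s m - s n) < e) \<longrightarrow>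
     (\<exists>l\<in>W. (\<lambda>n. nrm (s n - l)) \<longlonglongrightarrow> 0))"

lemma mem [simp, intro]:
  "0 \<in> V" "x \<in> V \<Longrightarrow> y \<in> V \<Longrightarrow> x + y \<in> V" "x \<in> V \<Longrightarrow> c *\<^sub>R x \<in> V"
  "x \<in> V \<Longrightarrow> y \<in> V \<Longrightarrow> x - y \<in> V" "x \<in> V \<Longrightarrow> - x \<in> V"
  using subspace_V by (auto simp: subspace_0 subspace_add subspace_scale subspace_diff subspace_neg)

lemma add_right: "x \<in> V \<Longrightarrow> y \<in> V \<Longrightarrow> z \<in> V \<Longrightarrow> B z (x + y) = B z x + B z y"
  using sym[of z "x + y"] sym[of z x] sym[of z y] add_left by simp

lemma scale_right: "x \<in> V \<Longrightarrow> z \<in> V \<Longrightarrow> B z (c *\<^sub>R x) = c * B z x"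
  using sym[of z "c *\<^sub>R x"] sym[of z x] scale_left by simp

lemma minus_left: "x \<in> V \<Longrightarrow> z \<in> V \<Longrightarrow> B (- x) z = - B x z"
  using scale_left[of x z "-1"] by simp

lemma minus_right: "x \<in> V \<Longrightarrow> z \<in> V \<Longrightarrow> B z (- x) = - B z x"
  using scale_right[of x z "-1"] by simp

lemma diff_left: "x \<in> V \<Longrightarrow> y \<in> V \<Longrightarrow> z \<in> V \<Longrightarrow> B (x - y) z = B x z - B y z"
  using add_left[of x "- y" z] minus_left by simp

lemma diff_right: "x \<in> V \<Longrightarrow> y \<in> V \<Longrightarrow> z \<in> V \<Longrightarrow> B z (x - y) = B z x - B z y"
  using add_right[of x "- y" z] minus_right by simp

lemma zero_left [simp]: "x \<in> V \<Longrightarrow> B 0 x = 0"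
  using scale_left[of 0 x 0] by simp

lemma zero_right [simp]: "x \<in> V \<Longrightarrow> B x 0 = 0"
  using scale_right[of 0 x 0] by simp

lemmas bilinear = add_left add_right diff_left diff_right scale_left scale_right
  minus_left minus_right

lemma nrm_nonneg [simp]: "x \<in> V \<Longrightarrow> 0 \<le> nrm x"
  by (simp add: nrm_def nonneg)

lemma nrm_sq: "x \<in> V \<Longrightarrow> (nrm x)\<^sup>2 = B x x"
  by (simp add: nrm_def nonneg)

lemma quad: "x \<in> V \<Longrightarrow> y \<in> V \<Longrightarrow>
    B (x - t *\<^sub>R y) (x - t *\<^sub>R y) = B x x - 2 * t * B x y + t\<^sup>2 * B y y"
  using sym[of x y] by (simp add: bilinear power2_eq_square algebra_simps)

text \<open>A quadratic polynomial bounded below controls its linear coefficient.\<close>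

lemma quad_bound:
  assumes "0 \<le> (b::real)" "\<And>t. - e \<le> - 2 * t * a + t\<^sup>2 * b"
  shows "a\<^sup>2 \<le> e * b"
proof (cases "b = 0")
  case True
  have "a = 0"
  proof (rule ccontr)
    assume "a \<noteq> 0"
    then have "- 2 * ((e + 1) / (2 * a)) * a = - (e + 1)" by (simp add: field_simps)
    then show False using assms(2)[of "(e + 1) / (2 * a)"] True by simp
  qed
  then show ?thesis using True by simp
next
  case False
  then have "b > 0" using assms(1) by simp
  have "- e \<le> - (a\<^sup>2 / b)"
    using assms(2)[of "a / b"] \<open>b > 0\<close> by (simp add: field_simps power2_eq_square)
  then show ?thesis using \<open>b > 0\<close> by (simp add: field_simps)
qed

lemma cauchy_schwarz_sq: "x \<in> V \<Longrightarrow> y \<in> V \<Longrightarrow> (B x y)\<^sup>2 \<le> B x x * B y y"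
proof (rule quad_bound)
  fix t assume "x \<in> V" "y \<in> V"
  then show "- B x x \<le> - 2 * t * B x y + t\<^sup>2 * B y y"
    using nonneg[of "x - t *\<^sub>R y"] quad[of x y t] by simp
qed (simp add: nonneg)

lemma cauchy_schwarz: "x \<in> V \<Longrightarrow> y \<in> V \<Longrightarrow> \<bar>B x y\<bar> \<le> nrm x * nrm y"
proof -
  assume "x \<in> V" "y \<in> V"
  then have "(B x y)\<^sup>2 \<le> (nrm x * nrm y)\<^sup>2"
    using cauchy_schwarz_sq by (simp add: power_mult_distrib nrm_sq)
  then show ?thesis
    using \<open>x \<in> V\<close> \<open>y \<in> V\<close> by (metis abs_le_square_iff abs_of_nonneg mult_nonneg_nonneg nrm_nonneg)
qed

lemma nrm_triangle: "x \<in> V \<Longrightarrow> y \<in> V \<Longrightarrow> nrm (x + y) \<le> nrm x + nrm y"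
proof -
  assume xy: "x \<in> V" "y \<in> V"
  have "(nrm (x + y))\<^sup>2 = (nrm x)\<^sup>2 + 2 * B x y + (nrm y)\<^sup>2"
    using xy sym[of x y] by (simp add: nrm_sq bilinear)
  also have "\<dots> \<le> (nrm x + nrm y)\<^sup>2"
    using cauchy_schwarz[OF xy] by (simp add: power2_sum)
  finally show ?thesis using xy by (meson add_nonneg_nonneg nrm_nonneg power2_le_imp_le)
qed

lemma nrm_scale: "x \<in> V \<Longrightarrow> nrm (c *\<^sub>R x) = \<bar>c\<bar> * nrm x"
  by (simp add: nrm_def bilinear real_sqrt_mult mult.assoc[symmetric])

lemma nrm_minus: "x \<in> V \<Longrightarrow> nrm (- x) = nrm x"
  by (simp add: nrm_def bilinear)

lemma nrm_diff: "x \<in> V \<Longrightarrow> y \<in> V \<Longrightarrow> nrm (x - y) \<le> nrm x + nrm y"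
  using nrm_triangle[of x "- y"] nrm_minus by simp

lemma nrm_commute: "x \<in> V \<Longrightarrow> y \<in> V \<Longrightarrow> nrm (x - y) = nrm (y - x)"
  using nrm_minus[of "x - y"] by simp

lemma tendsto_B:
  assumes "\<And>n. s n \<in> V" "l \<in> V" "q \<in> V" "(\<lambda>n::nat. nrm (s n - l)) \<longlonglongrightarrow> 0"
  shows "(\<lambda>n. B (s n) q) \<longlonglongrightarrow> B l q"
proof (rule LIM_zero_cancel, rule Lim_null_comparison)
  show "\<forall>\<^sub>F n in sequentially. norm (B (s n) q - B l q) \<le> nrm (s n - l) * nrm q"
    using assms cauchy_schwarz[of "s _ - l" q] by (simp add: diff_left)
  show "(\<lambda>n. nrm (s n - l) * nrm q) \<longlonglongrightarrow> 0"
    using tendsto_mult_left_zero[OF assms(4)] .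
qed

text \<open>Orthogonal projection onto a complete subspace: a minimizing sequence for the distance is Cauchy
  by the parallelogram identity, and its limit satisfies the orthogonality relations because the
  elements of the sequence do so approximately (\<open>quad_bound\<close>).\<close>

lemma projection:
  assumes W: "subspace W" "W \<subseteq> V" "complete_on W" and f: "f \<in> V"
  shows "\<exists>p\<in>W. \<forall>q\<in>W. B (f - p) q = 0"
proof -
  define A where "A = (\<lambda>q. B (f - q) (f - q)) ` W"
  define d where "d = Inf A"
  have "0 \<in> W" using W by (simp add: subspace_0)
  then have A: "A \<noteq> {}" "bdd_below A"
    using nonneg f W(2) by (auto simp: A_def intro!: bdd_belowI[of _ 0])
  have d: "d \<le> B (f - q) (f - q)" if "q \<in> W" for q
    unfolding d_def using A that by (intro cInf_lower) (auto simp: A_def)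
  have "\<exists>q\<in>W. B (f - q) (f - q) < d + 1 / real (Suc n)" for n
    using cInf_lessD[of A "d + 1 / real (Suc n)"] A by (auto simp: A_def d_def)
  then obtain s where s: "\<And>n. s n \<in> W" "\<And>n. B (f - s n) (f - s n) < d + 1 / real (Suc n)"
    by metis
  have sV: "s n \<in> V" for n using s W by auto
  have parallelogram: "B (s m - s n) (s m - s n) \<le> 2 / real (Suc m) + 2 / real (Suc n)" for m n
  proof -
    define q where "q = (1/2) *\<^sub>R s m + (1/2) *\<^sub>R s n"
    have q: "q \<in> W" unfolding q_def using s W by (intro subspace_add subspace_scale)
    have "B (s m - s n) (s m - s n) + 4 * B (f - q) (f - q) =
        2 * B (f - s m) (f - s m) + 2 * B (f - s n) (f - s n)"
      unfolding q_def using f sV sym[of f "s m"] sym[of f "s n"] sym[of "s m" "s n"]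
      by (simp add: bilinear algebra_simps)
    then show ?thesis using d[OF q] s(2)[of m] s(2)[of n] by linarith
  qed
  have "\<exists>N. \<forall>m\<ge>N. \<forall>n\<ge>N. nrm (s m - s n) < e" if "e > 0" for e
  proof -
    obtain N where N: "4 / e\<^sup>2 < real N" using reals_Archimedean2 by blast
    have "nrm (s m - s n) < e" if "m \<ge> N" "n \<ge> N" for m n
    proof -
      have "2 / real (Suc k) < e\<^sup>2 / 2" if "k \<ge> N" for k
      proof -
        have "4 / e\<^sup>2 < real (Suc k)" using N that by linarith
        then show ?thesis using \<open>e > 0\<close> by (simp add: field_simps)
      qed
      then have "B (s m - s n) (s m - s n) < e\<^sup>2"
        using parallelogram[of m n] that by (smt (verit) field_sum_of_halves)
      then show ?thesis using \<open>e > 0\<close> by (metis nrm_def real_less_rsqrt real_sqrt_less_iff real_sqrt_unique less_imp_le)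
    qed
    then show ?thesis by blast
  qed
  then obtain p where p: "p \<in> W" "(\<lambda>n. nrm (s n - p)) \<longlonglongrightarrow> 0"
    using W(3) s(1) unfolding complete_on_def by blast
  have "B (f - p) q = 0" if q: "q \<in> W" for q
  proof -
    have qV: "q \<in> V" and pV: "p \<in> V" using q p W by auto
    \<comment> \<open>\<open>s n\<close> minimizes the distance up to \<open>1 / (n + 1)\<close>, so perturbing it by \<open>t q\<close> gains at most that much.\<close>
    have bound: "(B (f - s n) q)\<^sup>2 \<le> 1 / real (Suc n) * B q q" for n
    proof (rule quad_bound)
      fix t
      have "s n + t *\<^sub>R q \<in> W" using W s q by (intro subspace_add subspace_scale)
      from d[OF this] have "d \<le> B ((f - s n) - t *\<^sub>R q) ((f - s n) - t *\<^sub>R q)"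
        by (simp add: diff_diff_eq)
      then show "- (1 / real (Suc n)) \<le> - 2 * t * B (f - s n) q + t\<^sup>2 * B q q"
        using quad[of "f - s n" q t] f sV qV s(2)[of n] by simp
    qed (simp add: nonneg qV)
    have "(\<lambda>n. B f q - B (s n) q) \<longlonglongrightarrow> B f q - B p q"
      by (intro tendsto_diff tendsto_const tendsto_B sV pV qV p)
    then have "(\<lambda>n. (B (f - s n) q)\<^sup>2) \<longlonglongrightarrow> (B (f - p) q)\<^sup>2"
      using f sV qV pV by (intro tendsto_power) (simp add: bilinear)
    moreover have "(\<lambda>n. (B (f - s n) q)\<^sup>2) \<longlonglongrightarrow> 0"
    proof (rule Lim_null_comparison)
      show "\<forall>\<^sub>F n in sequentially. norm ((B (f - s n) q)\<^sup>2) \<le> 1 / real (Suc n) * B q q"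
        using bound by simp
      show "(\<lambda>n. 1 / real (Suc n) * B q q) \<longlonglongrightarrow> 0"
        using LIMSEQ_inverse_real_of_nat by (intro tendsto_mult_left_zero) (simp add: inverse_eq_divide)
    qed
    ultimately have "(B (f - p) q)\<^sup>2 = 0" by (rule LIMSEQ_unique)
    then show ?thesis by simp
  qed
  then show ?thesis using p by blast
qed

end

text \<open>\<open>W\<close> is the graph of a closed linear operator (or relation) between complete spaces.\<close>

locale graph_space = H: semi_inner V1 B1 + G: semi_inner V2 B2
  for V1 :: "'v::real_vector set" and B1 and V2 :: "'w::real_vector set" and B2 +
  fixes W :: "('v \<times> 'w) set"
  assumes complete1: "H.complete_on V1" and complete2: "G.complete_on V2"
    and subspace_W: "subspace W" and W_sub: "W \<subseteq> V1 \<times> V2"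
    and W_closed: "(\<And>n::nat. (s n, t n) \<in> W) \<Longrightarrow> x \<in> V1 \<Longrightarrow> y \<in> V2 \<Longrightarrow>
      (\<lambda>n. H.nrm (s n - x)) \<longlonglongrightarrow> 0 \<Longrightarrow> (\<lambda>n. G.nrm (t n - y)) \<longlonglongrightarrow> 0 \<Longrightarrow> (x, y) \<in> W"
begin

lemma W_mem: "(x, y) \<in> W \<Longrightarrow> x \<in> V1" "(x, y) \<in> W \<Longrightarrow> y \<in> V2"
  using W_sub by auto

lemma W_diff: "(x, y) \<in> W \<Longrightarrow> (x', y') \<in> W \<Longrightarrow> (x - x', y - y') \<in> W"
  using subspace_diff[OF subspace_W, of "(x, y)" "(x', y')"] by simp

lemma W_scale: "(x, y) \<in> W \<Longrightarrow> (c *\<^sub>R x, c *\<^sub>R y) \<in> W"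
  using subspace_scale[OF subspace_W, of "(x, y)" c] by simp

text \<open>The projection of \<open>(f, g)\<close> onto \<open>W\<close> for the form \<open>\<delta> B1 + B2\<close>. For \<open>g = 0\<close> it solves the
  resolvent equation of the operator with graph \<open>W\<close>.\<close>

lemma graph_projection:
  assumes "\<delta> > 0" and f: "f \<in> V1" and g: "g \<in> V2"
  shows "\<exists>x y. (x, y) \<in> W \<and> (\<forall>(x', y')\<in>W. \<delta> * B1 (f - x) x' + B2 (g - y) y' = 0)"
proof -
  define B where "B = (\<lambda>p q. \<delta> * B1 (fst p) (fst q) + B2 (snd p) (snd q))"
  interpret P: semi_inner "V1 \<times> V2" B
  proof
    show "subspace (V1 \<times> V2)"
      using H.subspace_V G.subspace_V by (rule subspace_Times)
  qed (use \<open>\<delta> > 0\<close> in \<open>auto simp: B_def H.bilinear G.bilinear algebra_simps H.sym G.sym H.nonneg G.nonneg\<close>)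
  have N: "P.nrm p = sqrt (\<delta> * (H.nrm (fst p))\<^sup>2 + (G.nrm (snd p))\<^sup>2)" if "p \<in> V1 \<times> V2" for p
    unfolding P.nrm_def using that by (auto simp: B_def H.nrm_sq G.nrm_sq)
  have "P.complete_on W"
    unfolding P.complete_on_def
  proof (intro allI impI)
    fix s assume s: "\<forall>n. s n \<in> W"
      and cauchy: "\<forall>e>0. \<exists>N::nat. \<forall>m\<ge>N. \<forall>n\<ge>N. P.nrm (s m - s n) < e"
    define a where "a = (\<lambda>n. fst (s n))"
    define b where "b = (\<lambda>n. snd (s n))"
    have ab: "(a n, b n) \<in> W" for n using s by (simp add: a_def b_def)
    have sd: "s m - s n = (a m - a n, b m - b n)" for m n
      by (simp add: a_def b_def prod_eq_iff)
    have mem: "a n \<in> V1" "b n \<in> V2" for n using W_mem[OF ab] by auto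
    have N': "P.nrm (s m - s n) = sqrt (\<delta> * (H.nrm (a m - a n))\<^sup>2 + (G.nrm (b m - b n))\<^sup>2)" for m n
      using N[of "s m - s n"] mem by (simp add: sd)
    have "\<exists>N. \<forall>m\<ge>N. \<forall>n\<ge>N. H.nrm (a m - a n) < e" if "e > 0" for e
    proof -
      obtain N where N: "\<And>m n. m \<ge> N \<Longrightarrow> n \<ge> N \<Longrightarrow> P.nrm (s m - s n) < sqrt \<delta> * e"
        using cauchy \<open>\<delta> > 0\<close> \<open>e > 0\<close> by (metis mult_pos_pos real_sqrt_gt_0_iff)
      have "H.nrm (a m - a n) < e" if "m \<ge> N" "n \<ge> N" for m n
      proof -
        have "sqrt \<delta> * H.nrm (a m - a n) \<le> P.nrm (s m - s n)"
          unfolding N' using \<open>\<delta> > 0\<close> mem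
          by (intro real_le_rsqrt) (simp add: power_mult_distrib)
        then have "sqrt \<delta> * H.nrm (a m - a n) < sqrt \<delta> * e" using N[OF that] by linarith
        then show ?thesis using \<open>\<delta> > 0\<close> by simp
      qed
      then show ?thesis by blast
    qed
    then obtain x where x: "x \<in> V1" "(\<lambda>n. H.nrm (a n - x)) \<longlonglongrightarrow> 0"
      using complete1 mem unfolding H.complete_on_def by blast
    have "\<exists>N. \<forall>m\<ge>N. \<forall>n\<ge>N. G.nrm (b m - b n) < e" if "e > 0" for e
    proof -
      obtain N where N: "\<And>m n. m \<ge> N \<Longrightarrow> n \<ge> N \<Longrightarrow> P.nrm (s m - s n) < e"
        using cauchy \<open>e > 0\<close> by metis
      have "G.nrm (b m - b n) < e" if "m \<ge> N" "n \<ge> N" for m n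
      proof -
        have "G.nrm (b m - b n) \<le> P.nrm (s m - s n)"
          unfolding N' using \<open>\<delta> > 0\<close> by (intro real_le_rsqrt) simp
        then show ?thesis using N[OF that] by linarith
      qed
      then show ?thesis by blast
    qed
    then obtain y where y: "y \<in> V2" "(\<lambda>n. G.nrm (b n - y)) \<longlonglongrightarrow> 0"
      using complete2 mem unfolding G.complete_on_def by blast
    have "(x, y) \<in> W" using W_closed[OF ab x(1) y(1) x(2) y(2)] .
    moreover have "(\<lambda>n. P.nrm (s n - (x, y))) \<longlonglongrightarrow> 0"
    proof -
      have eq: "P.nrm (s n - (x, y)) = sqrt (\<delta> * (H.nrm (a n - x))\<^sup>2 + (G.nrm (b n - y))\<^sup>2)" for n
        using N[of "s n - (x, y)"] mem[of n] x y by (cases "s n") (auto simp: a_def b_def)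
      have "(\<lambda>n. sqrt (\<delta> * (H.nrm (a n - x))\<^sup>2 + (G.nrm (b n - y))\<^sup>2)) \<longlonglongrightarrow> sqrt (\<delta> * 0\<^sup>2 + 0\<^sup>2)"
        by (intro tendsto_intros x y)
      then show ?thesis by (simp add: eq)
    qed
    ultimately show "\<exists>l\<in>W. (\<lambda>n. P.nrm (s n - l)) \<longlonglongrightarrow> 0" by blast
  qed
  from P.projection[OF subspace_W W_sub this, of "(f, g)"] f g
  obtain p where p: "p \<in> W" "\<forall>q\<in>W. B ((f, g) - p) q = 0" by auto
  show ?thesis
  proof (intro exI conjI)
    show "(fst p, snd p) \<in> W" using p by simp
    show "\<forall>(x', y')\<in>W. \<delta> * B1 (f - fst p) x' + B2 (g - snd p) y' = 0"
      using p(2) by (auto simp: B_def)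
  qed
qed

text \<open>Let \<open>A\<close> be the operator with graph \<open>W\<close>. The hypothesis \<open>adj\<close> bounds the adjoint from below on the
  range of \<open>A\<close>: it reads \<open>|A x| \<le> c |d|\<close> whenever \<open>A\<^sup>* (A x) = d\<close>. The conclusion bounds \<open>A\<close> from
  below, with the same constant, on the orthogonal complement of its kernel.\<close>

lemma adjoint_bound_imp_bound:
  assumes c: "c \<ge> 0"
    and adj: "\<And>x y d. (x, y) \<in> W \<Longrightarrow> d \<in> V1 \<Longrightarrow> (\<And>x' y'. (x', y') \<in> W \<Longrightarrow> B2 y y' = B1 d x') \<Longrightarrow>
      G.nrm y \<le> c * H.nrm d"
    and ug: "(u, g) \<in> W" and ker: "\<And>x. (x, 0) \<in> W \<Longrightarrow> B1 u x = 0"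
  shows "H.nrm u \<le> c * G.nrm g"
proof -
  define \<delta> where "\<delta> = (\<lambda>k. 1 / real (Suc k))"
  have dpos: "\<delta> k > 0" for k by (simp add: \<delta>_def)
  have uV: "u \<in> V1" and gV: "g \<in> V2" using W_mem[OF ug] by auto
  have "\<exists>x y. (x, y) \<in> W \<and> (\<forall>(x', y')\<in>W. \<delta> k * B1 (u - x) x' + B2 (0 - y) y' = 0)" for k
    by (rule graph_projection[OF dpos uV]) simp
  then obtain \<psi> Q where "\<And>k. (\<psi> k, Q k) \<in> W \<and>
      (\<forall>(x', y')\<in>W. \<delta> k * B1 (u - \<psi> k) x' + B2 (0 - Q k) y' = 0)"
    by metis
  then have W: "(\<psi> k, Q k) \<in> W" and eq0: "\<forall>(x', y')\<in>W. \<delta> k * B1 (u - \<psi> k) x' + B2 (0 - Q k) y' = 0" for k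
    by auto
  have eq: "B2 (Q k) y' = \<delta> k * B1 (u - \<psi> k) x'" if "(x', y') \<in> W" for k x' y'
    using eq0[of k] that W_mem[OF that] W_mem[OF W[of k]] by (auto simp: G.bilinear)
  have pV: "\<psi> k \<in> V1" and QV: "Q k \<in> V2" for k using W_mem[OF W] by auto
  \<comment> \<open>Then \<open>A\<^sup>* (E k) = u - \<psi> k\<close>, and \<open>E k\<close> is the image of \<open>\<psi> k / \<delta> k\<close>.\<close>
  define E where "E = (\<lambda>k. (1 / \<delta> k) *\<^sub>R Q k)"
  have EV: "E k \<in> V2" for k by (simp add: E_def QV)
  have QE: "Q k = \<delta> k *\<^sub>R E k" for k using dpos[of k] by (simp add: E_def)
  have Eeq: "B2 (E k) y' = B1 (u - \<psi> k) x'" if "(x', y') \<in> W" for k x' y'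
    using eq[OF that, of k] W_mem[OF that] QV dpos[of k] by (simp add: E_def G.bilinear)
  have Ebound: "G.nrm (E k) \<le> c * H.nrm (u - \<psi> k)" for k
  proof (rule adj)
    show "((1 / \<delta> k) *\<^sub>R \<psi> k, E k) \<in> W" unfolding E_def by (rule W_scale[OF W])
  qed (auto simp: uV pV Eeq)
  define m where "m = c * G.nrm g"
  have m0: "m \<ge> 0" using c gV by (simp add: m_def)
  have ubound: "H.nrm (u - \<psi> k) \<le> m" for k
  proof -
    have "(H.nrm (u - \<psi> k))\<^sup>2 = B2 (E k) (g - Q k)"
      using Eeq[OF W_diff[OF ug W]] uV pV by (simp add: H.nrm_sq)
    also have "\<dots> = B2 (E k) g - \<delta> k * B2 (E k) (E k)"
      using EV gV by (simp add: QE G.bilinear)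
    also have "\<dots> \<le> B2 (E k) g" using dpos[of k] G.nonneg[OF EV] by simp
    also have "\<dots> \<le> G.nrm (E k) * G.nrm g" using G.cauchy_schwarz[OF EV gV, of k] by simp
    also have "\<dots> \<le> (c * H.nrm (u - \<psi> k)) * G.nrm g"
      by (intro mult_right_mono Ebound G.nrm_nonneg gV)
    finally have "H.nrm (u - \<psi> k) * H.nrm (u - \<psi> k) \<le> H.nrm (u - \<psi> k) * m"
      by (simp add: m_def power2_eq_square mult_ac)
    moreover have "0 \<le> H.nrm (u - \<psi> k)" using uV pV by simp
    ultimately show ?thesis
      using m0 by (cases "H.nrm (u - \<psi> k) = 0") auto
  qed
  define K where "K = c * m"
  have EK: "G.nrm (E k) \<le> K" for k
    using Ebound[of k] mult_left_mono[OF ubound c, of k] by (simp add: K_def)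
  have K0: "K \<ge> 0" using c m0 by (simp add: K_def)
  have QK: "G.nrm (Q k) \<le> \<delta> k * K" for k
    using EK[of k] dpos[of k] EV[of k] by (simp add: QE G.nrm_scale)
  have dlim: "\<delta> \<longlonglongrightarrow> 0"
    using LIMSEQ_inverse_real_of_nat by (simp add: \<delta>_def inverse_eq_divide)
  have Qlim: "(\<lambda>k. G.nrm (Q k - 0)) \<longlonglongrightarrow> 0"
    by (rule Lim_null_comparison[where g = "\<lambda>k. \<delta> k * K"])
      (use QK QV dlim in \<open>auto intro: tendsto_mult_left_zero\<close>)
  \<comment> \<open>Insert \<open>A\<^sup>* (E k - E j) = \<psi> j - \<psi> k\<close>; the images \<open>Q k\<close> are small as \<open>E k\<close> is bounded.\<close>
  have diff_bound: "(H.nrm (\<psi> j - \<psi> k))\<^sup>2 \<le> 2 * K * (K * (\<delta> j + \<delta> k))" for j k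
  proof -
    note Wjk = W_diff[OF W[of j] W[of k]]
    have "(H.nrm (\<psi> j - \<psi> k))\<^sup>2 = B1 (u - \<psi> k) (\<psi> j - \<psi> k) - B1 (u - \<psi> j) (\<psi> j - \<psi> k)"
      using uV pV by (simp add: H.nrm_sq H.bilinear)
    also have "\<dots> = B2 (E k - E j) (Q j - Q k)"
      using EV QV by (simp add: Eeq[OF Wjk, symmetric] G.diff_left)
    also have "\<dots> \<le> G.nrm (E k - E j) * G.nrm (Q j - Q k)"
      using G.cauchy_schwarz[of "E k - E j" "Q j - Q k"] EV QV by simp
    also have "\<dots> \<le> (K + K) * (\<delta> j * K + \<delta> k * K)"
      using G.nrm_diff[OF EV EV, of k j] G.nrm_diff[OF QV QV, of j k] EK[of k] EK[of j]
        QK[of j] QK[of k] K0 EV QV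
      by (intro mult_mono) auto
    finally show ?thesis by (simp add: algebra_simps)
  qed
  have "\<exists>N. \<forall>j\<ge>N. \<forall>k\<ge>N. H.nrm (\<psi> j - \<psi> k) < e" if "e > 0" for e
  proof -
    have "(\<lambda>k. 4 * K * K * \<delta> k) \<longlonglongrightarrow> 0" using tendsto_mult_right_zero[OF dlim] .
    then obtain N where N: "\<And>k. k \<ge> N \<Longrightarrow> 4 * K * K * \<delta> k < e\<^sup>2"
      using order_tendstoD(2)[of _ 0 sequentially "e\<^sup>2"] \<open>e > 0\<close>
      by (auto simp: eventually_sequentially)
    have "H.nrm (\<psi> j - \<psi> k) < e" if "j \<ge> N" "k \<ge> N" for j k
    proof -
      have "(H.nrm (\<psi> j - \<psi> k))\<^sup>2 < e\<^sup>2"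
        using diff_bound[of j k] N[OF that(1)] N[OF that(2)] by (simp add: algebra_simps)
      then show ?thesis using \<open>e > 0\<close> by (meson less_imp_le power_less_imp_less_base)
    qed
    then show ?thesis by blast
  qed
  then obtain w where w: "w \<in> V1" "(\<lambda>k. H.nrm (\<psi> k - w)) \<longlonglongrightarrow> 0"
    using complete1 pV unfolding H.complete_on_def by blast
  have w0: "(w, 0) \<in> W" by (rule W_closed[OF W w(1) _ w(2) Qlim]) simp
  \<comment> \<open>Both \<open>u\<close> and \<open>u - \<psi> k\<close>, which is in the range of \<open>A\<^sup>*\<close>, are orthogonal to the kernel.\<close>
  have "B1 (\<psi> k) w = 0" for k
    using Eeq[OF w0, of k] ker[OF w0] EV uV pV w by (simp add: H.bilinear)
  then have "B1 w w = 0"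
    using H.tendsto_B[OF pV w(1) w(1) w(2)] LIMSEQ_unique tendsto_const by (metis (no_types, lifting) ext)
  then have Nw: "H.nrm w = 0" by (simp add: H.nrm_def)
  have "H.nrm u \<le> m + H.nrm (\<psi> k - w)" for k
  proof -
    have "H.nrm u \<le> H.nrm (u - \<psi> k) + H.nrm (\<psi> k)"
      using H.nrm_triangle[of "u - \<psi> k" "\<psi> k"] uV pV by simp
    moreover have "H.nrm (\<psi> k) \<le> H.nrm (\<psi> k - w) + H.nrm w"
      using H.nrm_triangle[of "\<psi> k - w" w] pV w by simp
    ultimately show ?thesis using ubound[of k] Nw by linarith
  qed
  moreover have "(\<lambda>k. m + H.nrm (\<psi> k - w)) \<longlonglongrightarrow> m + 0" by (intro tendsto_intros w)
  ultimately have "H.nrm u \<le> m" by (intro LIMSEQ_le_const) auto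
  then show ?thesis by (simp add: m_def)
qed

end

section \<open>Completeness of the space of square integrable functions\<close>

lemma L2_D: "f \<in> L2 \<Omega> \<Longrightarrow> f \<in> borel_measurable (lebesgue_on \<Omega>)"
    "f \<in> L2 \<Omega> \<Longrightarrow> integrable (lebesgue_on \<Omega>) (\<lambda>x. (norm (f x))\<^sup>2)"
  by (auto simp: L2_def)

lemma integrable_inner_L2:
  assumes "f \<in> L2 \<Omega>" "g \<in> L2 \<Omega>"
  shows "integrable (lebesgue_on \<Omega>) (\<lambda>x. f x \<bullet> g x)"
proof (rule Bochner_Integration.integrable_bound)
  show "integrable (lebesgue_on \<Omega>) (\<lambda>x. (norm (f x))\<^sup>2 + (norm (g x))\<^sup>2)"
    using assms by (intro Bochner_Integration.integrable_add L2_D)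
  show "(\<lambda>x. f x \<bullet> g x) \<in> borel_measurable (lebesgue_on \<Omega>)"
    using L2_D(1)[OF assms(1)] L2_D(1)[OF assms(2)] by measurable
  have "\<bar>f x \<bullet> g x\<bar> \<le> (norm (f x))\<^sup>2 + (norm (g x))\<^sup>2" for x
  proof -
    have "2 * (norm (f x) * norm (g x)) \<le> (norm (f x))\<^sup>2 + (norm (g x))\<^sup>2"
      using sum_squares_bound[of "norm (f x)" "norm (g x)"] by simp
    moreover have "0 \<le> norm (f x) * norm (g x)" by simp
    ultimately show ?thesis using Cauchy_Schwarz_ineq2[of "f x" "g x"] by linarith
  qed
  then show "AE x in lebesgue_on \<Omega>. norm (f x \<bullet> g x) \<le> norm ((norm (f x))\<^sup>2 + (norm (g x))\<^sup>2)"
    by simp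
qed

lemma subspace_L2: "subspace (L2 \<Omega> :: (real^3 \<Rightarrow> 'b::euclidean_space) set)"
proof (rule subspaceI)
  fix f g :: "real^3 \<Rightarrow> 'b" and c :: real
  assume f: "f \<in> L2 \<Omega>"
  note [measurable] = L2_D(1)[OF f]
  show "c *\<^sub>R f \<in> L2 \<Omega>"
    using L2_D(2)[OF f] by (simp add: L2_def power_mult_distrib scaleR_fun_def)
  assume g: "g \<in> L2 \<Omega>"
  note [measurable] = L2_D(1)[OF g]
  have "integrable (lebesgue_on \<Omega>) (\<lambda>x. (norm (f x))\<^sup>2 + 2 * (f x \<bullet> g x) + (norm (g x))\<^sup>2)"
    using f g by (intro Bochner_Integration.integrable_add integrable_mult_right L2_D integrable_inner_L2)
  moreover have "(norm (f x))\<^sup>2 + 2 * (f x \<bullet> g x) + (norm (g x))\<^sup>2 = (norm (f x + g x))\<^sup>2" for x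
    by (simp add: power2_norm_eq_inner inner_add_left inner_add_right inner_commute)
  ultimately show "f + g \<in> L2 \<Omega>"
    by (simp add: L2_def plus_fun_def)
qed (simp add: L2_def zero_fun_def)

lemma semi_inner_L2: "semi_inner (L2 \<Omega> :: (real^3 \<Rightarrow> 'b::euclidean_space) set) (l2_inner \<Omega>)"
proof
  show "l2_inner \<Omega> x y = l2_inner \<Omega> y x" for x y :: "real^3 \<Rightarrow> 'b"
    by (simp add: l2_inner_def inner_commute)
  show "l2_inner \<Omega> (x + y) z = l2_inner \<Omega> x z + l2_inner \<Omega> y z"
    if "x \<in> L2 \<Omega>" "y \<in> L2 \<Omega>" "z \<in> L2 \<Omega>" for x y z :: "real^3 \<Rightarrow> 'b"
    using that by (simp add: l2_inner_def inner_add_left integrable_inner_L2)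
  show "l2_inner \<Omega> (c *\<^sub>R x) z = c * l2_inner \<Omega> x z" for c and x z :: "real^3 \<Rightarrow> 'b"
    by (simp add: l2_inner_def)
qed (auto simp: subspace_L2 l2_inner_def)

lemma nrm_L2: "semi_inner.nrm (l2_inner \<Omega>) f = l2_norm \<Omega> f"
  unfolding semi_inner.nrm_def[OF semi_inner_L2] l2_norm_def ..

lemma l2_norm_sq_integral: "(l2_norm \<Omega> f)\<^sup>2 = (LINT x|lebesgue_on \<Omega>. (norm (f x))\<^sup>2)"
  by (simp add: l2_norm_def l2_inner_def power2_norm_eq_inner)

lemma nn_integral_norm_sq:
  "f \<in> L2 \<Omega> \<Longrightarrow> (\<integral>\<^sup>+x. ennreal ((norm (f x))\<^sup>2) \<partial>lebesgue_on \<Omega>) = ennreal ((l2_norm \<Omega> f)\<^sup>2)"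
  unfolding l2_norm_sq_integral by (intro nn_integral_eq_integral L2_D) auto

text \<open>The form in which Fatou's lemma yields membership in \<open>L2\<close> and a norm bound at once.\<close>

lemma L2_bound:
  fixes f :: "real^3 \<Rightarrow> 'b::euclidean_space"
  assumes [measurable]: "f \<in> borel_measurable (lebesgue_on \<Omega>)" and "e \<ge> 0"
    and le: "(\<integral>\<^sup>+x. ennreal ((norm (f x))\<^sup>2) \<partial>lebesgue_on \<Omega>) \<le> ennreal (e\<^sup>2)"
  shows "f \<in> L2 \<Omega>" "l2_norm \<Omega> f \<le> e"
proof -
  show f: "f \<in> L2 \<Omega>"
    unfolding L2_def
    by (auto intro!: integrableI_bounded order.strict_trans1[OF le])
  have "(l2_norm \<Omega> f)\<^sup>2 \<le> e\<^sup>2"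
    using le nn_integral_norm_sq[OF f] by simp
  then show "l2_norm \<Omega> f \<le> e" using \<open>e \<ge> 0\<close> by (rule power2_le_imp_le)
qed

text \<open>Boundedness makes the measure finite, so that constants are square integrable.\<close>

locale bounded_open =
  fixes \<Omega> :: "(real^3) set"
  assumes open_dom: "open \<Omega>" and bounded_dom: "bounded \<Omega>"
begin

lemma lmeas: "\<Omega> \<in> lmeasurable"
  using open_dom bounded_dom by (rule lmeasurable_open[rotated])

sublocale fin: finite_measure "lebesgue_on \<Omega>"
  by (rule finite_measure_lebesgue_on[OF lmeas])

lemma const_L2: "(\<lambda>x. c) \<in> L2 \<Omega>"
  by (simp add: L2_def)

lemma bounded_L2:
  fixes f :: "real^3 \<Rightarrow> 'b::euclidean_space"
  assumes [measurable]: "f \<in> borel_measurable (lebesgue_on \<Omega>)"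
    and "\<And>x. x \<in> \<Omega> \<Longrightarrow> norm (f x) \<le> K"
  shows "f \<in> L2 \<Omega>"
proof -
  have "integrable (lebesgue_on \<Omega>) (\<lambda>x. (norm (f x))\<^sup>2)"
  proof (rule Bochner_Integration.integrable_bound[of _ "\<lambda>x. K\<^sup>2"])
    show "AE x in lebesgue_on \<Omega>. norm ((norm (f x))\<^sup>2) \<le> norm (K\<^sup>2)"
      using assms(2) by (auto intro!: AE_I2 power_mono)
  qed auto
  then show ?thesis by (simp add: L2_def)
qed

lemma integrable_L2: "f \<in> L2 \<Omega> \<Longrightarrow> integrable (lebesgue_on \<Omega>) (f :: real^3 \<Rightarrow> real)"
  using integrable_inner_L2[OF _ const_L2[of "1::real"], of f] by simp

text \<open>The theorem of Riesz and Fischer. A subsequence with norm differences \<open>2\<^sup>-\<^sup>k\<close> converges almost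
  everywhere; its limit is the limit in \<open>L2\<close> by Fatou's lemma.\<close>

lemma complete_L2:
  "semi_inner.complete_on (l2_inner \<Omega>) (L2 \<Omega> :: (real^3 \<Rightarrow> 'b::euclidean_space) set)"
proof -
  interpret S: semi_inner "L2 \<Omega> :: (real^3 \<Rightarrow> 'b) set" "l2_inner \<Omega>" by (rule semi_inner_L2)
  interpret R: semi_inner "L2 \<Omega> :: (real^3 \<Rightarrow> real) set" "l2_inner \<Omega>" by (rule semi_inner_L2)
  show ?thesis
    unfolding S.complete_on_def nrm_L2
  proof (intro allI impI)
    fix s :: "nat \<Rightarrow> real^3 \<Rightarrow> 'b"
    assume s: "\<forall>n. s n \<in> L2 \<Omega>"
      and cauchy: "\<forall>e>0. \<exists>N. \<forall>m\<ge>N. \<forall>n\<ge>N. l2_norm \<Omega> (s m - s n) < e"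
    have [measurable]: "s n \<in> borel_measurable (lebesgue_on \<Omega>)" for n
      using s L2_D(1) by blast
    have ex: "\<exists>N. \<forall>m\<ge>N. \<forall>n\<ge>N. l2_norm \<Omega> (s m - s n) < (1/2) ^ k" for k :: nat
      using cauchy by simp
    define r where "r = rec_nat (SOME N. \<forall>m\<ge>N. \<forall>n\<ge>N. l2_norm \<Omega> (s m - s n) < (1/2) ^ (0::nat))
      (\<lambda>k N'. max (Suc N') (SOME N. \<forall>m\<ge>N. \<forall>n\<ge>N. l2_norm \<Omega> (s m - s n) < (1/2) ^ (Suc k)))"
    have r_bound: "l2_norm \<Omega> (s m - s n) < (1/2) ^ k" if "m \<ge> r k" "n \<ge> r k" for m n k
    proof -
      have "(SOME N. \<forall>m\<ge>N. \<forall>n\<ge>N. l2_norm \<Omega> (s m - s n) < (1/2) ^ k) \<le> r k"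
        by (cases k) (auto simp: r_def)
      then show ?thesis using someI_ex[OF ex[of k]] that by (meson order_trans)
    qed
    have "strict_mono r"
      by (rule strict_mono_Suc_iff[THEN iffD2]) (auto simp: r_def less_Suc_eq_le)
    then have r_ge: "r k \<ge> k" and r_mono: "j \<le> k \<Longrightarrow> r j \<le> r k" for j k
      by (auto simp: strict_mono_imp_increasing strict_mono_leD)
    define g where "g = (\<lambda>k x. norm (s (r (Suc k)) x - s (r k) x))"
    have gm [measurable]: "g k \<in> borel_measurable (lebesgue_on \<Omega>)" for k
      unfolding g_def by measurable
    have gL2: "g k \<in> L2 \<Omega>" and gN: "l2_norm \<Omega> (g k) \<le> (1/2) ^ k" for k
    proof -
      have d: "s (r (Suc k)) - s (r k) \<in> L2 \<Omega>" using s by simp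
      have eq: "(\<lambda>x. (norm (g k x))\<^sup>2) = (\<lambda>x. (norm ((s (r (Suc k)) - s (r k)) x))\<^sup>2)"
        by (simp add: g_def)
      show "g k \<in> L2 \<Omega>" using L2_D(2)[OF d] gm unfolding L2_def mem_Collect_eq eq by simp
      have "(l2_norm \<Omega> (g k))\<^sup>2 = (l2_norm \<Omega> (s (r (Suc k)) - s (r k)))\<^sup>2"
        unfolding l2_norm_sq_integral eq ..
      then have "l2_norm \<Omega> (g k) = l2_norm \<Omega> (s (r (Suc k)) - s (r k))"
        by (metis S.nrm_nonneg R.nrm_nonneg \<open>g k \<in> L2 \<Omega>\<close> d nrm_L2 power2_eq_imp_eq)
      then show "l2_norm \<Omega> (g k) \<le> (1/2) ^ k"
        using r_bound[of k "r (Suc k)" "r k"] r_mono[of k "Suc k"] by simp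
    qed
    \<comment> \<open>As the measure is finite, the norm of the constant \<open>1\<close> turns \<open>L2\<close> bounds into \<open>L1\<close> bounds.\<close>
    define C where "C = l2_norm \<Omega> (\<lambda>x. 1::real)"
    have C: "C \<ge> 0" unfolding C_def using R.nrm_nonneg[OF const_L2] by (simp add: nrm_L2)
    have gI: "(\<integral>\<^sup>+x. ennreal (g k x) \<partial>lebesgue_on \<Omega>) \<le> ennreal ((1/2) ^ k * C)" for k
    proof -
      have "(\<integral>\<^sup>+x. ennreal (g k x) \<partial>lebesgue_on \<Omega>) = ennreal (LINT x|lebesgue_on \<Omega>. g k x)"
        by (intro nn_integral_eq_integral integrable_L2 gL2) (simp add: g_def)
      also have "(LINT x|lebesgue_on \<Omega>. g k x) = l2_inner \<Omega> (g k) (\<lambda>x. 1)"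
        by (simp add: l2_inner_def)
      also have "\<dots> \<le> l2_norm \<Omega> (g k) * C"
        using R.cauchy_schwarz[OF gL2 const_L2, of k 1] by (simp add: nrm_L2 C_def)
      also have "\<dots> \<le> (1/2) ^ k * C" by (intro mult_right_mono gN C)
      finally show ?thesis by (simp add: ennreal_leI)
    qed
    have "(\<integral>\<^sup>+x. (\<Sum>k. ennreal (g k x)) \<partial>lebesgue_on \<Omega>) = (\<Sum>k. \<integral>\<^sup>+x. ennreal (g k x) \<partial>lebesgue_on \<Omega>)"
      by (rule nn_integral_suminf) measurable
    also have "\<dots> \<le> (\<Sum>k. ennreal ((1/2) ^ k * C))"
      by (intro suminf_le gI) auto
    also have "\<dots> = ennreal (\<Sum>k. (1/2) ^ k * C)"
      using C by (intro suminf_ennreal2) (auto intro!: summable_mult2 summable_geometric)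
    also have "\<dots> < \<infinity>" by simp
    finally have "AE x in lebesgue_on \<Omega>. (\<Sum>k. ennreal (g k x)) \<noteq> \<infinity>"
      by (intro nn_integral_noteq_infinite) auto
    then have conv: "AE x in lebesgue_on \<Omega>. (\<lambda>k. s (r k) x) \<longlonglongrightarrow> lim (\<lambda>k. s (r k) x)"
    proof eventually_elim
      case (elim x)
      have "summable (\<lambda>k. g k x)"
        using elim by (intro summable_suminf_not_top) (auto simp: g_def)
      then have "summable (\<lambda>k. s (r (Suc k)) x - s (r k) x)"
        unfolding g_def by (rule summable_norm_cancel)
      then have "convergent (\<lambda>k. s (r k) x)"
        using sum_lessThan_telescope[of "\<lambda>k. s (r k) x"]
        by (simp add: summable_iff_convergent convergent_diff_const_right_iff)
      then show ?case by (simp add: convergent_LIMSEQ_iff)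
    qed
    define l where "l = (\<lambda>x. lim (\<lambda>k. s (r k) x))"
    have lm [measurable]: "l \<in> borel_measurable (lebesgue_on \<Omega>)"
      unfolding l_def by measurable
    have key: "s n - l \<in> L2 \<Omega> \<and> l2_norm \<Omega> (s n - l) \<le> (1/2) ^ k" if "n \<ge> r k" for n k
    proof -
      have "(\<integral>\<^sup>+x. ennreal ((norm ((s n - l) x))\<^sup>2) \<partial>lebesgue_on \<Omega>) =
          (\<integral>\<^sup>+x. liminf (\<lambda>j. ennreal ((norm ((s n - s (r j)) x))\<^sup>2)) \<partial>lebesgue_on \<Omega>)"
      proof (rule nn_integral_cong_AE)
        show "AE x in lebesgue_on \<Omega>. ennreal ((norm ((s n - l) x))\<^sup>2) =
            liminf (\<lambda>j. ennreal ((norm ((s n - s (r j)) x))\<^sup>2))"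
          using conv
        proof eventually_elim
          case (elim x)
          have "(\<lambda>j. ennreal ((norm ((s n - s (r j)) x))\<^sup>2)) \<longlonglongrightarrow> ennreal ((norm ((s n - l) x))\<^sup>2)"
            using elim by (auto simp: l_def intro!: tendsto_intros)
          from lim_imp_Liminf[OF _ this] show ?case by simp
        qed
      qed
      also have "\<dots> \<le> liminf (\<lambda>j. \<integral>\<^sup>+x. ennreal ((norm ((s n - s (r j)) x))\<^sup>2) \<partial>lebesgue_on \<Omega>)"
        by (rule nn_integral_liminf) (simp add: fun_diff_def)
      also have "\<dots> \<le> ennreal (((1/2) ^ k)\<^sup>2)"
      proof (rule Liminf_le)
        show "\<forall>\<^sub>F j in sequentially. (\<integral>\<^sup>+x. ennreal ((norm ((s n - s (r j)) x))\<^sup>2) \<partial>lebesgue_on \<Omega>)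
            \<le> ennreal (((1/2) ^ k)\<^sup>2)"
          unfolding eventually_sequentially
        proof (intro exI allI impI)
          fix j assume "k \<le> j"
          have d: "s n - s (r j) \<in> L2 \<Omega>" using s by simp
          have "l2_norm \<Omega> (s n - s (r j)) \<le> (1/2) ^ k"
            using r_bound[OF that r_mono[OF \<open>k \<le> j\<close>]] by simp
          then show "(\<integral>\<^sup>+x. ennreal ((norm ((s n - s (r j)) x))\<^sup>2) \<partial>lebesgue_on \<Omega>) \<le> ennreal (((1/2) ^ k)\<^sup>2)"
            unfolding nn_integral_norm_sq[OF d]
            using S.nrm_nonneg[OF d] by (intro ennreal_leI power_mono) (auto simp: nrm_L2)
        qed
      qed simp
      finally show ?thesis
        using L2_bound[of "s n - l" \<Omega> "(1/2) ^ k"] by (simp add: fun_diff_def)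
    qed
    have "s (r 0) \<in> L2 \<Omega>" "s (r 0) - l \<in> L2 \<Omega>" using key[of 0 "r 0"] s by auto
    from S.mem(4)[OF this] have lL2: "l \<in> L2 \<Omega>" by simp
    have "(\<lambda>n. l2_norm \<Omega> (s n - l)) \<longlonglongrightarrow> 0"
    proof (rule LIMSEQ_I)
      fix e :: real assume "e > 0"
      then obtain k where k: "(1/2) ^ k < e" using real_arch_pow_inv[of e "1/2"] by auto
      have "norm (l2_norm \<Omega> (s n - l) - 0) < e" if "n \<ge> r k" for n
      proof -
        have "0 \<le> l2_norm \<Omega> (s n - l)" using S.nrm_nonneg[of "s n - l"] key[OF that] by (simp add: nrm_L2)
        then show ?thesis using key[OF that] k by simp
      qed
      then show "\<exists>N. \<forall>n\<ge>N. norm (l2_norm \<Omega> (s n - l) - 0) < e" by blast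
    qed
    with lL2 show "\<exists>l\<in>L2 \<Omega>. (\<lambda>n. l2_norm \<Omega> (s n - l)) \<longlonglongrightarrow> 0" by blast
  qed
qed

sublocale S: semi_inner "L2 \<Omega> :: (real^3 \<Rightarrow> real) set" "l2_inner \<Omega>" by (rule semi_inner_L2)
sublocale X: semi_inner "L2 \<Omega> :: (real^3 \<Rightarrow> real^3) set" "l2_inner \<Omega>" by (rule semi_inner_L2)

end

section \<open>Smooth functions and test functions\<close>

lemma partial_eqI: "(f has_derivative f') (at x) \<Longrightarrow> partial i f x = f' (axis i 1)"
  unfolding partial_def using frechet_derivative_at by metis

lemma has_derivative_partial:
  assumes "f differentiable at (y + s *\<^sub>R axis i 1)"
  shows "((\<lambda>s. f (y + s *\<^sub>R axis i 1)) has_vector_derivative partial i f (y + s *\<^sub>R axis i 1)) (at s)"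
proof -
  let ?D = "frechet_derivative f (at (y + s *\<^sub>R axis i 1))"
  have D: "(f has_derivative ?D) (at (y + s *\<^sub>R axis i 1))"
    using assms frechet_derivative_works by blast
  have "((\<lambda>s. y + s *\<^sub>R axis i 1) has_derivative (\<lambda>t. t *\<^sub>R axis i 1)) (at s)"
    by (auto intro!: derivative_eq_intros)
  from has_derivative_compose[OF this D]
  have "((\<lambda>s. f (y + s *\<^sub>R axis i 1)) has_derivative (\<lambda>t. ?D (t *\<^sub>R axis i 1))) (at s)" .
  moreover have "?D (t *\<^sub>R axis i 1) = t *\<^sub>R ?D (axis i 1)" for t
    using linear_frechet_derivative[OF assms] by (rule linear_scale)
  ultimately show ?thesis by (simp add: has_vector_derivative_def partial_def)
qed

lemma partial_linear:
  assumes "f differentiable at x" "bounded_linear L"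
  shows "partial i (\<lambda>y. L (f y)) x = L (partial i f x)"
    and "(\<lambda>y. L (f y)) differentiable at x"
proof -
  have "((\<lambda>y. L (f y)) has_derivative (\<lambda>h. L (frechet_derivative f (at x) h))) (at x)"
    using assms frechet_derivative_works bounded_linear.has_derivative by blast
  then show "partial i (\<lambda>y. L (f y)) x = L (partial i f x)"
    "(\<lambda>y. L (f y)) differentiable at x"
    by (auto simp: partial_eqI differentiable_def) (simp add: partial_def)
qed

lemma partial_add:
  assumes "f differentiable at x" "g differentiable at x"
  shows "partial i (\<lambda>y. f y + g y) x = partial i f x + partial i g x"
proof -
  have "((\<lambda>y. f y + g y) has_derivative
      (\<lambda>h. frechet_derivative f (at x) h + frechet_derivative g (at x) h)) (at x)"
    using assms frechet_derivative_works has_derivative_add by blast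
  then show ?thesis by (simp add: partial_eqI) (simp add: partial_def)
qed

lemma partial_add_scale:
  fixes f g :: "real^3 \<Rightarrow> real"
  assumes "f differentiable at x" "g differentiable at x"
  shows "partial i (\<lambda>x. f x + c * g x) x = partial i f x + c * partial i g x"
  using partial_add[OF assms(1) partial_linear(2)[OF assms(2) bounded_linear_mult_right]]
    partial_linear(1)[OF assms(2) bounded_linear_mult_right] by simp

lemma partial_mult:
  fixes f g :: "real^3 \<Rightarrow> real"
  assumes "f differentiable at x" "g differentiable at x"
  shows "partial i (\<lambda>y. f y * g y) x = f x * partial i g x + partial i f x * g x"
proof -
  have "((\<lambda>y. f y * g y) has_derivative
      (\<lambda>h. f x * frechet_derivative g (at x) h + frechet_derivative f (at x) h * g x)) (at x)"
    using assms frechet_derivative_works by (intro has_derivative_mult) auto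
  then show ?thesis by (simp add: partial_eqI) (simp add: partial_def)
qed

lemma smooth_differentiable: "smooth f \<Longrightarrow> f differentiable at x"
  unfolding smooth_def by (metis iter_partial.simps(1))

lemma smooth_continuous: "smooth f \<Longrightarrow> continuous_on S f"
  by (meson continuous_at_imp_continuous_on differentiable_imp_continuous_within smooth_differentiable)

lemma iter_partial_append: "iter_partial (is @ [i]) f = iter_partial is (partial i f)"
  by (induction "is") auto

lemma smooth_partial: "smooth f \<Longrightarrow> smooth (partial i f)"
  unfolding smooth_def by (metis iter_partial_append)

text \<open>A coinduction principle: membership in a set of differentiable functions that is
  stable under partial derivatives entails smoothness.\<close>

lemma smooth_coinduct:
  assumes "f \<in> C" and "\<And>g x. g \<in> C \<Longrightarrow> g differentiable at x"
    and "\<And>g i. g \<in> C \<Longrightarrow> partial i g \<in> C"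
  shows "smooth f"
proof -
  have "iter_partial is f \<in> C" for "is" by (induction "is") (auto simp: assms)
  then show ?thesis using assms(2) by (auto simp: smooth_def)
qed

lemma smooth_linear: "smooth f \<Longrightarrow> bounded_linear L \<Longrightarrow> smooth (\<lambda>x. L (f x))"
proof (rule smooth_coinduct[where C = "{\<lambda>x. L (g x) | g. smooth g}"])
  fix h i assume L: "bounded_linear L" and "h \<in> {\<lambda>x. L (g x) | g. smooth g}"
  then obtain g where g: "h = (\<lambda>x. L (g x))" "smooth g" by blast
  then have "partial i h = (\<lambda>x. L (partial i g x))"
    using partial_linear(1)[OF smooth_differentiable L] by (auto simp: g)
  then show "partial i h \<in> {\<lambda>x. L (g x) | g. smooth g}" using smooth_partial g by blast
qed (auto intro: partial_linear smooth_differentiable)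

lemma smooth_add: "smooth f \<Longrightarrow> smooth g \<Longrightarrow> smooth (\<lambda>x. f x + g x)"
proof (rule smooth_coinduct[where C = "{\<lambda>x. f x + g x | f g. smooth f \<and> smooth g}"])
  fix h i assume "h \<in> {\<lambda>x. f x + g x | f g. smooth f \<and> smooth g}"
  then obtain f g where h: "h = (\<lambda>x. f x + g x)" "smooth f" "smooth g" by blast
  then have "partial i h = (\<lambda>x. partial i f x + partial i g x)"
    by (simp add: h fun_eq_iff partial_add smooth_differentiable)
  then show "partial i h \<in> {\<lambda>x. f x + g x | f g. smooth f \<and> smooth g}"
    using smooth_partial h by blast
qed (auto intro: differentiable_add smooth_differentiable)

lemma smooth_const: "smooth (\<lambda>x. c)"
  by (rule smooth_coinduct[where C = "range (\<lambda>c x. c)"]) (auto simp: partial_def[abs_def])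

lemma smooth_diff: "smooth f \<Longrightarrow> smooth g \<Longrightarrow> smooth (\<lambda>x. f x - g x)"
  using smooth_add[of f "\<lambda>x. - g x"] smooth_linear[of g uminus]
  by (simp add: bounded_linear_minus bounded_linear_ident)

lemma smooth_sum: "finite I \<Longrightarrow> (\<And>i. i \<in> I \<Longrightarrow> smooth (f i)) \<Longrightarrow> smooth (\<lambda>x. \<Sum>i\<in>I. f i x)"
  by (induction I rule: finite_induct) (auto simp: smooth_const smooth_add)

lemma smooth_vecI:
  fixes f :: "real^3 \<Rightarrow> real^3"
  assumes "\<And>i. smooth (\<lambda>x. f x $ i)"
  shows "smooth f"
proof -
  have "f = (\<lambda>x. \<Sum>i\<in>UNIV. (f x $ i) *\<^sub>R axis i 1)"
    by (simp add: vec_eq_iff sum_component axis_def fun_eq_iff if_distrib cong: if_cong)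
  moreover have "smooth (\<lambda>x. \<Sum>i\<in>UNIV. (f x $ i) *\<^sub>R (axis i 1 :: real^3))"
    by (intro smooth_sum smooth_linear[OF assms] bounded_linear_scaleR_left) auto
  ultimately show ?thesis by metis
qed

lemma smooth_component: "smooth f \<Longrightarrow> smooth (\<lambda>x. f x $ i)"
  by (rule smooth_linear[OF _ bounded_linear_vec_nth])

lemma smooth_grad: "smooth f \<Longrightarrow> smooth (grad f)"
  by (rule smooth_vecI) (simp add: grad_def smooth_partial)

lemma smooth_divergence: "smooth f \<Longrightarrow> smooth (divergence f)"
  unfolding divergence_def by (intro smooth_sum smooth_partial smooth_component) auto

lemma smooth_curl: "smooth f \<Longrightarrow> smooth (curl f)"
proof (rule smooth_vecI)
  fix i assume f: "smooth f"
  have "\<forall>i. smooth (\<lambda>x. curl f x $ i)"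
    using f by (simp add: curl_def Let_def forall_3 smooth_diff smooth_partial smooth_component)
  then show "smooth (\<lambda>x. curl f x $ i)" ..
qed

text \<open>Two applications of the mean value theorem to the second difference over a square of side \<open>h\<close>.\<close>

lemma second_difference:
  fixes f :: "real^3 \<Rightarrow> real"
  assumes f: "smooth f" and h: "h > 0"
  shows "\<exists>s t. 0 < s \<and> s < h \<and> 0 < t \<and> t < h \<and>
    f (x + h *\<^sub>R axis i 1 + h *\<^sub>R axis j 1) - f (x + h *\<^sub>R axis i 1) - f (x + h *\<^sub>R axis j 1) + f x
    = h\<^sup>2 * partial j (partial i f) (x + s *\<^sub>R axis i 1 + t *\<^sub>R axis j 1)"
proof -
  have D: "((\<lambda>s. g (y + s *\<^sub>R axis k 1)) has_real_derivative partial k g (y + s *\<^sub>R axis k 1)) (at s)"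
    if "smooth g" for g :: "real^3 \<Rightarrow> real" and y k s
    using has_derivative_partial[OF smooth_differentiable[OF that]]
    by (simp add: has_real_derivative_iff_has_vector_derivative)
  let ?g = "\<lambda>s. f ((x + h *\<^sub>R axis j 1) + s *\<^sub>R axis i 1) - f (x + s *\<^sub>R axis i 1)"
  have "(?g has_real_derivative
      (partial i f ((x + h *\<^sub>R axis j 1) + s *\<^sub>R axis i 1) - partial i f (x + s *\<^sub>R axis i 1))) (at s)" for s
    by (intro DERIV_diff D f)
  from MVT2[OF h this] obtain s where s: "0 < s" "s < h"
    "?g h - ?g 0 = (h - 0) * (partial i f ((x + h *\<^sub>R axis j 1) + s *\<^sub>R axis i 1) - partial i f (x + s *\<^sub>R axis i 1))"
    by blast
  let ?k = "\<lambda>t. partial i f ((x + s *\<^sub>R axis i 1) + t *\<^sub>R axis j 1)"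
  from MVT2[OF h D[OF smooth_partial[OF f, of i], where y = "x + s *\<^sub>R axis i 1" and k = j]]
  obtain t where t: "0 < t" "t < h"
    "?k h - ?k 0 = (h - 0) * partial j (partial i f) ((x + s *\<^sub>R axis i 1) + t *\<^sub>R axis j 1)"
    by blast
  have "f (x + h *\<^sub>R axis i 1 + h *\<^sub>R axis j 1) - f (x + h *\<^sub>R axis i 1) - f (x + h *\<^sub>R axis j 1) + f x
      = ?g h - ?g 0" by (simp add: add_ac)
  also have "\<dots> = h * (?k h - ?k 0)" using s(3) by (simp add: add_ac)
  also have "\<dots> = h\<^sup>2 * partial j (partial i f) (x + s *\<^sub>R axis i 1 + t *\<^sub>R axis j 1)"
    using t(3) by (simp add: power2_eq_square)
  finally show ?thesis using s(1,2) t(1,2) by blast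
qed

text \<open>Both mixed derivatives are limits of the second difference quotient, which is symmetric in \<open>i\<close> and \<open>j\<close>.\<close>

lemma partial_commute:
  fixes f :: "real^3 \<Rightarrow> real"
  assumes f: "smooth f"
  shows "partial i (partial j f) x = partial j (partial i f) x"
proof (rule ccontr)
  let ?p = "partial i (partial j f)" and ?q = "partial j (partial i f)"
  assume ne: "?p x \<noteq> ?q x"
  define e where "e = \<bar>?p x - ?q x\<bar> / 2"
  have e: "e > 0" using ne by (simp add: e_def)
  have cont: "isCont ?p x" "isCont ?q x"
    using smooth_partial[OF smooth_partial[OF f]] smooth_differentiable
      differentiable_imp_continuous_within by blast+
  obtain d1 where d1: "d1 > 0" "\<And>y. dist y x < d1 \<Longrightarrow> dist (?p y) (?p x) < e"
    using cont(1) e unfolding continuous_at_eps_delta by metis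
  obtain d2 where d2: "d2 > 0" "\<And>y. dist y x < d2 \<Longrightarrow> dist (?q y) (?q x) < e"
    using cont(2) e unfolding continuous_at_eps_delta by metis
  define h where "h = min d1 d2 / 2"
  have h: "h > 0" using d1 d2 by (simp add: h_def)
  have near: "dist (x + s *\<^sub>R axis k 1 + t *\<^sub>R axis l 1) x < 2 * h"
    if "0 < s" "s < h" "0 < t" "t < h" for s t and k l :: 3
  proof -
    have "norm (s *\<^sub>R axis k 1 + t *\<^sub>R axis l 1 :: real^3) \<le> s + t"
      using norm_triangle_ineq[of "s *\<^sub>R axis k 1 :: real^3" "t *\<^sub>R axis l 1"] that
      by (simp add: norm_axis_1)
    then show ?thesis using that by (simp add: dist_norm add.assoc)
  qed
  obtain s t where st: "0 < s" "s < h" "0 < t" "t < h"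
    "f (x + h *\<^sub>R axis i 1 + h *\<^sub>R axis j 1) - f (x + h *\<^sub>R axis i 1) - f (x + h *\<^sub>R axis j 1) + f x
    = h\<^sup>2 * ?q (x + s *\<^sub>R axis i 1 + t *\<^sub>R axis j 1)" using second_difference[OF f h] by blast
  obtain s' t' where st': "0 < s'" "s' < h" "0 < t'" "t' < h"
    "f (x + h *\<^sub>R axis j 1 + h *\<^sub>R axis i 1) - f (x + h *\<^sub>R axis j 1) - f (x + h *\<^sub>R axis i 1) + f x
    = h\<^sup>2 * ?p (x + s' *\<^sub>R axis j 1 + t' *\<^sub>R axis i 1)" using second_difference[OF f h] by blast
  have "h\<^sup>2 * ?q (x + s *\<^sub>R axis i 1 + t *\<^sub>R axis j 1) = h\<^sup>2 * ?p (x + s' *\<^sub>R axis j 1 + t' *\<^sub>R axis i 1)"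
    unfolding st(5)[symmetric] st'(5)[symmetric] by (simp add: add_ac)
  then have eq: "?q (x + s *\<^sub>R axis i 1 + t *\<^sub>R axis j 1) = ?p (x + s' *\<^sub>R axis j 1 + t' *\<^sub>R axis i 1)"
    using h by simp
  have "dist (?q (x + s *\<^sub>R axis i 1 + t *\<^sub>R axis j 1)) (?q x) < e"
    by (rule d2, rule less_le_trans[OF near[OF st(1-4)]]) (simp add: h_def)
  moreover have "dist (?p (x + s' *\<^sub>R axis j 1 + t' *\<^sub>R axis i 1)) (?p x) < e"
    by (rule d1, rule less_le_trans[OF near[OF st'(1-4)]]) (simp add: h_def)
  ultimately show False using eq by (simp add: e_def dist_real_def abs_if split: if_splits)
qed

lemma curl_grad:
  fixes f :: "real^3 \<Rightarrow> real"
  assumes "smooth f"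
  shows "curl (grad f) = (\<lambda>x. 0)"
proof -
  have "partial i (\<lambda>y. grad f y $ j) = partial i (partial j f)" for i j
    by (simp add: grad_def)
  then show ?thesis
    using partial_commute[OF assms] by (simp add: curl_def vec_eq_iff forall_3 fun_eq_iff)
qed

lemma divergence_curl:
  assumes "smooth f"
  shows "divergence (curl f) = (\<lambda>x. 0)"
proof
  fix x
  have s: "smooth (\<lambda>x. f x $ i)" for i by (rule smooth_component[OF assms])
  have "partial k (\<lambda>x. partial i (\<lambda>y. f y $ j) x - partial i' (\<lambda>y. f y $ j') x) x =
      partial k (partial i (\<lambda>y. f y $ j)) x - partial k (partial i' (\<lambda>y. f y $ j')) x" for i j i' j' k
    using partial_add_scale[of "partial i (\<lambda>y. f y $ j)" x "partial i' (\<lambda>y. f y $ j')" k "-1"]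
      smooth_differentiable[OF smooth_partial[OF s]] by simp
  then show "divergence (curl f) x = 0"
    using partial_commute[OF s] by (simp add: divergence_def curl_def Let_def sum_3)
qed

text \<open>The support may be replaced by any compact set outside of which the function vanishes.\<close>

lemma test_functions_iff:
  "\<phi> \<in> test_functions \<Omega> \<longleftrightarrow> smooth \<phi> \<and> (\<exists>K. compact K \<and> K \<subseteq> \<Omega> \<and> (\<forall>x. x \<notin> K \<longrightarrow> \<phi> x = 0))"
proof
  assume "\<phi> \<in> test_functions \<Omega>"
  then show "smooth \<phi> \<and> (\<exists>K. compact K \<and> K \<subseteq> \<Omega> \<and> (\<forall>x. x \<notin> K \<longrightarrow> \<phi> x = 0))"
    using closure_subset[of "{x. \<phi> x \<noteq> 0}"] unfolding test_functions_def by blast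
next
  assume "smooth \<phi> \<and> (\<exists>K. compact K \<and> K \<subseteq> \<Omega> \<and> (\<forall>x. x \<notin> K \<longrightarrow> \<phi> x = 0))"
  then obtain K where K: "smooth \<phi>" "compact K" "K \<subseteq> \<Omega>" "\<forall>x. x \<notin> K \<longrightarrow> \<phi> x = 0" by blast
  then have "closure {x. \<phi> x \<noteq> 0} \<subseteq> K"
    by (intro closure_minimal) (auto simp: compact_imp_closed)
  then show "\<phi> \<in> test_functions \<Omega>"
    using K unfolding test_functions_def
    by (auto intro: compact_closure[THEN iffD2] bounded_subset[OF compact_imp_bounded[OF K(2)]] closure_subset)
qed

lemma test_smooth: "\<phi> \<in> test_functions \<Omega> \<Longrightarrow> smooth \<phi>"
  by (simp add: test_functions_iff)

lemma partial_outside: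
  assumes "compact K" "\<forall>x. x \<notin> K \<longrightarrow> f x = 0" "x \<notin> K"
  shows "partial i f x = 0"
proof -
  have "((\<lambda>x. 0) has_derivative (\<lambda>h. 0)) (at x)" by simp
  then have "(f has_derivative (\<lambda>h. 0)) (at x)"
    by (rule has_derivative_transform_within_open[OF _ open_Compl[OF compact_imp_closed[OF assms(1)]]])
      (use assms in auto)
  then show ?thesis by (simp add: partial_eqI)
qed

lemma test_partial:
  assumes "f \<in> test_functions \<Omega>" shows "partial i f \<in> test_functions \<Omega>"
  using assms partial_outside smooth_partial unfolding test_functions_iff by metis

lemma test_linear:
  assumes "f \<in> test_functions \<Omega>" "bounded_linear L" shows "(\<lambda>x. L (f x)) \<in> test_functions \<Omega>"
  using assms smooth_linear linear_simps(3)[OF assms(2)] unfolding test_functions_iff by metis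

lemma test_add:
  assumes "f \<in> test_functions \<Omega>" "g \<in> test_functions \<Omega>" shows "(\<lambda>x. f x + g x) \<in> test_functions \<Omega>"
proof -
  obtain K K' where "compact K" "K \<subseteq> \<Omega>" "\<forall>x. x \<notin> K \<longrightarrow> f x = 0"
    "compact K'" "K' \<subseteq> \<Omega>" "\<forall>x. x \<notin> K' \<longrightarrow> g x = 0" using assms unfolding test_functions_iff by metis
  then show ?thesis unfolding test_functions_iff
    using smooth_add[OF assms[THEN test_smooth]] by (auto intro!: exI[of _ "K \<union> K'"] compact_Un)
qed

lemma test_component: "f \<in> test_functions \<Omega> \<Longrightarrow> (\<lambda>x. f x $ i) \<in> test_functions \<Omega>"
  by (rule test_linear[OF _ bounded_linear_vec_nth])

lemma test_axis: "f \<in> test_functions \<Omega> \<Longrightarrow> (\<lambda>x. f x *\<^sub>R v) \<in> test_functions \<Omega>"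
  by (rule test_linear[OF _ bounded_linear_scaleR_left])

lemma test_zero: "(\<lambda>x. 0) \<in> test_functions \<Omega>"
  by (auto simp: test_functions_iff smooth_const)

lemma test_grad: 
  assumes "f \<in> test_functions \<Omega>" shows "grad f \<in> test_functions \<Omega>"
proof -
  obtain K where K: "smooth f" "compact K" "K \<subseteq> \<Omega>" "\<forall>x. x \<notin> K \<longrightarrow> f x = 0"
    using assms unfolding test_functions_iff by blast
  then show ?thesis unfolding test_functions_iff
    by (auto simp: grad_def vec_eq_iff intro!: smooth_grad[unfolded grad_def] exI[of _ K] partial_outside)
qed

lemma test_divergence:
  assumes "f \<in> test_functions \<Omega>" shows "divergence f \<in> test_functions \<Omega>"
proof -
  obtain K where K: "smooth f" "compact K" "K \<subseteq> \<Omega>" "\<forall>x. x \<notin> K \<longrightarrow> f x = 0"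
    using assms unfolding test_functions_iff by blast
  then show ?thesis unfolding test_functions_iff
    by (auto simp: divergence_def intro!: smooth_divergence[unfolded divergence_def] exI[of _ K] sum.neutral partial_outside)
qed

lemma test_curl:
  assumes "f \<in> test_functions \<Omega>" shows "curl f \<in> test_functions \<Omega>"
proof -
  obtain K where K: "smooth f" "compact K" "K \<subseteq> \<Omega>" "\<forall>x. x \<notin> K \<longrightarrow> f x = 0"
    using assms unfolding test_functions_iff by blast
  have "partial i (\<lambda>y. f y $ j) x = 0" if "x \<notin> K" for i j x
    using K that by (intro partial_outside) auto
  then have "curl f x = 0" if "x \<notin> K" for x
    using that by (simp add: curl_def vec_eq_iff forall_3)
  then show ?thesis unfolding test_functions_iff using K smooth_curl by blast
qed

lemma grad_add_scale:
  fixes f g :: "real^3 \<Rightarrow> real"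
  assumes "smooth f" "smooth g"
  shows "grad (\<lambda>x. f x + c * g x) = (\<lambda>x. grad f x + c *\<^sub>R grad g x)"
  using assms by (simp add: grad_def vec_eq_iff fun_eq_iff partial_add_scale smooth_differentiable)

lemma divergence_add_scale:
  assumes "smooth f" "smooth g"
  shows "divergence (\<lambda>x. f x + c *\<^sub>R g x) = (\<lambda>x. divergence f x + c * divergence g x)"
  using smooth_component[OF assms(1), THEN smooth_differentiable]
    smooth_component[OF assms(2), THEN smooth_differentiable]
  by (simp add: divergence_def fun_eq_iff partial_add_scale
    sum.distrib sum_distrib_left)

section \<open>Integration by parts\<close>

lemma integrable_compact_support:
  fixes f :: "real^3 \<Rightarrow> real"
  assumes "continuous_on UNIV f" "compact K" "\<And>x. x \<notin> K \<Longrightarrow> f x = 0"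
  shows "integrable lborel f"
proof -
  have "integrable lborel (\<lambda>x. indicator K x *\<^sub>R f x)"
    using assms by (intro borel_integrable_compact) (auto intro: continuous_on_subset)
  moreover have "(\<lambda>x. indicator K x *\<^sub>R f x) = f"
    using assms(3) by (auto simp: indicator_def fun_eq_iff)
  ultimately show ?thesis by metis
qed

lemma integral_lebesgue_on_eq_lborel:
  fixes f :: "real^3 \<Rightarrow> real"
  assumes "open \<Omega>" "f \<in> borel_measurable borel" "\<And>x. x \<notin> \<Omega> \<Longrightarrow> f x = 0"
  shows "(LINT x|lebesgue_on \<Omega>. f x) = (LINT x|lborel. f x)"
    and "integrable (lebesgue_on \<Omega>) f \<longleftrightarrow> integrable lborel f"
proof -
  have ind: "(\<lambda>x. indicator \<Omega> x *\<^sub>R f x) = f" using assms(3) by (auto simp: indicator_def fun_eq_iff)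
  have \<Omega>: "\<Omega> \<inter> space lebesgue \<in> sets lebesgue"
    using \<open>open \<Omega>\<close> by (simp add: borel_open sets_completionI_sets)
  have m: "f \<in> lborel \<rightarrow>\<^sub>M borel" using assms(2) by simp
  show "(LINT x|lebesgue_on \<Omega>. f x) = (LINT x|lborel. f x)"
    unfolding integral_restrict_space[OF \<Omega>] ind by (rule integral_completion[OF m])
  show "integrable (lebesgue_on \<Omega>) f \<longleftrightarrow> integrable lborel f"
    unfolding integrable_restrict_space[OF \<Omega>] ind by (rule integrable_completion[OF m])
qed

text \<open>The integral of a partial derivative is the limit of integrals of difference quotients,
  and these vanish by translation invariance.\<close>

lemma integral_partial_eq_0:
  fixes f :: "real^3 \<Rightarrow> real"
  assumes diff: "\<And>x. f differentiable at x" and cont: "continuous_on UNIV (partial i f)"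
    and K: "compact K" "\<And>x. x \<notin> K \<Longrightarrow> f x = 0"
  shows "(LINT x|lborel. partial i f x) = 0"
proof -
  let ?e = "axis i 1 :: real^3"
  have fc: "continuous_on UNIV f"
    using diff by (meson continuous_at_imp_continuous_on differentiable_imp_continuous_within)
  have fint: "integrable lborel f" by (rule integrable_compact_support[OF fc K])
  obtain r where r: "\<And>x. x \<in> K \<Longrightarrow> norm x \<le> r"
    using compact_imp_bounded[OF K(1)] by (auto simp: bounded_iff)
  obtain M where M: "\<And>x. x \<in> cball 0 (r + 2) \<Longrightarrow> \<bar>partial i f x\<bar> \<le> M"
    using compact_imp_bounded[OF compact_continuous_image[OF continuous_on_subset[OF cont subset_UNIV] compact_cball[of 0 "r + 2"]]]
    by (auto simp: bounded_iff simp del: mem_cball mem_cball_0)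
  define h where "h = (\<lambda>n. 1 / real (Suc n))"
  have h: "0 < h n" "h n \<le> 1" for n by (auto simp: h_def)
  have hlim: "h \<longlonglongrightarrow> 0" using LIMSEQ_inverse_real_of_nat by (simp add: h_def inverse_eq_divide)
  define q where "q = (\<lambda>n x. (f (x + h n *\<^sub>R ?e) - f x) / h n)"
  have D: "((\<lambda>s. f (x + s *\<^sub>R ?e)) has_real_derivative partial i f (x + s *\<^sub>R ?e)) (at s)" for x s
    using has_derivative_partial[OF diff] by (simp add: has_real_derivative_iff_has_vector_derivative)
  have [measurable]: "f \<in> borel_measurable borel" "partial i f \<in> borel_measurable borel"
    using fc cont by (auto intro: borel_measurable_continuous_onI)
  have "(\<lambda>n. LINT x|lborel. q n x) \<longlonglongrightarrow> (LINT x|lborel. partial i f x)"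
  proof (rule integral_dominated_convergence[where w = "\<lambda>x. indicator (cball 0 (r + 1)) x *\<^sub>R M"])
    show "AE x in lborel. (\<lambda>n. q n x) \<longlonglongrightarrow> partial i f x"
    proof (rule AE_I2)
      fix x
      have "((\<lambda>s. (f (x + s *\<^sub>R ?e) - f x) / s) \<longlongrightarrow> partial i f x) (at 0)"
        using D[of x 0] by (simp add: DERIV_def)
      moreover have "filterlim h (at 0) sequentially"
        using hlim h(1) by (intro filterlim_atI) (auto simp: less_imp_neq[symmetric])
      ultimately show "(\<lambda>n. q n x) \<longlonglongrightarrow> partial i f x"
        unfolding q_def by (rule filterlim_compose)
    qed
    show "AE x in lborel. norm (q n x) \<le> indicator (cball 0 (r + 1)) x *\<^sub>R M" for n
    proof (rule AE_I2)
      fix x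
      show "norm (q n x) \<le> indicator (cball 0 (r + 1)) x *\<^sub>R M"
      proof (cases "x \<in> cball 0 (r + 1)")
        case True
        obtain s where s: "0 < s" "s < h n"
          "f (x + h n *\<^sub>R ?e) - f (x + 0 *\<^sub>R ?e) = (h n - 0) * partial i f (x + s *\<^sub>R ?e)"
          using MVT2[OF h(1) D] by blast
        have "norm (x + s *\<^sub>R ?e) \<le> norm x + norm (s *\<^sub>R ?e)" by (rule norm_triangle_ineq)
        also have "\<dots> \<le> r + 2" using True s(1,2) h(2)[of n] by (simp add: norm_axis_1)
        finally have "\<bar>partial i f (x + s *\<^sub>R ?e)\<bar> \<le> M" by (intro M) simp
        moreover have "q n x = partial i f (x + s *\<^sub>R ?e)"
          using s(3) h(1)[of n] by (simp add: q_def)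
        ultimately show ?thesis using True by simp
      next
        case False
        then have nx: "norm x > r + 1" by simp
        have "norm x \<le> norm (x + h n *\<^sub>R ?e) + norm (h n *\<^sub>R ?e)"
          using norm_triangle_ineq4[of "x + h n *\<^sub>R ?e" "h n *\<^sub>R ?e"] by simp
        then have "norm (x + h n *\<^sub>R ?e) > r" using nx h(1)[of n] h(2)[of n] by (simp add: norm_axis_1)
        then have "x + h n *\<^sub>R ?e \<notin> K" "x \<notin> K" using r nx by fastforce+
        then show ?thesis using K(2) using False by (simp add: q_def indicator_def)
      qed
    qed
    show "integrable lborel (\<lambda>x. indicator (cball 0 (r + 1)) x *\<^sub>R M)"
      by (intro borel_integrable_compact) auto
    show "q n \<in> borel_measurable lborel" for n
    proof -
      have [measurable]: "(\<lambda>x. f (x + h n *\<^sub>R ?e)) \<in> borel_measurable borel"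
        by (intro borel_measurable_continuous_onI continuous_on_compose2[OF fc] continuous_intros) auto
      show ?thesis unfolding q_def by measurable
    qed
  qed measurable
  moreover have "(LINT x|lborel. q n x) = 0" for n
  proof -
    have meas: "(+) (h n *\<^sub>R ?e) \<in> lborel \<rightarrow>\<^sub>M borel" by measurable
    have eq: "integral\<^sup>L lborel f = (LINT x|lborel. f (h n *\<^sub>R ?e + x))"
      using integral_distr[OF meas, of f] by (simp add: lborel_distr_plus)
    have "integrable lborel (\<lambda>x. f (h n *\<^sub>R ?e + x))"
      using integrable_distr_eq[OF meas, of f] fint by (simp add: lborel_distr_plus)
    then show ?thesis unfolding q_def
      using fint eq by (simp add: add.commute)
  qed
  ultimately show ?thesis by (simp add: LIMSEQ_const_iff)
qed

text \<open>Only one factor needs compact support. The other one is allowed to be a constant or to contain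
  the coordinate function.\<close>

lemma integration_by_parts:
  fixes \<phi> \<psi> :: "real^3 \<Rightarrow> real"
  assumes \<Omega>: "open \<Omega>" and \<psi>: "\<psi> \<in> test_functions \<Omega>"
    and diff: "\<And>x. \<phi> differentiable at x" and cont: "continuous_on UNIV (partial i \<phi>)"
  shows "l2_inner \<Omega> \<phi> (partial i \<psi>) = - l2_inner \<Omega> (partial i \<phi>) \<psi>"
proof -
  obtain K where K: "compact K" "K \<subseteq> \<Omega>" "\<And>x. x \<notin> K \<Longrightarrow> \<psi> x = 0"
    using \<psi> unfolding test_functions_iff by blast
  have c: "continuous_on UNIV \<phi>"
    using diff by (meson continuous_at_imp_continuous_on differentiable_imp_continuous_within)
  have c': "continuous_on UNIV \<psi>" "continuous_on UNIV (partial i \<psi>)"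
    using smooth_continuous[OF test_smooth[OF \<psi>]]
      smooth_continuous[OF smooth_partial[OF test_smooth[OF \<psi>]]] by auto
  have p\<psi>: "partial i \<psi> x = 0" if "x \<notin> K" for x
    using partial_outside[OF K(1) _ that] K(3) by blast
  let ?a = "\<lambda>x. \<phi> x * partial i \<psi> x" and ?b = "\<lambda>x. partial i \<phi> x * \<psi> x"
  have p: "partial i (\<lambda>x. \<phi> x * \<psi> x) = (\<lambda>x. ?a x + ?b x)"
    using partial_mult[OF diff smooth_differentiable[OF test_smooth[OF \<psi>]]] by (simp add: fun_eq_iff)
  have "(LINT x|lborel. partial i (\<lambda>x. \<phi> x * \<psi> x) x) = 0"
  proof (rule integral_partial_eq_0[OF _ _ K(1)])
    show "(\<lambda>x. \<phi> x * \<psi> x) differentiable at x" for x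
      by (intro differentiable_mult diff smooth_differentiable[OF test_smooth[OF \<psi>]])
    show "continuous_on UNIV (partial i (\<lambda>x. \<phi> x * \<psi> x))"
      unfolding p by (intro continuous_intros c c' cont)
  qed (simp add: K)
  moreover have ab: "integrable lborel ?a" "integrable lborel ?b"
    by (rule integrable_compact_support[OF _ K(1)]; simp add: K(3) p\<psi> continuous_on_mult c c' cont)+
  ultimately have "(LINT x|lborel. ?a x) + (LINT x|lborel. ?b x) = 0" by (simp add: p)
  moreover have "?a x = 0" "?b x = 0" if "x \<notin> \<Omega>" for x
    using that K(2,3) p\<psi> by auto
  ultimately show ?thesis
    using integral_lebesgue_on_eq_lborel(1)[OF \<Omega>, of ?a] integral_lebesgue_on_eq_lborel(1)[OF \<Omega>, of ?b]
      ab by (simp add: l2_inner_def borel_measurable_integrable)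
qed

section \<open>Fields with vanishing weak gradient\<close>

text \<open>Infinitely differentiable functions of one real variable, described coinductively: \<open>f\<close> belongs to
  a set of functions each of which has a derivative in the same set.\<close>

definition smooth1 :: "(real \<Rightarrow> real) \<Rightarrow> bool" where
  "smooth1 f \<longleftrightarrow> (\<exists>C. f \<in> C \<and> (\<forall>g\<in>C. \<exists>g'\<in>C. \<forall>t. (g has_real_derivative g' t) (at t)))"

lemma smooth1_deriv:
  assumes "smooth1 f"
  shows "\<exists>f'. smooth1 f' \<and> (\<forall>t. (f has_real_derivative f' t) (at t))"
  using assms unfolding smooth1_def by metis

lemma smooth1_continuous: "smooth1 f \<Longrightarrow> continuous_on S f"
  using smooth1_deriv by (meson DERIV_isCont continuous_at_imp_continuous_on)

lemma smooth1_scale_compose: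
  assumes "smooth1 f" shows "smooth1 (\<lambda>t. c * f (a * t + b))"
  unfolding smooth1_def
proof (intro exI conjI ballI)
  let ?C = "{\<lambda>t. c * f (a * t + b) | c f. smooth1 f}"
  show "(\<lambda>t. c * f (a * t + b)) \<in> ?C" using assms by blast
  fix g assume "g \<in> ?C"
  then obtain d h where h: "g = (\<lambda>t. d * h (a * t + b))" "smooth1 h" by blast
  obtain h' where h': "smooth1 h'" "\<And>t. (h has_real_derivative h' t) (at t)"
    using smooth1_deriv[OF h(2)] by blast
  have "(g has_real_derivative (d * a) * h' (a * t + b)) (at t)" for t
    unfolding h by (auto intro!: derivative_eq_intros DERIV_chain2[OF h'(2)])
  then show "\<exists>g'\<in>?C. \<forall>t. (g has_real_derivative g' t) (at t)"
    using h'(1) by (intro bexI[of _ "\<lambda>t. (d * a) * h' (a * t + b)"]) auto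
qed

text \<open>Finite sums of products of smooth functions, a class closed under differentiation by the product
  rule; it serves to show that products are smooth.\<close>

inductive sum_of_products :: "(real \<Rightarrow> real) \<Rightarrow> bool" where
  prod: "smooth1 f \<Longrightarrow> smooth1 g \<Longrightarrow> sum_of_products (\<lambda>t. f t * g t)"
| add: "sum_of_products h \<Longrightarrow> sum_of_products k \<Longrightarrow> sum_of_products (\<lambda>t. h t + k t)"

lemma sum_of_products_smooth1: "sum_of_products f \<Longrightarrow> smooth1 f"
  unfolding smooth1_def
proof (rule exI, intro conjI ballI)
  show "f \<in> Collect sum_of_products" if "sum_of_products f" using that by simp
  fix g assume "g \<in> Collect sum_of_products"
  then have "sum_of_products g" by simp
  then have "\<exists>g'. sum_of_products g' \<and> (\<forall>t. (g has_real_derivative g' t) (at t))"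
  proof induction
    case (prod f g)
    obtain f' g' where "smooth1 f'" "\<And>t. (f has_real_derivative f' t) (at t)"
      "smooth1 g'" "\<And>t. (g has_real_derivative g' t) (at t)"
      using smooth1_deriv prod by metis
    then show ?case
      by (intro exI[of _ "\<lambda>t. f' t * g t + f t * g' t"] conjI sum_of_products.intros prod)
        (auto intro!: derivative_eq_intros)
  next
    case (add h k)
    then obtain h' k' where "sum_of_products h'" "\<And>t. (h has_real_derivative h' t) (at t)"
      "sum_of_products k'" "\<And>t. (k has_real_derivative k' t) (at t)" by metis
    then show ?case
      by (intro exI[of _ "\<lambda>t. h' t + k' t"] conjI sum_of_products.intros)
        (auto intro!: derivative_eq_intros)
  qed
  then show "\<exists>g'\<in>Collect sum_of_products. \<forall>t. (g has_real_derivative g' t) (at t)" by blast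
qed

lemma smooth1_mult: "smooth1 f \<Longrightarrow> smooth1 g \<Longrightarrow> smooth1 (\<lambda>t. f t * g t)"
  by (rule sum_of_products_smooth1[OF sum_of_products.prod])

lemma smooth1_const: "smooth1 (\<lambda>t. c)"
  unfolding smooth1_def by (intro exI[of _ "range (\<lambda>c t. c)"]) (auto intro!: exI[of _ 0])

lemma smooth1_lincomb: "smooth1 f \<Longrightarrow> smooth1 g \<Longrightarrow> smooth1 (\<lambda>t. a * f t + b * g t)"
proof -
  assume f: "smooth1 f" and g: "smooth1 g"
  have "sum_of_products (\<lambda>t. a * f t)" "sum_of_products (\<lambda>t. b * g t)"
    using sum_of_products.prod[OF smooth1_const f, of a] sum_of_products.prod[OF smooth1_const g, of b]
    by auto
  from sum_of_products.add[OF this] show ?thesis by (rule sum_of_products_smooth1)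
qed

lemma smooth1_antiderivative:
  assumes "smooth1 f" "\<And>t. (F has_real_derivative f t) (at t)"
  shows "smooth1 F"
  unfolding smooth1_def
  by (rule exI[of _ "insert F (Collect smooth1)"]) (use assms smooth1_deriv in blast)

text \<open>The functions \<open>p (1/t) exp (-1/t)\<close> for a polynomial \<open>p\<close>, extended by zero to \<open>t \<le> 0\<close>. All derivatives
  of \<open>exp (-1/t)\<close> are of this form.\<close>

definition flat :: "real poly \<Rightarrow> real \<Rightarrow> real" where
  "flat p t = (if t \<le> 0 then 0 else poly p (1 / t) * exp (- 1 / t))"

lemma poly_div_exp_tendsto_0:
  "((\<lambda>x. x ^ k * poly p x / exp x) \<longlongrightarrow> (0::real)) at_top"
proof (induction p arbitrary: k)
  case 0
  then show ?case by simp
next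
  case (pCons a p)
  have "((\<lambda>x. a * (x ^ k / exp x) + x ^ Suc k * poly p x / exp x) \<longlongrightarrow> a * 0 + (0::real)) at_top"
    by (intro tendsto_intros tendsto_power_div_exp_0 pCons.IH)
  then show ?case by (simp add: algebra_simps add_divide_distrib)
qed

lemma flat_deriv:
  "(flat p has_real_derivative flat (monom 1 2 * (p - pderiv p)) t) (at t)"
proof -
  consider "t < 0" | "t > 0" | "t = 0" by linarith
  then show ?thesis
  proof cases
    case 1
    have "((\<lambda>t. 0) has_real_derivative 0) (at t)" by simp
    then have "(flat p has_real_derivative 0) (at t)"
      by (rule has_field_derivative_transform_within_open[where S = "{..<0}"]) (use 1 in \<open>auto simp: flat_def\<close>)
    then show ?thesis using 1 by (simp add: flat_def)
  next
    case 2
    have "((\<lambda>t. poly p (1 / t) * exp (- 1 / t)) has_real_derivative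
        poly p (1 / t) * (exp (- 1 / t) * (1 / t\<^sup>2)) + poly (pderiv p) (1 / t) * (- 1 / t\<^sup>2) * exp (- 1 / t)) (at t)"
      using 2 by (auto intro!: derivative_eq_intros DERIV_chain2[OF poly_DERIV] simp: power2_eq_square field_simps)
    then have "((\<lambda>t. poly p (1 / t) * exp (- 1 / t)) has_real_derivative
        flat (monom 1 2 * (p - pderiv p)) t) (at t)"
      using 2 by (simp add: flat_def poly_monom field_simps)
    then show ?thesis
      by (rule has_field_derivative_transform_within_open[where S = "{0<..}"]) (use 2 in \<open>auto simp: flat_def\<close>)
  next
    case 3
    have "((\<lambda>h. flat p h / h) \<longlongrightarrow> 0) (at_left 0)"
      by (rule tendsto_eventually) (auto simp: eventually_at_filter flat_def)
    moreover have "((\<lambda>h. flat p h / h) \<longlongrightarrow> 0) (at_right 0)"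
    proof -
      have "((\<lambda>h. inverse h ^ 1 * poly p (inverse h) / exp (inverse h)) \<longlongrightarrow> 0) (at_right (0::real))"
        by (rule filterlim_compose[OF poly_div_exp_tendsto_0 filterlim_inverse_at_top_right])
      then show ?thesis
        by (rule Lim_transform_eventually)
          (auto simp: eventually_at_filter flat_def exp_minus field_simps)
    qed
    ultimately have "((\<lambda>h. flat p h / h) \<longlongrightarrow> 0) (at 0)" by (simp add: filterlim_at_split)
    then show ?thesis using 3 by (simp add: DERIV_def flat_def)
  qed
qed

lemma smooth1_flat: "smooth1 (flat p)"
  unfolding smooth1_def by (rule exI[of _ "range flat"]) (auto intro: flat_deriv)

text \<open>Smooth functions that vanish outside the open interval from \<open>a\<close> to \<open>b\<close> and converge, boundedly and pointwise, to its
  indicator function as \<open>n\<close> tends to infinity. The factor \<open>Suc n\<close> is never zero.\<close>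

definition bump :: "real \<Rightarrow> real \<Rightarrow> nat \<Rightarrow> real \<Rightarrow> real" where
  "bump a b n t = flat 1 (real (Suc n) * (t - a)) * flat 1 (real (Suc n) * (b - t))"

lemma smooth1_bump: "smooth1 (bump a b n)"
proof -
  have "smooth1 (\<lambda>t. (1 * flat 1 (real (Suc n) * t + - real (Suc n) * a)) * (1 * flat 1 ((- real (Suc n)) * t + real (Suc n) * b)))"
    by (intro smooth1_mult smooth1_scale_compose smooth1_flat)
  then show ?thesis by (simp add: bump_def[abs_def] algebra_simps)
qed

lemma flat1_bounds: "0 \<le> flat 1 t" "flat 1 t \<le> 1"
  by (auto simp: flat_def)

lemma bump_bounds: "0 \<le> bump a b n t" "bump a b n t \<le> 1"
  unfolding bump_def using flat1_bounds by (auto intro: mult_le_one)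

lemma bump_outside: "t \<notin> {a<..<b} \<Longrightarrow> bump a b n t = 0"
  by (auto simp: bump_def flat_def mult_le_0_iff not_less)

lemma bump_pos: "t \<in> {a<..<b} \<Longrightarrow> bump a b n t > 0"
  by (auto simp: bump_def flat_def mult_le_0_iff not_less)

lemma flat_tendsto_1: "t > 0 \<Longrightarrow> (\<lambda>n. flat 1 (real (Suc n) * t)) \<longlonglongrightarrow> 1"
proof -
  assume t: "t > 0"
  have "(\<lambda>n. exp (- (1 / t) * inverse (real (Suc n)))) \<longlonglongrightarrow> exp (- (1 / t) * 0)"
    by (intro tendsto_intros LIMSEQ_inverse_real_of_nat)
  moreover have "exp (- (1 / t) * inverse (real (Suc n))) = flat 1 (real (Suc n) * t)" for n
  proof -
    have "real (Suc n) * t > 0" using t by simp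
    then show ?thesis by (simp add: flat_def not_le inverse_eq_divide mult.commute del: of_nat_Suc)
  qed
  ultimately show ?thesis by simp
qed

lemma bump_tendsto: "(\<lambda>n. bump a b n t) \<longlonglongrightarrow> indicator {a<..<b} t"
proof (cases "t \<in> {a<..<b}")
  case True
  then have "(\<lambda>n. bump a b n t) \<longlonglongrightarrow> 1 * 1"
    unfolding bump_def by (intro tendsto_mult flat_tendsto_1) auto
  then show ?thesis using True by simp
qed (simp add: bump_outside)

text \<open>A continuous function with support in an interval and vanishing integral is the derivative of a
  function with support in the same interval.\<close>

lemma antiderivative_compact_support:
  fixes g :: "real \<Rightarrow> real"
  assumes g: "continuous_on UNIV g" and out: "\<And>t. t \<notin> {l..u} \<Longrightarrow> g t = 0"
    and lu: "l \<le> u" and zero: "integral {l..u} g = 0"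
  shows "\<exists>G. (\<forall>t. (G has_real_derivative g t) (at t)) \<and> (\<forall>t. t \<notin> {l..u} \<longrightarrow> G t = 0)"
proof -
  \<comment> \<open>Starting the integral at \<open>l - 1\<close> keeps the point \<open>l\<close> away from the left end of the interval.\<close>
  define G where "G = (\<lambda>t. integral {l - 1..t} g)"
  have int: "g integrable_on {a..b}" for a b
    by (intro integrable_continuous_real continuous_on_subset[OF g]) auto
  have left: "G t = 0" if "t < l" for t
    unfolding G_def using out that by (intro integral_eq_0_iff[THEN iffD2] integral_unique has_integral_is_0) auto
  have right: "G t = 0" if "t > u" for t
  proof -
    have "integral {l - 1..l} g = 0"
    proof -
      have "integral {l - 1..l} g = integral {l - 1..l} (\<lambda>_. 0)"
        by (rule integral_spike[of "{l}"]) (auto simp: out)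
      then show ?thesis by simp
    qed
    moreover have "integral {u..t} g = 0"
    proof -
      have "integral {u..t} g = integral {u..t} (\<lambda>_. 0)"
        by (rule integral_spike[of "{u}"]) (auto simp: out)
      then show ?thesis by simp
    qed
    moreover have "G t = integral {l - 1..l} g + integral {l..u} g + integral {u..t} g"
      unfolding G_def using lu that
        Henstock_Kurzweil_Integration.integral_combine[of "l - 1" l u g]
        Henstock_Kurzweil_Integration.integral_combine[of "l - 1" u t g] int by simp
    ultimately show ?thesis using zero by simp
  qed
  have "(G has_real_derivative g t) (at t)" for t
  proof (cases "t < l")
    case True
    have "((\<lambda>t. 0) has_real_derivative 0) (at t)" by simp
    then have "(G has_real_derivative 0) (at t)"
      by (rule has_field_derivative_transform_within_open[where S = "{..<l}"]) (use True left in auto)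
    then show ?thesis using True out by simp
  next
    case False
    have "(G has_real_derivative g t) (at t within {l - 1..t + 1})"
      unfolding G_def using False
      by (intro integral_has_real_derivative continuous_on_subset[OF g]) auto
    then show ?thesis
      using False by (subst (asm) at_within_interior) (auto simp: interior_atLeastAtMost_real)
  qed
  then show ?thesis using left right by (intro exI[of _ G]) auto
qed

text \<open>The function \<open>x \<mapsto> a\<^sub>1(x\<^sub>1) a\<^sub>2(x\<^sub>2) a\<^sub>3(x\<^sub>3)\<close>.\<close>

definition tensor :: "(3 \<Rightarrow> real \<Rightarrow> real) \<Rightarrow> real^3 \<Rightarrow> real" where
  "tensor a x = (\<Prod>j\<in>UNIV. a j (x $ j))"

lemma tensor_upd: "tensor (a(i := b)) x = b (x $ i) * (\<Prod>j\<in>UNIV - {i}. a j (x $ j))"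
proof -
  have "tensor (a(i := b)) x = b (x $ i) * (\<Prod>j\<in>UNIV - {i}. (a(i := b)) j (x $ j))"
    unfolding tensor_def by (subst prod.remove[of _ i]) auto
  also have "(\<Prod>j\<in>UNIV - {i}. (a(i := b)) j (x $ j)) = (\<Prod>j\<in>UNIV - {i}. a j (x $ j))"
    by (rule prod.cong) auto
  finally show ?thesis .
qed

lemma tensor_has_derivative:
  assumes "\<And>j t. (a j has_real_derivative a' j t) (at t)"
  shows "tensor a differentiable at x" "partial i (tensor a) x = tensor (a(i := a' i)) x"
proof -
  have "((\<lambda>x. a j (x $ j)) has_derivative (\<lambda>h. a' j (x $ j) * h $ j)) (at x)" for j
  proof -
    have "((\<lambda>x. x $ j) has_derivative (\<lambda>h. h $ j)) (at x)"
      by (rule bounded_linear_imp_has_derivative) (rule bounded_linear_vec_nth)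
    from has_derivative_compose[OF this, of "a j" "(*) (a' j (x $ j))"]
    show ?thesis using assms[of j "x $ j"] by (simp add: has_field_derivative_def)
  qed
  then have D: "(tensor a has_derivative
      (\<lambda>h. \<Sum>j\<in>UNIV. (a' j (x $ j) * h $ j) * (\<Prod>k\<in>UNIV - {j}. a k (x $ k)))) (at x)"
    unfolding tensor_def[abs_def] by (intro has_derivative_prod) auto
  then show "tensor a differentiable at x" by (auto simp: differentiable_def)
  show "partial i (tensor a) x = tensor (a(i := a' i)) x"
    unfolding partial_eqI[OF D] tensor_upd
    by (subst sum.remove[of _ i]) (auto simp: axis_def intro!: sum.neutral)
qed

lemma smooth_tensor:
  assumes "\<And>j. smooth1 (a j)" shows "smooth (tensor a)"
proof (rule smooth_coinduct[where C = "{tensor a | a. \<forall>j. smooth1 (a j)}"])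
  fix g i x assume "g \<in> {tensor a | a. \<forall>j. smooth1 (a j)}"
  then obtain b where b: "g = tensor b" "\<And>j. smooth1 (b j)" by blast
  obtain b' where b': "\<And>j. smooth1 (b' j)" "\<And>j t. (b j has_real_derivative b' j t) (at t)"
    using smooth1_deriv[OF b(2)] by metis
  show "g differentiable at x" unfolding b by (rule tensor_has_derivative[OF b'(2)])
  have "partial i g = tensor (b(i := b' i))"
    unfolding b using tensor_has_derivative(2)[OF b'(2)] by (simp add: fun_eq_iff)
  then show "partial i g \<in> {tensor a | a. \<forall>j. smooth1 (a j)}"
    using b b' by (auto intro!: exI[of _ "b(i := b' i)"])
qed (use assms in auto)

lemma tensor_test:
  assumes "cbox l u \<subseteq> \<Omega>" "\<And>j. smooth1 (a j)" "\<And>j t. t \<notin> {l $ j..u $ j} \<Longrightarrow> a j t = 0"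
  shows "tensor a \<in> test_functions \<Omega>"
  unfolding test_functions_iff
proof (intro conjI exI allI impI)
  show "tensor a x = 0" if x: "x \<notin> cbox l u" for x
  proof -
    obtain j where "x $ j \<notin> {l $ j..u $ j}" using x by (auto simp: mem_box_cart)
    then show ?thesis unfolding tensor_def using assms(3) by (intro prod_zero) auto
  qed
qed (use assms in \<open>auto intro: smooth_tensor\<close>)

lemma (in bounded_open) test_L2:
  fixes \<phi> :: "real^3 \<Rightarrow> 'b::euclidean_space"
  assumes "\<phi> \<in> test_functions \<Omega>"
  shows "\<phi> \<in> L2 \<Omega>"
proof -
  obtain K where K: "compact K" "\<And>x. x \<notin> K \<Longrightarrow> \<phi> x = 0"
    using assms unfolding test_functions_iff by blast
  have c: "continuous_on S \<phi>" for S by (rule smooth_continuous[OF test_smooth[OF assms]])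
  obtain M where M: "\<And>x. x \<in> K \<Longrightarrow> norm (\<phi> x) \<le> M"
    using compact_imp_bounded[OF compact_continuous_image[OF c K(1)]] by (auto simp: bounded_iff)
  have "norm (\<phi> x) \<le> max M 0" for x using K(2)[of x] M[of x] by (cases "x \<in> K") auto
  moreover have "\<phi> \<in> borel_measurable (lebesgue_on \<Omega>)"
    by (rule continuous_imp_measurable_on_sets_lebesgue[OF c])
      (simp add: lmeas fmeasurableD)
  ultimately show ?thesis by (intro bounded_L2) auto
qed

context bounded_open
begin

text \<open>Replace one factor of a tensor product. The combination \<open>(\<integral>a\<^sub>i) b - (\<integral>b) a\<^sub>i\<close> has vanishing
  integral and is therefore the derivative of a test function of one variable, so the corresponding
  tensor product is a partial derivative and is annihilated by \<open>w\<close>.\<close>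

lemma weak_const_step:
  assumes w: "has_weak_grad \<Omega> w (\<lambda>x. 0)" and Q: "cbox l u \<subseteq> \<Omega>" and lu: "l $ i \<le> u $ i"
    and a: "\<And>j. smooth1 (a j)" "\<And>j t. t \<notin> {l $ j..u $ j} \<Longrightarrow> a j t = 0"
    and b: "smooth1 b" "\<And>t. t \<notin> {l $ i..u $ i} \<Longrightarrow> b t = 0"
  shows "integral {l $ i..u $ i} (a i) * l2_inner \<Omega> w (tensor (a(i := b))) =
    integral {l $ i..u $ i} b * l2_inner \<Omega> w (tensor a)"
proof -
  define A where "A = integral {l $ i..u $ i} (a i)"
  define B where "B = integral {l $ i..u $ i} b"
  define c where "c = (\<lambda>t. A * b t + (- B) * a i t)"
  have c: "smooth1 c" unfolding c_def by (rule smooth1_lincomb[OF b(1) a(1)])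
  have int: "b integrable_on {l $ i..u $ i}" "a i integrable_on {l $ i..u $ i}"
    by (intro integrable_continuous_real smooth1_continuous a b)+
  have "((\<lambda>t. A * b t + (- B) * a i t) has_integral A * B + (- B) * A) {l $ i..u $ i}"
    unfolding A_def B_def using int
    by (intro has_integral_add has_integral_mult_right) (auto simp: has_integral_integral[symmetric])
  then have "integral {l $ i..u $ i} c = 0"
    unfolding c_def by (subst integral_unique) auto
  then obtain G where G: "\<And>t. (G has_real_derivative c t) (at t)"
      "\<And>t. t \<notin> {l $ i..u $ i} \<Longrightarrow> G t = 0"
    using antiderivative_compact_support[of c "l $ i" "u $ i", OF smooth1_continuous[OF c] _ lu]
      a(2)[of _ i] b(2) by (auto simp: c_def)
  have GS: "smooth1 G" by (rule smooth1_antiderivative[OF c G(1)])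
  obtain a' where a': "\<And>j t. (a j has_real_derivative a' j t) (at t)"
    using smooth1_deriv[OF a(1)] by metis
  have D: "((a(i := G)) j has_real_derivative (a'(i := c)) j t) (at t)" for j t
    using a' G(1) by (cases "j = i") auto
  from tensor_has_derivative(2)[where a = "a(i := G)" and a' = "a'(i := c)", OF D, of i]
  have p: "partial i (tensor (a(i := G))) = tensor (a(i := c))" by (simp add: fun_eq_iff)
  have test: "tensor (a(i := h)) \<in> test_functions \<Omega>" if "smooth1 h" "\<And>t. t \<notin> {l $ i..u $ i} \<Longrightarrow> h t = 0" for h
    using that a by (intro tensor_test[OF Q]) (auto simp del: atLeastAtMost_iff)
  have "l2_inner \<Omega> w (partial i (tensor (a(i := G)))) = 0"
    using w test[OF GS G(2)] by (simp add: has_weak_grad_def l2_inner_def)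
  then have "l2_inner \<Omega> w (tensor (a(i := c))) = 0" by (simp add: p)
  moreover have "tensor (a(i := c)) = A *\<^sub>R tensor (a(i := b)) + (- B) *\<^sub>R tensor a"
    using tensor_upd[of a i "a i"] by (simp add: fun_eq_iff tensor_upd c_def algebra_simps)
  moreover have "w \<in> L2 \<Omega>" using w by (simp add: has_weak_grad_def)
  moreover have "tensor (a(i := b)) \<in> L2 \<Omega>" by (rule test_L2[OF test[OF b]])
  moreover have "tensor a \<in> L2 \<Omega>" by (rule test_L2[OF tensor_test[OF Q a]])
  ultimately show ?thesis by (simp add: S.bilinear A_def B_def)
qed

text \<open>On tensor products \<open>w\<close> acts as a multiple of the integral.\<close>

lemma weak_const_tensor:
  assumes w: "has_weak_grad \<Omega> w (\<lambda>x. 0)" and Q: "cbox l u \<subseteq> \<Omega>" and lu: "\<And>i. l $ i \<le> u $ i"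
    and a: "\<And>j. smooth1 (a j)" "\<And>j t. t \<notin> {l $ j..u $ j} \<Longrightarrow> a j t = 0"
    and b: "\<And>j. smooth1 (b j)" "\<And>j t. t \<notin> {l $ j..u $ j} \<Longrightarrow> b j t = 0"
  shows "(\<Prod>i\<in>UNIV. integral {l $ i..u $ i} (a i)) * l2_inner \<Omega> w (tensor b) =
    (\<Prod>i\<in>UNIV. integral {l $ i..u $ i} (b i)) * l2_inner \<Omega> w (tensor a)"
proof -
  have "(\<Prod>i\<in>T. integral {l $ i..u $ i} (a i)) * l2_inner \<Omega> w (tensor (\<lambda>j. if j \<in> T then b j else a j)) =
    (\<Prod>i\<in>T. integral {l $ i..u $ i} (b i)) * l2_inner \<Omega> w (tensor a)" if "finite T" for T
    using that
  proof induction
    case (insert k T)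
    let ?c = "\<lambda>j. if j \<in> T then b j else a j"
    have eq: "(\<lambda>j. if j \<in> insert k T then b j else a j) = ?c(k := b k)" by auto
    have "integral {l $ k..u $ k} (?c k) * l2_inner \<Omega> w (tensor (?c(k := b k))) =
        integral {l $ k..u $ k} (b k) * l2_inner \<Omega> w (tensor ?c)"
      using a b by (intro weak_const_step[OF w Q lu]) (auto simp del: atLeastAtMost_iff)
    then have "integral {l $ k..u $ k} (a k) * l2_inner \<Omega> w (tensor (?c(k := b k))) =
        integral {l $ k..u $ k} (b k) * l2_inner \<Omega> w (tensor ?c)"
      using insert.hyps by simp
    note step = this
    have "(\<Prod>i\<in>insert k T. integral {l $ i..u $ i} (a i)) * l2_inner \<Omega> w (tensor (?c(k := b k))) =
        (\<Prod>i\<in>T. integral {l $ i..u $ i} (a i)) *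
          (integral {l $ k..u $ k} (a k) * l2_inner \<Omega> w (tensor (?c(k := b k))))"
      unfolding prod.insert[OF insert.hyps] by (simp only: mult_ac)
    also have "\<dots> = integral {l $ k..u $ k} (b k) *
        ((\<Prod>i\<in>T. integral {l $ i..u $ i} (a i)) * l2_inner \<Omega> w (tensor ?c))"
      unfolding step by (simp only: mult_ac)
    also have "\<dots> = (\<Prod>i\<in>insert k T. integral {l $ i..u $ i} (b i)) * l2_inner \<Omega> w (tensor a)"
      unfolding insert.IH prod.insert[OF insert.hyps] by (simp only: mult_ac)
    finally show ?case unfolding eq .
  qed simp
  from this[of UNIV] show ?thesis by simp
qed

end

text \<open>Boxes form a generator of the Borel sets that is closed under intersections, so that vanishing of
  the integrals carries over from boxes to all Borel sets.\<close>

lemma AE_eq_0_if_box_integrals_eq_0: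
  fixes f :: "real^3 \<Rightarrow> real"
  assumes f: "integrable lborel f" and box0: "\<And>p q. (LINT x:box p q|lborel. f x) = 0"
  shows "AE x in lborel. f x = 0"
proof (rule sigma_finite_measure.density_zero[OF sigma_finite_lborel f])
  have si: "set_integrable lborel A f" if "A \<in> sets borel" for A
    using f that unfolding set_integrable_def by (intro integrable_mult_indicator) auto
  have UN: "(\<Union>n::nat. box (- (real n *\<^sub>R One)) (real n *\<^sub>R One)) = (UNIV :: (real^3) set)"
    by (rule UN_box_eq_UNIV)
  have "(\<lambda>n::nat. LINT x:box (- (real n *\<^sub>R One)) (real n *\<^sub>R One)|lborel. f x) \<longlonglongrightarrow>
      (LINT x:(\<Union>n::nat. box (- (real n *\<^sub>R One)) (real n *\<^sub>R One))|lborel. f x)"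
  proof (rule set_integral_cont_up)
    show "incseq (\<lambda>n::nat. box (- (real n *\<^sub>R One)) (real n *\<^sub>R One) :: (real^3) set)"
      by (rule incseq_SucI, rule subset_box_imp) (auto simp: inner_Basis)
  qed (auto intro: si)
  then have whole: "(LINT x:UNIV|lborel. f x) = 0" by (simp add: UN box0 LIMSEQ_const_iff)
  fix A :: "(real^3) set" assume "A \<in> sets lborel"
  then have A: "A \<in> sigma_sets UNIV (range (\<lambda>(a, b). box a b))" by (simp add: borel_eq_box)
  have stable: "Int_stable (range (\<lambda>(a, b). box a b :: (real^3) set))"
    by (auto simp: Int_stable_def box_Int_box)
  have Pow: "range (\<lambda>(a, b). box a b :: (real^3) set) \<subseteq> Pow UNIV" by simp
  show "(LINT x:A|lborel. f x) = 0"
    using stable Pow A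
  proof (induction rule: sigma_sets_induct_disjoint)
    case (compl A)
    then have A: "A \<in> sets borel" by (simp add: borel_eq_box)
    have "(LINT x:A \<union> (UNIV - A)|lborel. f x) = (LINT x:A|lborel. f x) + (LINT x:UNIV - A|lborel. f x)"
      using A by (intro set_integral_Un si) auto
    then show ?case using compl whole by simp
  next
    case (union A)
    have "A i \<in> sets borel" for i
      using union(2) unfolding borel_eq_box by (subst sets_measure_of) (auto simp: image_subset_iff)
    then show ?case using union
      by (subst lebesgue_integral_countable_add) (auto intro!: si simp: disjoint_family_on_def)
  qed (use box0 in \<open>auto simp: set_lebesgue_integral_def\<close>)
qed

text \<open>The same on a single box, for functions that are only Lebesgue measurable; a Borel measurable
  representative reduces this to the previous lemma.\<close>

lemma AE_eq_0_on_box: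
  fixes f :: "real^3 \<Rightarrow> real"
  assumes f: "integrable (lebesgue_on \<Omega>) f" and \<Omega>: "\<Omega> \<in> sets lebesgue" and sub: "box l u \<subseteq> \<Omega>"
    and box0: "\<And>p q. box p q \<subseteq> box l u \<Longrightarrow> (LINT x|lebesgue_on \<Omega>. indicator (box p q) x * f x) = 0"
  shows "AE x in lebesgue. x \<in> box l u \<longrightarrow> f x = 0"
proof -
  have \<Omega>': "\<Omega> \<inter> space lebesgue \<in> sets lebesgue" using \<Omega> by simp
  define g where "g = (\<lambda>x. indicator (box l u) x * (indicator \<Omega> x * f x))"
  have "integrable lebesgue (\<lambda>x. indicator \<Omega> x * f x)"
    using f unfolding integrable_restrict_space[OF \<Omega>'] by simp
  then have g: "integrable lebesgue g"
    unfolding g_def using integrable_mult_indicator[of "box l u" lebesgue "\<lambda>x. indicator \<Omega> x * f x"] by simp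
  then obtain h where h: "h \<in> borel_measurable lborel" "AE x in lborel. g x = h x"
    using completion_ex_borel_measurable_real[of g lborel] by auto
  have gh: "AE x in lebesgue. g x = h x" using h(2) by (rule AE_completion)
  have h_leb: "h \<in> borel_measurable lebesgue" using h(1) by (rule measurable_completion)
  have "integrable lebesgue h"
    by (rule integrable_cong_AE_imp[OF g h_leb gh])
  then have hint: "integrable lborel h" using integrable_completion[OF h(1)] by simp
  have "AE x in lborel. h x = 0"
  proof (rule AE_eq_0_if_box_integrals_eq_0[OF hint])
    fix p q :: "real^3"
    obtain p' q' where pq: "box p q \<inter> box l u = box p' q'" using box_Int_box[of p q l u] by blast
    have "(LINT x:box p q|lborel. h x) = (LINT x|lebesgue. indicator (box p q) x * h x)"
      unfolding set_lebesgue_integral_def using h(1)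
      by (subst integral_completion[symmetric]) auto
    also have "\<dots> = (LINT x|lebesgue. indicator (box p q) x * g x)"
    proof (rule integral_cong_AE)
      show "AE x in lebesgue. indicator (box p q) x * h x = indicator (box p q) x * g x"
        using gh by eventually_elim simp
    qed (use h_leb borel_measurable_integrable[OF g] in
      \<open>intro borel_measurable_times borel_measurable_indicator; simp\<close>)+
    also have "\<dots> = (LINT x|lebesgue. indicator \<Omega> x *\<^sub>R (indicator (box p' q') x * f x))"
      unfolding g_def pq[symmetric] by (simp add: indicator_inter_arith mult_ac)
    also have "\<dots> = (LINT x|lebesgue_on \<Omega>. indicator (box p' q') x * f x)"
      by (rule integral_restrict_space[OF \<Omega>', symmetric])
    also have "\<dots> = 0" using pq by (intro box0) auto
    finally show "(LINT x:box p q|lborel. h x) = 0" .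
  qed
  then have "AE x in lebesgue. h x = 0" by (rule AE_completion)
  with gh show ?thesis
  proof eventually_elim
    case (elim x)
    then show ?case using sub by (auto simp: g_def)
  qed
qed

context bounded_open
begin

text \<open>Tensor products of bumps converge to indicator functions of boxes, hence \<open>\<integral>w = \<kappa> |Q|\<close> for every box
  \<open>Q\<close> in the given one, with the same \<open>\<kappa>\<close>.\<close>

lemma weak_const_local:
  assumes w: "has_weak_grad \<Omega> w (\<lambda>x. 0)" and Q: "cbox l u \<subseteq> \<Omega>" and lu: "\<And>i. l $ i < u $ i"
  shows "\<exists>\<kappa>. AE x in lebesgue. x \<in> box l u \<longrightarrow> w x = \<kappa>"
proof -
  have wL2: "w \<in> L2 \<Omega>" using w by (simp add: has_weak_grad_def)
  have sub: "box l u \<subseteq> \<Omega>" using Q box_subset_cbox by blast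
  have mb: "box p q \<in> sets (lebesgue_on \<Omega>)" if "box p q \<subseteq> box l u" for p q
  proof -
    have "box p q = \<Omega> \<inter> box p q" using that sub by blast
    then show ?thesis unfolding sets_restrict_space by (rule image_eqI) simp
  qed
  define \<beta> where "\<beta> = (\<lambda>j. bump (l $ j) (u $ j) 0)"
  have \<beta>: "smooth1 (\<beta> j)" "t \<notin> {l $ j..u $ j} \<Longrightarrow> \<beta> j t = 0" for j t
    by (auto simp: \<beta>_def smooth1_bump intro!: bump_outside)
  define A where "A = (\<Prod>i\<in>UNIV. integral {l $ i..u $ i} (\<beta> i))"
  have "integral {l $ i..u $ i} (\<beta> i) \<noteq> 0" for i
  proof
    assume "integral {l $ i..u $ i} (\<beta> i) = 0"
    then have "\<forall>t\<in>{l $ i..u $ i}. \<beta> i t = 0"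
      using lu[of i]
      by (subst (asm) integral_eq_0_iff) (auto simp: \<beta>_def bump_bounds intro!: smooth1_continuous smooth1_bump)
    moreover have "\<beta> i ((l $ i + u $ i) / 2) > 0"
      unfolding \<beta>_def using lu[of i] by (intro bump_pos) (auto simp: field_simps)
    ultimately show False using lu[of i] by (auto simp: field_simps dest!: bspec[of _ _ "(l $ i + u $ i) / 2"])
  qed
  then have A: "A \<noteq> 0" by (simp add: A_def)
  define \<kappa> where "\<kappa> = l2_inner \<Omega> w (tensor \<beta>) / A"
  have box_int: "(LINT x|lebesgue_on \<Omega>. indicator (box p q) x * w x) = \<kappa> * measure lborel (box p q)"
    if pq: "box p q \<subseteq> box l u" "box p q \<noteq> {}" for p q
  proof -
    have pq_lt: "p $ j < q $ j" for j using pq(2) by (auto simp: interval_eq_empty_cart not_le)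
    have pq_sub: "l $ j \<le> p $ j" "q $ j \<le> u $ j" for j
      using pq(1) pq_lt by (auto simp: subset_interval_cart)
    define b where "b = (\<lambda>n j. bump (p $ j) (q $ j) n)"
    have out: "t \<notin> {l $ j..u $ j} \<Longrightarrow> b n j t = 0" for n j t
      unfolding b_def using pq_sub[of j] by (intro bump_outside) auto
    have "A * l2_inner \<Omega> w (tensor (b n)) = (\<Prod>i\<in>UNIV. integral {l $ i..u $ i} (b n i)) * l2_inner \<Omega> w (tensor \<beta>)" for n
      unfolding A_def using out lu
      by (intro weak_const_tensor[OF w Q _ \<beta>]) (auto simp: b_def smooth1_bump less_imp_le)
    then have eq: "l2_inner \<Omega> w (tensor (b n)) = \<kappa> * (\<Prod>i\<in>UNIV. integral {l $ i..u $ i} (b n i))" for n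
      using A by (simp add: \<kappa>_def field_simps)
    have lim1: "(\<lambda>n. integral {l $ i..u $ i} (b n i)) \<longlonglongrightarrow> q $ i - p $ i" for i
    proof -
      have "(\<lambda>n. integral {l $ i..u $ i} (b n i)) \<longlonglongrightarrow> integral {l $ i..u $ i} (indicator {p $ i<..<q $ i})"
        by (rule dominated_convergence(2)[where h = "\<lambda>_. 1"])
          (auto simp: b_def bump_bounds bump_tendsto intro!: integrable_continuous_real smooth1_continuous smooth1_bump smooth1_const)
      also have "integral {l $ i..u $ i} (indicator {p $ i<..<q $ i} :: real \<Rightarrow> real) = q $ i - p $ i"
      proof -
        have "((\<lambda>t. 1) has_integral (q $ i - p $ i)) {p $ i..q $ i}"
          using has_integral_const_real[of "1::real" "p $ i" "q $ i"] pq_lt[of i] by simp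
        then have "((\<lambda>t. if t \<in> {p $ i..q $ i} then 1 else 0) has_integral (q $ i - p $ i)) {l $ i..u $ i}"
          using pq_sub[of i] by (subst has_integral_restrict) auto
        then have "(indicator {p $ i<..<q $ i} has_integral (q $ i - p $ i)) {l $ i..u $ i}"
          by (rule has_integral_spike[of "{p $ i, q $ i}", rotated 2]) (auto simp: indicator_def)
        then show ?thesis by (rule integral_unique)
      qed
      finally show ?thesis .
    qed
    have limit: "(\<lambda>n. l2_inner \<Omega> w (tensor (b n))) \<longlonglongrightarrow> \<kappa> * (\<Prod>i\<in>UNIV. q $ i - p $ i)"
      unfolding eq by (intro tendsto_intros lim1)
    have limit': "(\<lambda>n. l2_inner \<Omega> w (tensor (b n))) \<longlonglongrightarrow> (LINT x|lebesgue_on \<Omega>. indicator (box p q) x * w x)"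
      unfolding l2_inner_def
    proof (rule integral_dominated_convergence[where w = "\<lambda>x. \<bar>w x\<bar>"])
      show "integrable (lebesgue_on \<Omega>) (\<lambda>x. \<bar>w x\<bar>)"
        using integrable_L2[OF wL2] by simp
      show "AE x in lebesgue_on \<Omega>. norm (w x \<bullet> tensor (b n) x) \<le> \<bar>w x\<bar>" for n
      proof (rule AE_I2)
        fix x
        have "0 \<le> tensor (b n) x" "tensor (b n) x \<le> 1"
          unfolding tensor_def b_def by (auto intro!: prod_nonneg prod_le_1 bump_bounds)
        then show "norm (w x \<bullet> tensor (b n) x) \<le> \<bar>w x\<bar>"
          by (simp add: abs_mult mult_left_le)
      qed
      show "AE x in lebesgue_on \<Omega>. (\<lambda>n. w x \<bullet> tensor (b n) x) \<longlonglongrightarrow> indicator (box p q) x * w x"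
      proof (rule AE_I2)
        fix x
        have "(\<lambda>n. tensor (b n) x) \<longlonglongrightarrow> (\<Prod>j\<in>UNIV. indicator {p $ j<..<q $ j} (x $ j))"
          unfolding tensor_def b_def by (intro tendsto_prod bump_tendsto)
        also have "(\<Prod>j\<in>UNIV. indicator {p $ j<..<q $ j} (x $ j)) = (indicator (box p q) x :: real)"
          by (auto simp: indicator_def mem_box_cart intro!: prod_zero)
        finally have "(\<lambda>n. w x * tensor (b n) x) \<longlonglongrightarrow> w x * indicator (box p q) x"
          by (intro tendsto_mult tendsto_const)
        then show "(\<lambda>n. w x \<bullet> tensor (b n) x) \<longlonglongrightarrow> indicator (box p q) x * w x"
          by (simp add: mult.commute)
      qed
      show "(\<lambda>x. w x \<bullet> tensor (b n) x) \<in> borel_measurable (lebesgue_on \<Omega>)" for n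
      proof -
        have "tensor (b n) \<in> test_functions \<Omega>"
          using out by (intro tensor_test[OF Q]) (auto simp: b_def smooth1_bump)
        then show ?thesis
          using integrable_inner_L2[OF wL2 test_L2] borel_measurable_integrable by blast
      qed
      show "(\<lambda>x. indicator (box p q) x * w x) \<in> borel_measurable (lebesgue_on \<Omega>)"
        by (rule borel_measurable_times[OF borel_measurable_indicator[OF mb[OF pq(1)]] L2_D(1)[OF wL2]])
    qed
    have content: "(\<Prod>i\<in>UNIV. q $ i - p $ i) = measure lborel (box p q)"
    proof -
      have "cbox p q \<noteq> {}" using pq_lt by (auto simp: interval_eq_empty_cart not_less less_imp_le)
      then have "(\<Prod>i\<in>UNIV. q $ i - p $ i) = measure lborel (cbox p q)" by (rule content_cbox_cart[symmetric])
      then show ?thesis by (simp only: measure_lborel_cbox_eq measure_lborel_box_eq)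
    qed
    show ?thesis using LIMSEQ_unique[OF limit' limit] unfolding content .
  qed
  have "AE x in lebesgue. x \<in> box l u \<longrightarrow> w x - \<kappa> = 0"
  proof (rule AE_eq_0_on_box[OF _ _ sub])
    show "integrable (lebesgue_on \<Omega>) (\<lambda>x. w x - \<kappa>)" using integrable_L2[OF wL2] by simp
    show "\<Omega> \<in> sets lebesgue" using lmeas by (rule fmeasurableD)
    fix p q assume pq: "box p q \<subseteq> box l u"
    show "(LINT x|lebesgue_on \<Omega>. indicator (box p q) x * (w x - \<kappa>)) = 0"
    proof (cases "box p q = {}")
      case False
      have i1: "integrable (lebesgue_on \<Omega>) (\<lambda>x. indicator (box p q) x * w x)"
        using integrable_mult_indicator[OF mb[OF pq] integrable_L2[OF wL2]] by simp
      have i2: "integrable (lebesgue_on \<Omega>) (\<lambda>x. indicator (box p q) x * \<kappa>)"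
        using integrable_mult_indicator[OF mb[OF pq], of "\<lambda>x. \<kappa>"] by simp
      have "(LINT x|lebesgue_on \<Omega>. indicator (box p q) x * \<kappa>) = measure (lebesgue_on \<Omega>) (box p q) * \<kappa>"
        using mb[OF pq] by (simp add: Int_absorb2[OF order_trans[OF pq sub]])
      also have "measure (lebesgue_on \<Omega>) (box p q) = measure lborel (box p q)"
        using pq sub lmeas by (subst measure_restrict_space) (auto simp: fmeasurableD)
      finally have i3: "(LINT x|lebesgue_on \<Omega>. indicator (box p q) x * \<kappa>) = measure lborel (box p q) * \<kappa>" .
      have "(LINT x|lebesgue_on \<Omega>. indicator (box p q) x * (w x - \<kappa>)) =
          (LINT x|lebesgue_on \<Omega>. indicator (box p q) x * w x) - (LINT x|lebesgue_on \<Omega>. indicator (box p q) x * \<kappa>)"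
        using Bochner_Integration.integral_diff[OF i1 i2] by (simp add: right_diff_distrib)
      then show ?thesis unfolding i3 using box_int[OF pq False] by (simp add: mult.commute)
    qed simp
  qed
  then show ?thesis by (intro exI[of _ \<kappa>]) simp
qed


text \<open>The local almost everywhere value is a locally constant function of the point, hence constant on the
  connected set; being null is a local property as well.\<close>

lemma weak_grad_zero_imp_const:
  assumes w: "has_weak_grad \<Omega> w (\<lambda>x. 0)" and conn: "connected \<Omega>"
  shows "\<exists>\<kappa>. AE x in lebesgue_on \<Omega>. w x = \<kappa>"
proof -
  define P where "P = (\<lambda>p \<kappa>. \<exists>r>0. ball p r \<subseteq> \<Omega> \<and> (AE x in lebesgue. x \<in> ball p r \<longrightarrow> w x = \<kappa>))"
  have ex: "\<exists>\<kappa>. P p \<kappa>" if p: "p \<in> \<Omega>" for p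
  proof -
    obtain a b where ab: "p \<in> box a b" "cbox a b \<subseteq> \<Omega>"
      by (rule open_contains_cbox[OF open_dom p])
    have "a $ i < b $ i" for i
    proof -
      have "a $ i < p $ i \<and> p $ i < b $ i" using ab(1) by (simp add: mem_box_cart)
      then show ?thesis by linarith
    qed
    then obtain \<kappa> where \<kappa>: "AE x in lebesgue. x \<in> box a b \<longrightarrow> w x = \<kappa>"
      using weak_const_local[OF w ab(2)] by blast
    obtain r where r: "r > 0" "ball p r \<subseteq> box a b"
      by (rule openE[OF open_box ab(1)])
    moreover have "AE x in lebesgue. x \<in> ball p r \<longrightarrow> w x = \<kappa>"
      using \<kappa> by eventually_elim (use r in blast)
    moreover have "ball p r \<subseteq> \<Omega>" using r(2) ab(2) box_subset_cbox[of a b] by blast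
    ultimately show ?thesis unfolding P_def by blast
  qed
  have unique: "\<kappa> = \<kappa>'" if "P p \<kappa>" "P p \<kappa>'" for p \<kappa> \<kappa>'
  proof (rule ccontr)
    assume ne: "\<kappa> \<noteq> \<kappa>'"
    obtain r r' where r: "r > 0" "AE x in lebesgue. x \<in> ball p r \<longrightarrow> w x = \<kappa>"
      "r' > 0" "AE x in lebesgue. x \<in> ball p r' \<longrightarrow> w x = \<kappa>'" using \<open>P p \<kappa>\<close> \<open>P p \<kappa>'\<close> unfolding P_def by blast
    have "AE x in lebesgue. x \<notin> ball p (min r r')"
      using r(2,4) by eventually_elim (use ne in auto)
    then have "ball p (min r r') \<in> null_sets lebesgue"
      by (subst AE_iff_null_sets) (auto intro: fmeasurableD lmeasurable_ball)
    then have "negligible (ball p (min r r'))"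
      by (simp only: negligible_iff_null_sets)
    then show False using r(1,3) open_not_negligible[of "ball p (min r r')"] by auto
  qed
  define k where "k = (\<lambda>p. SOME \<kappa>. P p \<kappa>)"
  have k: "P p (k p)" if "p \<in> \<Omega>" for p unfolding k_def using someI_ex[OF ex[OF that]] .
  have "k constant_on \<Omega>"
  proof (rule locally_constant_imp_constant[OF conn])
    fix p assume p: "p \<in> \<Omega>"
    obtain r where r: "r > 0" "ball p r \<subseteq> \<Omega>" "AE x in lebesgue. x \<in> ball p r \<longrightarrow> w x = k p"
      using k[OF p] unfolding P_def by blast
    have "k q = k p" if q: "q \<in> ball p r" for q
    proof (rule unique)
      show "P q (k q)" using k q r(2) by blast
      obtain s where s: "s > 0" "ball q s \<subseteq> ball p r"
        by (rule openE[OF open_ball q])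
      moreover have "AE x in lebesgue. x \<in> ball q s \<longrightarrow> w x = k p"
        using r(3) by eventually_elim (use s in blast)
      ultimately show "P q (k p)" unfolding P_def using r(2) by blast
    qed
    then show "\<exists>T. openin (top_of_set \<Omega>) T \<and> p \<in> T \<and> (\<forall>x\<in>T. k x = k p)"
      using open_subset[OF r(2) open_ball] centre_in_ball[of p r] r(1) by blast
  qed
  then obtain \<kappa> where \<kappa>: "\<And>p. p \<in> \<Omega> \<Longrightarrow> k p = \<kappa>" unfolding constant_on_def by blast
  define N where "N = {x \<in> \<Omega>. w x \<noteq> \<kappa>}"
  have "negligible N"
  proof (rule locally_negligible_alt[THEN iffD2], rule ballI)
    fix p assume "p \<in> N"
    then have p: "p \<in> \<Omega>" by (simp add: N_def)
    obtain r where r: "r > 0" "ball p r \<subseteq> \<Omega>" "AE x in lebesgue. x \<in> ball p r \<longrightarrow> w x = \<kappa>"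
      using k[OF p] \<kappa>[OF p] unfolding P_def by auto
    have "AE x in lebesgue. x \<notin> N \<inter> ball p r"
      using r(3) by eventually_elim (auto simp: N_def)
    then obtain M where M: "N \<inter> ball p r \<subseteq> M" "M \<in> null_sets lebesgue"
      unfolding eventually_ae_filter by (auto simp del: mem_ball)
    then have "negligible (N \<inter> ball p r)"
      using negligible_subset[of M "N \<inter> ball p r"] by (simp add: negligible_iff_null_sets)
    then show "\<exists>U. openin (top_of_set N) U \<and> p \<in> U \<and> negligible U"
      using \<open>p \<in> N\<close> openin_open_Int[OF open_ball, of N p r] centre_in_ball[of p r] r(1) by blast
  qed
  then have "AE x in lebesgue. x \<notin> N"
    by (simp add: negligible_iff_null_sets AE_not_in)
  then have "AE x in lebesgue. x \<in> \<Omega> \<longrightarrow> w x = \<kappa>" by eventually_elim (auto simp: N_def)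
  then show ?thesis
    using lmeas by (intro exI[of _ \<kappa>]) (simp add: AE_restrict_space_iff fmeasurableD)
qed

end

section \<open>Weak gradients and closures of test functions\<close>

lemma l2_norm_nonneg [simp]: "0 \<le> l2_norm \<Omega> f"
  by (simp add: l2_norm_def l2_inner_def)

lemma l2_inner_commute: "l2_inner \<Omega> f g = l2_inner \<Omega> g f"
  by (simp add: l2_inner_def inner_commute)

lemma l2_inner_zero [simp]: "l2_inner \<Omega> (\<lambda>x. 0) f = 0" "l2_inner \<Omega> f (\<lambda>x. 0) = 0"
  by (simp_all add: l2_inner_def)

lemma approx_by_test_iff:
  "approx_by_test \<Omega> A u f \<longleftrightarrow>
    (\<forall>e>0. \<exists>\<phi>\<in>test_functions \<Omega>. l2_norm \<Omega> (u - \<phi>) < e \<and> l2_norm \<Omega> (f - A \<phi>) < e)"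
proof -
  have eq: "graph_norm \<Omega> (\<lambda>x. u x - \<phi> x) (\<lambda>x. f x - A \<phi> x) =
      sqrt ((l2_norm \<Omega> (u - \<phi>))\<^sup>2 + (l2_norm \<Omega> (f - A \<phi>))\<^sup>2)" for \<phi>
    by (simp add: graph_norm_def fun_diff_def)
  show ?thesis
  proof
    assume L: "approx_by_test \<Omega> A u f"
    show "\<forall>e>0. \<exists>\<phi>\<in>test_functions \<Omega>. l2_norm \<Omega> (u - \<phi>) < e \<and> l2_norm \<Omega> (f - A \<phi>) < e"
    proof (intro allI impI)
      fix e :: real assume "e > 0"
      then obtain \<phi> where \<phi>: "\<phi> \<in> test_functions \<Omega>"
        "sqrt ((l2_norm \<Omega> (u - \<phi>))\<^sup>2 + (l2_norm \<Omega> (f - A \<phi>))\<^sup>2) < e"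
        using L unfolding approx_by_test_def eq by blast
      then show "\<exists>\<phi>\<in>test_functions \<Omega>. l2_norm \<Omega> (u - \<phi>) < e \<and> l2_norm \<Omega> (f - A \<phi>) < e"
        using real_sqrt_sum_squares_ge1[of "l2_norm \<Omega> (u - \<phi>)" "l2_norm \<Omega> (f - A \<phi>)"]
          real_sqrt_sum_squares_ge2[of "l2_norm \<Omega> (f - A \<phi>)" "l2_norm \<Omega> (u - \<phi>)"]
        by (intro bexI[of _ \<phi>]) linarith+
    qed
  next
    assume R: "\<forall>e>0. \<exists>\<phi>\<in>test_functions \<Omega>. l2_norm \<Omega> (u - \<phi>) < e \<and> l2_norm \<Omega> (f - A \<phi>) < e"
    show "approx_by_test \<Omega> A u f"
      unfolding approx_by_test_def eq
    proof (intro allI impI)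
      fix e :: real assume "e > 0"
      then obtain \<phi> where \<phi>: "\<phi> \<in> test_functions \<Omega>"
        "l2_norm \<Omega> (u - \<phi>) < e / 2" "l2_norm \<Omega> (f - A \<phi>) < e / 2"
        using R half_gt_zero by blast
      then show "\<exists>\<phi>\<in>test_functions \<Omega>. sqrt ((l2_norm \<Omega> (u - \<phi>))\<^sup>2 + (l2_norm \<Omega> (f - A \<phi>))\<^sup>2) < e"
        using sqrt_sum_squares_le_sum_abs[of "l2_norm \<Omega> (u - \<phi>)" "l2_norm \<Omega> (f - A \<phi>)"]
        by (intro bexI[of _ \<phi>]) simp_all
    qed
  qed
qed

context bounded_open
begin

text \<open>The closure in \<open>L2 \<times> L2\<close> of the graph of a differential operator \<open>A\<close> on test functions.\<close>

definition test_closure ::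
  "((real^3 \<Rightarrow> 'b::euclidean_space) \<Rightarrow> real^3 \<Rightarrow> 'c::euclidean_space) \<Rightarrow> ((real^3 \<Rightarrow> 'b) \<times> (real^3 \<Rightarrow> 'c)) set" where
  "test_closure A = {(u, f). u \<in> L2 \<Omega> \<and> f \<in> L2 \<Omega> \<and> approx_by_test \<Omega> A u f}"

lemma test_closure_approx:
  assumes "(u, f) \<in> test_closure A" "e > 0"
  obtains \<phi> where "\<phi> \<in> test_functions \<Omega>" "l2_norm \<Omega> (u - \<phi>) < e" "l2_norm \<Omega> (f - A \<phi>) < e"
proof -
  have "\<forall>e>0. \<exists>\<phi>\<in>test_functions \<Omega>. l2_norm \<Omega> (u - \<phi>) < e \<and> l2_norm \<Omega> (f - A \<phi>) < e"
    using assms(1) unfolding test_closure_def approx_by_test_iff by simp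
  with assms(2) that show ?thesis by blast
qed

lemma subspace_test_closure:
  assumes test: "\<And>\<phi>. \<phi> \<in> test_functions \<Omega> \<Longrightarrow> A \<phi> \<in> test_functions \<Omega>"
    and lin: "\<And>\<phi> \<psi> c. \<phi> \<in> test_functions \<Omega> \<Longrightarrow> \<psi> \<in> test_functions \<Omega> \<Longrightarrow>
      A (\<lambda>x. \<phi> x + c *\<^sub>R \<psi> x) = (\<lambda>x. A \<phi> x + c *\<^sub>R A \<psi> x)"
  shows "subspace (test_closure A)"
proof -
  interpret U: semi_inner "L2 \<Omega> :: (real^3 \<Rightarrow> 'a) set" "l2_inner \<Omega>" by (rule semi_inner_L2)
  interpret F: semi_inner "L2 \<Omega> :: (real^3 \<Rightarrow> 'b) set" "l2_inner \<Omega>" by (rule semi_inner_L2)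
  have L: "(u + c *\<^sub>R u', f + c *\<^sub>R f') \<in> test_closure A"
    if "(u, f) \<in> test_closure A" "(u', f') \<in> test_closure A" for u f u' f' c
  proof -
    have L2: "u \<in> L2 \<Omega>" "f \<in> L2 \<Omega>" "u' \<in> L2 \<Omega>" "f' \<in> L2 \<Omega>"
      using that by (auto simp: test_closure_def)
    have "\<exists>\<phi>\<in>test_functions \<Omega>. l2_norm \<Omega> (u + c *\<^sub>R u' - \<phi>) < e \<and> l2_norm \<Omega> (f + c *\<^sub>R f' - A \<phi>) < e"
      if e: "e > 0" for e
    proof -
      define d where "d = e / (1 + \<bar>c\<bar>)"
      have d: "d > 0" "d * (1 + \<bar>c\<bar>) = e" using e by (auto simp: d_def field_simps)
      obtain \<phi> where \<phi>: "\<phi> \<in> test_functions \<Omega>" "l2_norm \<Omega> (u - \<phi>) < d" "l2_norm \<Omega> (f - A \<phi>) < d"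
        by (rule test_closure_approx[OF \<open>(u, f) \<in> test_closure A\<close> d(1)])
      obtain \<psi> where \<psi>: "\<psi> \<in> test_functions \<Omega>" "l2_norm \<Omega> (u' - \<psi>) < d" "l2_norm \<Omega> (f' - A \<psi>) < d"
        by (rule test_closure_approx[OF \<open>(u', f') \<in> test_closure A\<close> d(1)])
      define \<theta> where "\<theta> = (\<lambda>x. \<phi> x + c *\<^sub>R \<psi> x)"
      have \<theta>: "\<theta> \<in> test_functions \<Omega>"
        unfolding \<theta>_def by (intro test_add \<phi> test_linear[OF \<psi>(1) bounded_linear_scaleR_right])
      have eq: "u + c *\<^sub>R u' - \<theta> = (u - \<phi>) + c *\<^sub>R (u' - \<psi>)"
        "f + c *\<^sub>R f' - A \<theta> = (f - A \<phi>) + c *\<^sub>R (f' - A \<psi>)"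
        unfolding \<theta>_def lin[OF \<phi>(1) \<psi>(1)] by (auto simp: fun_eq_iff algebra_simps)
      note mem = L2 \<phi>(1)[THEN test_L2] \<psi>(1)[THEN test_L2] test[OF \<phi>(1), THEN test_L2] test[OF \<psi>(1), THEN test_L2]
      have "\<bar>c\<bar> * l2_norm \<Omega> (u' - \<psi>) \<le> \<bar>c\<bar> * d" "\<bar>c\<bar> * l2_norm \<Omega> (f' - A \<psi>) \<le> \<bar>c\<bar> * d"
        using \<psi> by (auto intro: mult_left_mono)
      moreover have "l2_norm \<Omega> ((u - \<phi>) + c *\<^sub>R (u' - \<psi>)) \<le> l2_norm \<Omega> (u - \<phi>) + \<bar>c\<bar> * l2_norm \<Omega> (u' - \<psi>)"
        using U.nrm_triangle[of "u - \<phi>" "c *\<^sub>R (u' - \<psi>)"] U.nrm_scale[of "u' - \<psi>" c] mem by (simp add: nrm_L2)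
      moreover have "l2_norm \<Omega> ((f - A \<phi>) + c *\<^sub>R (f' - A \<psi>)) \<le> l2_norm \<Omega> (f - A \<phi>) + \<bar>c\<bar> * l2_norm \<Omega> (f' - A \<psi>)"
        using F.nrm_triangle[of "f - A \<phi>" "c *\<^sub>R (f' - A \<psi>)"] F.nrm_scale[of "f' - A \<psi>" c] mem by (simp add: nrm_L2)
      moreover have "d + \<bar>c\<bar> * d = e" using d(2) by (simp add: algebra_simps)
      ultimately show ?thesis unfolding eq[symmetric] using \<theta> \<phi>(2,3) by (intro bexI[of _ \<theta>] conjI) linarith+
    qed
    then show ?thesis using L2 by (auto simp: test_closure_def approx_by_test_iff)
  qed
  have Z: "(0, 0) \<in> test_closure A"
  proof -
    have z: "(0 :: real^3 \<Rightarrow> 'a) \<in> test_functions \<Omega>" using test_zero by (simp add: zero_fun_def)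
    have "A 0 = A (\<lambda>x. 0 x + (- 1) *\<^sub>R 0 x)" by (simp add: zero_fun_def)
    also have "\<dots> = 0" unfolding lin[OF z z] by (simp add: zero_fun_def)
    finally have "A 0 = 0" .
    then have "approx_by_test \<Omega> A 0 0"
      unfolding approx_by_test_iff using z by (auto intro!: bexI[of _ 0] simp: l2_norm_def l2_inner_def zero_fun_def)
    then show ?thesis by (simp add: test_closure_def)
  qed
  show ?thesis
  proof (rule subspaceI)
    show "0 \<in> test_closure A" using Z by (simp add: zero_prod_def)
    fix p q :: "(real^3 \<Rightarrow> 'a) \<times> (real^3 \<Rightarrow> 'b)" assume p: "p \<in> test_closure A"
    obtain u f where uf: "p = (u, f)" by (cases p)
    show "c *\<^sub>R p \<in> test_closure A" for c
      using L[OF Z, of u f c] p unfolding uf by simp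
    assume q: "q \<in> test_closure A"
    obtain u' f' where uf': "q = (u', f')" by (cases q)
    show "p + q \<in> test_closure A"
      using L[of u f u' f' 1] p q unfolding uf uf' by simp
  qed
qed

lemma closed_test_closure:
  fixes A :: "(real^3 \<Rightarrow> 'b::euclidean_space) \<Rightarrow> real^3 \<Rightarrow> 'c::euclidean_space"
  assumes test: "\<And>\<phi>. \<phi> \<in> test_functions \<Omega> \<Longrightarrow> A \<phi> \<in> test_functions \<Omega>"
    and st: "\<And>n::nat. (s n, t n) \<in> test_closure A" and u: "u \<in> L2 \<Omega>" and f: "f \<in> L2 \<Omega>"
    and lim: "(\<lambda>n. l2_norm \<Omega> (s n - u)) \<longlonglongrightarrow> 0" "(\<lambda>n. l2_norm \<Omega> (t n - f)) \<longlonglongrightarrow> 0"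
  shows "(u, f) \<in> test_closure A"
proof -
  interpret U: semi_inner "L2 \<Omega> :: (real^3 \<Rightarrow> 'b) set" "l2_inner \<Omega>" by (rule semi_inner_L2)
  interpret F: semi_inner "L2 \<Omega> :: (real^3 \<Rightarrow> 'c) set" "l2_inner \<Omega>" by (rule semi_inner_L2)
  have "\<exists>\<phi>\<in>test_functions \<Omega>. l2_norm \<Omega> (u - \<phi>) < e \<and> l2_norm \<Omega> (f - A \<phi>) < e" if e: "e > 0" for e
  proof -
    have "\<forall>\<^sub>F n in sequentially. l2_norm \<Omega> (s n - u) < e / 2 \<and> l2_norm \<Omega> (t n - f) < e / 2"
      using order_tendstoD(2)[OF lim(1), of "e / 2"] order_tendstoD(2)[OF lim(2), of "e / 2"] e
      by (auto intro: eventually_conj)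
    then obtain n where n: "l2_norm \<Omega> (s n - u) < e / 2" "l2_norm \<Omega> (t n - f) < e / 2"
      by (auto simp: eventually_sequentially)
    obtain \<phi> where \<phi>: "\<phi> \<in> test_functions \<Omega>" "l2_norm \<Omega> (s n - \<phi>) < e / 2" "l2_norm \<Omega> (t n - A \<phi>) < e / 2"
      by (rule test_closure_approx[OF st[of n] half_gt_zero[OF e]])
    have mem: "s n \<in> L2 \<Omega>" "t n \<in> L2 \<Omega>" "\<phi> \<in> L2 \<Omega>" "A \<phi> \<in> L2 \<Omega>"
      using st[of n] \<phi>(1) test test_L2 by (auto simp: test_closure_def)
    have "l2_norm \<Omega> (u - \<phi>) \<le> l2_norm \<Omega> (s n - u) + l2_norm \<Omega> (s n - \<phi>)"
      using U.nrm_triangle[of "u - s n" "s n - \<phi>"] U.nrm_commute[of u "s n"] u mem by (simp add: nrm_L2)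
    moreover have "l2_norm \<Omega> (f - A \<phi>) \<le> l2_norm \<Omega> (t n - f) + l2_norm \<Omega> (t n - A \<phi>)"
      using F.nrm_triangle[of "f - t n" "t n - A \<phi>"] F.nrm_commute[of f "t n"] f mem by (simp add: nrm_L2)
    ultimately show ?thesis using \<phi> n by (intro bexI[of _ \<phi>] conjI) linarith+
  qed
  then show ?thesis using u f by (simp add: test_closure_def approx_by_test_iff)
qed

text \<open>An identity \<open>\<langle>A \<phi>, q\<rangle> = \<langle>\<phi>, p\<rangle>\<close> for test functions extends to the closure of \<open>A\<close>.\<close>

lemma test_closure_pairing:
  fixes A :: "(real^3 \<Rightarrow> 'b::euclidean_space) \<Rightarrow> real^3 \<Rightarrow> 'c::euclidean_space"
  assumes test: "\<And>\<phi>. \<phi> \<in> test_functions \<Omega> \<Longrightarrow> A \<phi> \<in> test_functions \<Omega>"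
    and uf: "(u, f) \<in> test_closure A" and p: "p \<in> L2 \<Omega>" and q: "q \<in> L2 \<Omega>"
    and eq: "\<And>\<phi>. \<phi> \<in> test_functions \<Omega> \<Longrightarrow> l2_inner \<Omega> (A \<phi>) q = l2_inner \<Omega> \<phi> p"
  shows "l2_inner \<Omega> f q = l2_inner \<Omega> u p"
proof -
  interpret U: semi_inner "L2 \<Omega> :: (real^3 \<Rightarrow> 'b) set" "l2_inner \<Omega>" by (rule semi_inner_L2)
  interpret F: semi_inner "L2 \<Omega> :: (real^3 \<Rightarrow> 'c) set" "l2_inner \<Omega>" by (rule semi_inner_L2)
  have L2: "u \<in> L2 \<Omega>" "f \<in> L2 \<Omega>" using uf by (auto simp: test_closure_def)
  have "\<bar>l2_inner \<Omega> f q - l2_inner \<Omega> u p\<bar> \<le> e" if e: "e > 0" for e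
  proof -
    define K where "K = 1 + l2_norm \<Omega> q + l2_norm \<Omega> p"
    have K: "K > 0" using l2_norm_nonneg[of \<Omega> q] l2_norm_nonneg[of \<Omega> p] unfolding K_def by linarith
    obtain \<phi> where \<phi>: "\<phi> \<in> test_functions \<Omega>" "l2_norm \<Omega> (u - \<phi>) < e / K" "l2_norm \<Omega> (f - A \<phi>) < e / K"
      by (rule test_closure_approx[OF uf divide_pos_pos[OF e K]])
    note mem = L2 \<phi>(1)[THEN test_L2] test[OF \<phi>(1), THEN test_L2]
    have "\<bar>l2_inner \<Omega> (f - A \<phi>) q\<bar> \<le> e / K * l2_norm \<Omega> q"
    proof -
      have "\<bar>l2_inner \<Omega> (f - A \<phi>) q\<bar> \<le> l2_norm \<Omega> (f - A \<phi>) * l2_norm \<Omega> q"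
        using F.cauchy_schwarz[of "f - A \<phi>" q] mem q by (simp add: nrm_L2)
      also have "\<dots> \<le> e / K * l2_norm \<Omega> q"
        by (rule mult_right_mono[OF less_imp_le[OF \<phi>(3)] l2_norm_nonneg])
      finally show ?thesis .
    qed
    moreover have "\<bar>l2_inner \<Omega> (u - \<phi>) p\<bar> \<le> e / K * l2_norm \<Omega> p"
    proof -
      have "\<bar>l2_inner \<Omega> (u - \<phi>) p\<bar> \<le> l2_norm \<Omega> (u - \<phi>) * l2_norm \<Omega> p"
        using U.cauchy_schwarz[of "u - \<phi>" p] mem p by (simp add: nrm_L2)
      also have "\<dots> \<le> e / K * l2_norm \<Omega> p"
        by (rule mult_right_mono[OF less_imp_le[OF \<phi>(2)] l2_norm_nonneg])
      finally show ?thesis .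
    qed
    moreover have "l2_inner \<Omega> f q - l2_inner \<Omega> u p = l2_inner \<Omega> (f - A \<phi>) q - l2_inner \<Omega> (u - \<phi>) p"
      using mem p q eq[OF \<phi>(1)] by (simp add: U.bilinear F.bilinear)
    moreover have "e / K * l2_norm \<Omega> q + e / K * l2_norm \<Omega> p \<le> e / K * K"
      unfolding K_def distrib_left using e K by (simp add: K_def)
    moreover have "e / K * K = e" using K by simp
    ultimately show ?thesis by linarith
  qed
  then have "\<bar>l2_inner \<Omega> f q - l2_inner \<Omega> u p\<bar> \<le> 0" by (rule field_le_epsilon) simp
  then show ?thesis by simp
qed

lemma in_test_closure:
  assumes "\<phi> \<in> test_functions \<Omega>" "A \<phi> \<in> test_functions \<Omega>"
  shows "(\<phi>, A \<phi>) \<in> test_closure A"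
  using assms by (auto simp: test_closure_def approx_by_test_iff test_L2 l2_norm_def l2_inner_def intro!: bexI[of _ \<phi>])


lemma component_sq_le: "(norm (v $ i))\<^sup>2 \<le> (norm v)\<^sup>2" for v :: "real^3"
  by (rule power_mono) (simp_all add: component_le_norm_cart)

lemma component_L2:
  fixes E :: "real^3 \<Rightarrow> real^3"
  assumes "E \<in> L2 \<Omega>"
  shows "(\<lambda>x. E x $ i) \<in> L2 \<Omega>"
proof -
  have m: "(\<lambda>x. E x $ i) \<in> borel_measurable (lebesgue_on \<Omega>)"
    using measurable_compose[OF L2_D(1)[OF assms] borel_measurable_continuous_onI[of "\<lambda>v. v $ i"]]
    by (simp add: continuous_on_component)
  have "integrable (lebesgue_on \<Omega>) (\<lambda>x. (norm (E x $ i))\<^sup>2)"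
  proof (rule Bochner_Integration.integrable_bound[OF L2_D(2)[OF assms]])
    show "(\<lambda>x. (norm (E x $ i))\<^sup>2) \<in> borel_measurable (lebesgue_on \<Omega>)" using m by measurable
    show "AE x in lebesgue_on \<Omega>. norm ((norm (E x $ i))\<^sup>2) \<le> norm ((norm (E x))\<^sup>2)"
      using component_sq_le[of "E _" i] by (intro AE_I2) (simp only: real_norm_def abs_power2 abs_of_nonneg[OF zero_le_power2])
  qed
  then show ?thesis using m by (simp add: L2_def)
qed

lemma l2_inner_components:
  fixes E X :: "real^3 \<Rightarrow> real^3"
  assumes "E \<in> L2 \<Omega>" "X \<in> L2 \<Omega>"
  shows "l2_inner \<Omega> E X = (\<Sum>i\<in>UNIV. l2_inner \<Omega> (\<lambda>x. E x $ i) (\<lambda>x. X x $ i))"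
  unfolding l2_inner_def inner_vec_def
  by (rule Bochner_Integration.integral_sum) (use integrable_inner_L2[OF component_L2 component_L2] assms in simp)

lemma grad_component: "(\<lambda>x. grad \<phi> x $ i) = partial i \<phi>"
  by (simp add: grad_def)

lemma weak_grad_test:
  assumes "\<phi> \<in> test_functions \<Omega>" shows "has_weak_grad \<Omega> \<phi> (grad \<phi>)"
  unfolding has_weak_grad_def grad_component
  using test_L2[OF assms] test_L2[OF test_grad[OF assms]] 
    integration_by_parts[OF open_dom _ smooth_differentiable[OF test_smooth[OF assms]]
      smooth_continuous[OF smooth_partial[OF test_smooth[OF assms]]]] by blast

lemma weak_grad_const: "has_weak_grad \<Omega> (\<lambda>x. c) (\<lambda>x. 0)"
  unfolding has_weak_grad_def
proof (intro conjI ballI allI)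
  fix \<phi> :: "real^3 \<Rightarrow> real" and i assume "\<phi> \<in> test_functions \<Omega>"
  from integration_by_parts[OF open_dom this, of "\<lambda>x. c" i]
  show "l2_inner \<Omega> (\<lambda>x. c) (partial i \<phi>) = - l2_inner \<Omega> (\<lambda>x. 0 $ i) \<phi>"
    by (simp add: partial_def[abs_def])
qed (auto intro: const_L2)

lemma weak_grad_divergence:
  assumes ug: "has_weak_grad \<Omega> u g" and \<Phi>: "\<Phi> \<in> test_functions \<Omega>"
  shows "l2_inner \<Omega> u (divergence \<Phi>) = - l2_inner \<Omega> g \<Phi>"
proof -
  have u: "u \<in> L2 \<Omega>" and g: "g \<in> L2 \<Omega>" using ug by (auto simp: has_weak_grad_def)
  have p: "partial i (\<lambda>y. \<Phi> y $ i) \<in> L2 \<Omega>" for i by (rule test_L2[OF test_partial[OF test_component[OF \<Phi>]]])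
  have "l2_inner \<Omega> u (divergence \<Phi>) = (\<Sum>i\<in>UNIV. l2_inner \<Omega> u (partial i (\<lambda>y. \<Phi> y $ i)))"
    unfolding l2_inner_def divergence_def inner_sum_right
    by (rule Bochner_Integration.integral_sum) (rule integrable_inner_L2[OF u p])
  also have "\<dots> = (\<Sum>i\<in>UNIV. - l2_inner \<Omega> (\<lambda>x. g x $ i) (\<lambda>y. \<Phi> y $ i))"
    using ug test_component[OF \<Phi>] by (intro sum.cong) (auto simp: has_weak_grad_def)
  also have "\<dots> = - l2_inner \<Omega> g \<Phi>"
    by (simp add: l2_inner_components[OF g test_L2[OF \<Phi>]] sum_negf)
  finally show ?thesis .
qed

lemma weak_grad_rot:
  assumes ug: "has_weak_grad \<Omega> u g"
  shows "has_weak_rot \<Omega> g (\<lambda>x. 0)"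
  unfolding has_weak_rot_def
proof (intro conjI ballI)
  show "g \<in> L2 \<Omega>" using ug by (simp add: has_weak_grad_def)
  fix \<Phi> :: "real^3 \<Rightarrow> real^3" assume \<Phi>: "\<Phi> \<in> test_functions \<Omega>"
  show "l2_inner \<Omega> g (curl \<Phi>) = l2_inner \<Omega> (\<lambda>x. 0) \<Phi>"
    using weak_grad_divergence[OF ug test_curl[OF \<Phi>]] divergence_curl[OF test_smooth[OF \<Phi>]] by simp
qed (rule const_L2)

text \<open>The graph of the weak gradient with domain \<open>H1\<close>.\<close>

definition weak_graph :: "((real^3 \<Rightarrow> real) \<times> (real^3 \<Rightarrow> real^3)) set" where
  "weak_graph = {(u, g). has_weak_grad \<Omega> u g}"

lemma component_fun: "(\<lambda>x. (f + g) x $ i) = (\<lambda>x. f x $ i) + (\<lambda>x. g x $ i)"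
  "(\<lambda>x. (c *\<^sub>R f) x $ i) = c *\<^sub>R (\<lambda>x. f x $ i)"
  "(\<lambda>x. (f - g) x $ i) = (\<lambda>x. f x $ i) - (\<lambda>x. g x $ i)" for f g :: "real^3 \<Rightarrow> real^3"
  by (auto simp: fun_eq_iff)

lemma subspace_weak_graph: "subspace weak_graph"
proof (rule subspaceI)
  show "0 \<in> weak_graph" using weak_grad_const[of 0] by (simp add: weak_graph_def zero_prod_def zero_fun_def)
  fix p q assume p: "p \<in> weak_graph"
  obtain u g where pu: "p = (u, g)" by fastforce
  have ug: "has_weak_grad \<Omega> u g" using p by (simp add: weak_graph_def pu)
  have mem: "u \<in> L2 \<Omega>" "g \<in> L2 \<Omega>" using ug by (auto simp: has_weak_grad_def)
  have eq: "l2_inner \<Omega> u (partial i \<phi>) = - l2_inner \<Omega> (\<lambda>x. g x $ i) \<phi>"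
    if "\<phi> \<in> test_functions \<Omega>" for \<phi> i using ug that by (simp add: has_weak_grad_def)
  note test = test_L2 test_L2[OF test_partial]
  show "c *\<^sub>R p \<in> weak_graph" for c
    unfolding weak_graph_def pu scaleR_Pair mem_Collect_eq prod.case has_weak_grad_def component_fun
    using mem by (simp add: S.scale_left component_L2 test eq)
  assume q: "q \<in> weak_graph"
  obtain v h where qv: "q = (v, h)" by fastforce
  have vh: "has_weak_grad \<Omega> v h" using q by (simp add: weak_graph_def qv)
  have mem': "v \<in> L2 \<Omega>" "h \<in> L2 \<Omega>" using vh by (auto simp: has_weak_grad_def)
  have eq': "l2_inner \<Omega> v (partial i \<phi>) = - l2_inner \<Omega> (\<lambda>x. h x $ i) \<phi>"
    if "\<phi> \<in> test_functions \<Omega>" for \<phi> i using vh that by (simp add: has_weak_grad_def)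
  show "p + q \<in> weak_graph"
    unfolding weak_graph_def pu qv add_Pair mem_Collect_eq prod.case has_weak_grad_def component_fun
    using mem mem' by (simp add: S.add_left component_L2 test eq eq')
qed

lemma component_norm_le:
  fixes E :: "real^3 \<Rightarrow> real^3"
  assumes "E \<in> L2 \<Omega>"
  shows "l2_norm \<Omega> (\<lambda>x. E x $ i) \<le> l2_norm \<Omega> E"
proof -
  have "(l2_norm \<Omega> (\<lambda>x. E x $ i))\<^sup>2 \<le> (l2_norm \<Omega> E)\<^sup>2"
    unfolding l2_norm_sq_integral
    by (intro integral_mono L2_D component_L2 assms component_sq_le)
  then show ?thesis by (rule power2_le_imp_le) simp
qed

lemma closed_weak_graph:
  assumes st: "\<And>n::nat. (s n, t n) \<in> weak_graph" and u: "u \<in> L2 \<Omega>" and g: "g \<in> L2 \<Omega>"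
    and lim: "(\<lambda>n. l2_norm \<Omega> (s n - u)) \<longlonglongrightarrow> 0" "(\<lambda>n. l2_norm \<Omega> (t n - g)) \<longlonglongrightarrow> 0"
  shows "(u, g) \<in> weak_graph"
proof -
  have mem: "s n \<in> L2 \<Omega>" "t n \<in> L2 \<Omega>" for n using st[of n] by (auto simp: weak_graph_def has_weak_grad_def)
  have "l2_inner \<Omega> u (partial i \<phi>) = - l2_inner \<Omega> (\<lambda>x. g x $ i) \<phi>"
    if \<phi>: "\<phi> \<in> test_functions \<Omega>" for \<phi> i
  proof -
    have l1: "(\<lambda>n. l2_inner \<Omega> (s n) (partial i \<phi>)) \<longlonglongrightarrow> l2_inner \<Omega> u (partial i \<phi>)"
      using lim(1) by (intro S.tendsto_B mem u test_L2[OF test_partial[OF \<phi>]]) (simp add: nrm_L2)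
    have l2: "(\<lambda>n. l2_inner \<Omega> (\<lambda>x. t n x $ i) \<phi>) \<longlonglongrightarrow> l2_inner \<Omega> (\<lambda>x. g x $ i) \<phi>"
    proof (intro S.tendsto_B component_L2 mem g test_L2[OF \<phi>])
      show "(\<lambda>n. S.nrm ((\<lambda>x. t n x $ i) - (\<lambda>x. g x $ i))) \<longlonglongrightarrow> 0"
      proof (rule Lim_null_comparison[OF _ lim(2)], rule always_eventually, rule allI)
        fix n
        show "norm (S.nrm ((\<lambda>x. t n x $ i) - (\<lambda>x. g x $ i))) \<le> l2_norm \<Omega> (t n - g)"
          unfolding nrm_L2 component_fun(3)[symmetric] real_norm_def abs_of_nonneg[OF l2_norm_nonneg]
          by (rule component_norm_le[OF X.mem(4)[OF mem(2) g]])
      qed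
    qed
    have eq: "l2_inner \<Omega> (s n) (partial i \<phi>) = - l2_inner \<Omega> (\<lambda>x. t n x $ i) \<phi>" for n
      using st[of n] \<phi> by (simp add: weak_graph_def has_weak_grad_def)
    show ?thesis by (rule LIMSEQ_unique[OF l1[unfolded eq] tendsto_minus[OF l2]])
  qed
  then show ?thesis using u g by (simp add: weak_graph_def has_weak_grad_def)
qed


lemma test_closure_grad_weak:
  assumes "has_weak_grad \<Omega> u g" "approx_by_test \<Omega> grad u g"
  shows "(u, g) \<in> test_closure grad"
  using assms by (simp add: test_closure_def has_weak_grad_def)

lemma subspace_test_closure_grad: "subspace (test_closure grad)"
  by (rule subspace_test_closure[OF test_grad]) (simp_all add: grad_add_scale test_smooth)

lemma subspace_test_closure_divergence: "subspace (test_closure divergence)"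
  by (rule subspace_test_closure[OF test_divergence]) (simp_all add: divergence_add_scale test_smooth)

lemma test_closure_divergence_pairing:
  assumes "(v, d) \<in> test_closure divergence" "has_weak_grad \<Omega> u g"
  shows "l2_inner \<Omega> d u = - l2_inner \<Omega> v g"
proof -
  have mem: "u \<in> L2 \<Omega>" "g \<in> L2 \<Omega>" "v \<in> L2 \<Omega>"
    using assms by (auto simp: has_weak_grad_def test_closure_def)
  have "l2_inner \<Omega> d u = l2_inner \<Omega> v (- g)"
  proof (rule test_closure_pairing[OF test_divergence assms(1)])
    fix \<Phi> :: "real^3 \<Rightarrow> real^3" assume \<Phi>: "\<Phi> \<in> test_functions \<Omega>"
    have "l2_inner \<Omega> (divergence \<Phi>) u = - l2_inner \<Omega> \<Phi> g"
      unfolding l2_inner_commute[of \<Omega> _ u] l2_inner_commute[of \<Omega> _ g]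
      by (rule weak_grad_divergence[OF assms(2) \<Phi>])
    then show "l2_inner \<Omega> (divergence \<Phi>) u = l2_inner \<Omega> \<Phi> (- g)"
      by (simp only: X.minus_right[OF mem(2) test_L2[OF \<Phi>]])
  qed (use mem in auto)
  then show ?thesis by (simp only: X.minus_right[OF mem(2,3)])
qed

text \<open>The domain of the adjoint of the weak gradient on \<open>H1\<close> consists of limits of test fields, in the
  graph norm of the divergence. The part \<open>(a, b)\<close> of \<open>(v, d)\<close> orthogonal to that closure satisfies \<open>a = grad b\<close> weakly. Both \<open>(v, d)\<close> and
  its projection are in the adjoint relation with \<open>(b, a)\<close>, hence so is \<open>(a, b)\<close>, which says
  \<open>|a|\<^sup>2 = - |b|\<^sup>2\<close>.\<close>

lemma adjoint_weak_grad:
  assumes v: "v \<in> L2 \<Omega>" and d: "d \<in> L2 \<Omega>"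
    and adj: "\<And>q X. has_weak_grad \<Omega> q X \<Longrightarrow> l2_inner \<Omega> v X = - l2_inner \<Omega> d q"
  shows "has_weak_div \<Omega> v d" "approx_by_test \<Omega> divergence v d"
proof -
  show "has_weak_div \<Omega> v d"
    unfolding has_weak_div_def using v d adj[OF weak_grad_test] by blast
  interpret Z: graph_space "L2 \<Omega> :: (real^3 \<Rightarrow> real^3) set" "l2_inner \<Omega>"
    "L2 \<Omega> :: (real^3 \<Rightarrow> real) set" "l2_inner \<Omega>" "test_closure divergence"
  proof
    show "test_closure divergence \<subseteq> L2 \<Omega> \<times> L2 \<Omega>" by (auto simp: test_closure_def)
    show "(x, y) \<in> test_closure divergence"
      if "\<And>n. (s n, t n) \<in> test_closure divergence" "x \<in> L2 \<Omega>" "y \<in> L2 \<Omega>"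
        "(\<lambda>n. X.nrm (s n - x)) \<longlonglongrightarrow> 0" "(\<lambda>n. S.nrm (t n - y)) \<longlonglongrightarrow> 0" for s t x y
    proof (rule closed_test_closure)
      show "divergence \<phi> \<in> test_functions \<Omega>" if "\<phi> \<in> test_functions \<Omega>" for \<phi>
        by (rule test_divergence[OF that])
      show "(s n, t n) \<in> test_closure divergence" for n by (rule that(1))
    qed (use that(2-5) in \<open>simp_all only: nrm_L2\<close>)
  qed (rule complete_L2 subspace_test_closure_divergence)+
  obtain x y where xy: "(x, y) \<in> test_closure divergence"
    "\<And>x' y'. (x', y') \<in> test_closure divergence \<Longrightarrow> 1 * l2_inner \<Omega> (v - x) x' + l2_inner \<Omega> (d - y) y' = 0"
    using Z.graph_projection[OF zero_less_one v d] by blast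
  define a where "a = v - x"
  define b where "b = d - y"
  have mem: "x \<in> L2 \<Omega>" "y \<in> L2 \<Omega>" using xy(1) by (auto simp: test_closure_def)
  have ab: "a \<in> L2 \<Omega>" "b \<in> L2 \<Omega>" using mem v d by (auto simp: a_def b_def)
  have "has_weak_grad \<Omega> b a"
    unfolding has_weak_grad_def
  proof (intro conjI ballI allI ab)
    fix \<phi> :: "real^3 \<Rightarrow> real" and i assume \<phi>: "\<phi> \<in> test_functions \<Omega>"
    define \<Phi> where "\<Phi> = (\<lambda>x. \<phi> x *\<^sub>R (axis i 1 :: real^3))"
    have \<Phi>: "\<Phi> \<in> test_functions \<Omega>" unfolding \<Phi>_def by (rule test_axis[OF \<phi>])
    have "divergence \<Phi> = partial i \<phi>"
    proof
      fix x
      have "partial j (\<lambda>y. \<Phi> y $ j) x = (if j = i then partial i \<phi> x else 0)" for j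
        by (simp add: \<Phi>_def axis_def partial_def)
      then show "divergence \<Phi> x = partial i \<phi> x" by (simp add: divergence_def)
    qed
    moreover have "l2_inner \<Omega> a \<Phi> = l2_inner \<Omega> (\<lambda>x. a x $ i) \<phi>"
      by (simp add: l2_inner_def \<Phi>_def inner_axis mult.commute)
    ultimately show "l2_inner \<Omega> b (partial i \<phi>) = - l2_inner \<Omega> (\<lambda>x. a x $ i) \<phi>"
      using xy(2)[OF in_test_closure[of \<Phi> divergence, OF \<Phi> test_divergence[OF \<Phi>]]] by (simp add: a_def b_def)
  qed
  then have "l2_inner \<Omega> v a = - l2_inner \<Omega> d b" "l2_inner \<Omega> y b = - l2_inner \<Omega> x a"
    using adj test_closure_divergence_pairing[OF xy(1)] by blast+
  then have "l2_inner \<Omega> a a + l2_inner \<Omega> b b = 0"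
    using mem v d ab by (simp add: a_def b_def S.bilinear X.bilinear)
  then have "l2_norm \<Omega> a = 0" "l2_norm \<Omega> b = 0"
    using X.nonneg[OF ab(1)] S.nonneg[OF ab(2)] by (auto simp: l2_norm_def)
  then have "l2_norm \<Omega> (x - v) = 0" "l2_norm \<Omega> (y - d) = 0"
    using X.nrm_commute[OF mem(1) v] S.nrm_commute[OF mem(2) d] by (auto simp: a_def b_def nrm_L2)
  then have "(v, d) \<in> test_closure divergence"
    using closed_test_closure[of divergence "\<lambda>_. x" "\<lambda>_. y", OF test_divergence xy(1) v d] by simp
  then show "approx_by_test \<Omega> divergence v d" by (simp add: test_closure_def)
qed

end

section \<open>The inequality of Friedrichs\<close>

context bounded_open
begin

text \<open>Integrate \<open>\<partial>\<^sub>1(x\<^sub>1 \<phi>\<^sup>2)\<close> and apply the Cauchy-Schwarz inequality.\<close>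

lemma poincare_test:
  assumes r: "\<And>x. x \<in> \<Omega> \<Longrightarrow> norm x \<le> r" "0 \<le> r" and \<phi>: "\<phi> \<in> test_functions \<Omega>"
  shows "l2_norm \<Omega> \<phi> \<le> 2 * r * l2_norm \<Omega> (grad \<phi>)"
proof -
  have sm: "smooth \<phi>" by (rule test_smooth[OF \<phi>])
  have nth: "((\<lambda>x. x $ 1) has_derivative (\<lambda>h. h $ 1)) (at x)" for x :: "real^3"
    by (rule bounded_linear_imp_has_derivative) (rule bounded_linear_vec_nth)
  have p1: "partial 1 (\<lambda>x. x $ 1) x = 1" for x
    using partial_eqI[OF nth] by (simp add: axis_def)
  have nd: "(\<lambda>x. x $ 1) differentiable at x" for x :: "real^3"
    using nth unfolding differentiable_def by blast
  let ?f = "\<lambda>x. x $ 1 * \<phi> x"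
  have fd: "?f differentiable at x" for x
    by (rule differentiable_mult[OF nd smooth_differentiable[OF sm]])
  have pf: "partial 1 ?f x = x $ 1 * partial 1 \<phi> x + \<phi> x" for x
    using partial_mult[OF nd smooth_differentiable[OF sm], where i = 1] p1 by simp
  have pf_fun: "partial 1 ?f = (\<lambda>x. x $ 1 * partial 1 \<phi> x + \<phi> x)"
    by (rule ext, rule pf)
  have c1: "continuous_on S (\<lambda>x. x $ 1)" for S :: "(real^3) set"
    by (rule linear_continuous_on) (rule bounded_linear_vec_nth)
  have cont: "continuous_on UNIV (partial 1 ?f)"
    unfolding pf_fun
    by (rule continuous_on_add[OF continuous_on_mult[OF c1
          smooth_continuous[OF smooth_partial[OF sm]]] smooth_continuous[OF sm]])
  have fL2: "(\<lambda>x. x $ 1 * \<psi> x) \<in> L2 \<Omega>" if \<psi>: "\<psi> \<in> test_functions \<Omega>" for \<psi>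
  proof -
    obtain K where K: "compact K" "K \<subseteq> \<Omega>" "\<And>x. x \<notin> K \<Longrightarrow> \<psi> x = 0"
      using \<psi> unfolding test_functions_iff by blast
    have c: "continuous_on S (\<lambda>x. x $ 1 * \<psi> x)" for S
      by (rule continuous_on_mult[OF c1 smooth_continuous[OF test_smooth[OF \<psi>]]])
    obtain M where M: "\<And>x. x \<in> K \<Longrightarrow> norm (x $ 1 * \<psi> x) \<le> M"
      using compact_imp_bounded[OF compact_continuous_image[OF c K(1)]] by (auto simp: bounded_iff)
    have "norm (x $ 1 * \<psi> x) \<le> max M 0" for x
      using K(3)[of x] M[of x] by (cases "x \<in> K") auto
    moreover have "(\<lambda>x. x $ 1 * \<psi> x) \<in> borel_measurable (lebesgue_on \<Omega>)"
      by (rule continuous_imp_measurable_on_sets_lebesgue[OF c]) (simp add: lmeas fmeasurableD)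
    ultimately show ?thesis by (rule bounded_L2[rotated])
  qed
  have \<phi>L2: "\<phi> \<in> L2 \<Omega>" and pL2: "partial 1 \<phi> \<in> L2 \<Omega>" 
    by (rule test_L2[OF \<phi>], rule test_L2[OF test_partial[OF \<phi>]])
  have "l2_inner \<Omega> ?f (partial 1 \<phi>) = - l2_inner \<Omega> (partial 1 ?f) \<phi>"
    by (rule integration_by_parts[OF open_dom \<phi> fd cont])
  moreover have "partial 1 ?f = (\<lambda>x. x $ 1 * partial 1 \<phi> x) + \<phi>" by (simp only: pf_fun plus_fun_def)
  ultimately have "l2_inner \<Omega> ?f (partial 1 \<phi>) = - (l2_inner \<Omega> (\<lambda>x. x $ 1 * partial 1 \<phi> x) \<phi> + l2_inner \<Omega> \<phi> \<phi>)"
    using fL2[OF test_partial[OF \<phi>]] \<phi>L2 by (simp add: S.bilinear)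
  moreover have "l2_inner \<Omega> (\<lambda>x. x $ 1 * partial 1 \<phi> x) \<phi> = l2_inner \<Omega> ?f (partial 1 \<phi>)"
    by (simp add: l2_inner_def mult_ac)
  ultimately have "l2_inner \<Omega> \<phi> \<phi> = - 2 * l2_inner \<Omega> ?f (partial 1 \<phi>)" by simp
  also have "\<dots> \<le> 2 * (l2_norm \<Omega> ?f * l2_norm \<Omega> (partial 1 \<phi>))"
    using S.cauchy_schwarz[OF fL2[OF \<phi>] pL2, unfolded nrm_L2] by linarith
  also have "\<dots> \<le> 2 * ((r * l2_norm \<Omega> \<phi>) * l2_norm \<Omega> (grad \<phi>))"
  proof (intro mult_left_mono mult_mono)
    have "(l2_norm \<Omega> ?f)\<^sup>2 \<le> (r * l2_norm \<Omega> \<phi>)\<^sup>2"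
      unfolding power_mult_distrib l2_norm_sq_integral Bochner_Integration.integral_mult_right_zero[symmetric]
    proof (rule integral_mono)
      show "integrable (lebesgue_on \<Omega>) (\<lambda>x. (norm (x $ 1 * \<phi> x))\<^sup>2)" by (rule L2_D(2)[OF fL2[OF \<phi>]])
      show "integrable (lebesgue_on \<Omega>) (\<lambda>x. r\<^sup>2 * (norm (\<phi> x))\<^sup>2)"
        by (intro integrable_mult_right L2_D(2)[OF \<phi>L2])
      fix x assume "x \<in> space (lebesgue_on \<Omega>)"
      then have "\<bar>x $ 1\<bar> \<le> r" using r(1)[of x] component_le_norm_cart[of x 1] by simp
      then have "norm (x $ 1 * \<phi> x) \<le> r * norm (\<phi> x)" by (simp add: abs_mult mult_right_mono)
      then have "(norm (x $ 1 * \<phi> x))\<^sup>2 \<le> (r * norm (\<phi> x))\<^sup>2" by (rule power_mono) simp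
      then show "(norm (x $ 1 * \<phi> x))\<^sup>2 \<le> r\<^sup>2 * (norm (\<phi> x))\<^sup>2" by (simp only: power_mult_distrib)
    qed
    then show "l2_norm \<Omega> ?f \<le> r * l2_norm \<Omega> \<phi>" by (rule power2_le_imp_le) (simp add: r)
    show "l2_norm \<Omega> (partial 1 \<phi>) \<le> l2_norm \<Omega> (grad \<phi>)"
      using component_norm_le[OF test_L2[OF test_grad[OF \<phi>]], of 1] by (simp only: grad_component)
  qed (auto simp: r)
  finally have "(l2_norm \<Omega> \<phi>)\<^sup>2 \<le> 2 * ((r * l2_norm \<Omega> \<phi>) * l2_norm \<Omega> (grad \<phi>))"
    by (simp only: S.nrm_sq[OF \<phi>L2, unfolded nrm_L2])
  then have *: "l2_norm \<Omega> \<phi> * l2_norm \<Omega> \<phi> \<le> l2_norm \<Omega> \<phi> * (2 * r * l2_norm \<Omega> (grad \<phi>))"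
    by (simp add: power2_eq_square mult_ac)
  show ?thesis
  proof (cases "l2_norm \<Omega> \<phi> = 0")
    case True
    then show ?thesis using r(2) by simp
  next
    case False
    then have "l2_norm \<Omega> \<phi> > 0" using l2_norm_nonneg[of \<Omega> \<phi>] by linarith
    then show ?thesis using * by (simp only: mult_le_cancel_left_pos)
  qed
qed

lemma test_closure_grad_kernel:
  assumes "(z, 0) \<in> test_closure grad"
  shows "l2_norm \<Omega> z = 0"
proof -
  obtain r0 where r0: "\<And>x. x \<in> \<Omega> \<Longrightarrow> norm x \<le> r0" using bounded_dom by (auto simp: bounded_iff)
  define r where "r = max r0 0"
  have r: "\<And>x. x \<in> \<Omega> \<Longrightarrow> norm x \<le> r" "0 \<le> r" using r0 by (force simp: r_def)+
  have z: "z \<in> L2 \<Omega>" using assms by (simp add: test_closure_def)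
  have "l2_norm \<Omega> z \<le> 0 + e" if e: "e > 0" for e
  proof -
    define d where "d = e / (1 + 2 * r)"
    have d0: "d > 0" using r(2) e by (simp add: d_def add_pos_nonneg)
    have "d * (1 + 2 * r) = e" using r(2) by (simp add: d_def)
    then have d: "d > 0" "d + 2 * r * d = e" using d0 by (simp_all add: algebra_simps)
    obtain \<phi> where \<phi>: "\<phi> \<in> test_functions \<Omega>" "l2_norm \<Omega> (z - \<phi>) < d" "l2_norm \<Omega> (0 - grad \<phi>) < d"
      by (rule test_closure_approx[OF assms d(1)])
    have "l2_norm \<Omega> (grad \<phi>) < d"
      using \<phi>(3) X.nrm_minus[OF test_L2[OF test_grad[OF \<phi>(1)]]] by (simp add: nrm_L2)
    then have "2 * r * l2_norm \<Omega> (grad \<phi>) \<le> 2 * r * d" using r(2) by (intro mult_left_mono) auto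
    then have "l2_norm \<Omega> \<phi> \<le> 2 * r * d" using poincare_test[OF r \<phi>(1)] by linarith
    moreover have "l2_norm \<Omega> z \<le> l2_norm \<Omega> (z - \<phi>) + l2_norm \<Omega> \<phi>"
      using S.nrm_triangle[of "z - \<phi>" \<phi>] z test_L2[OF \<phi>(1)] by (simp add: nrm_L2)
    ultimately show ?thesis using \<phi>(2) d(2) by linarith
  qed
  then have "l2_norm \<Omega> z \<le> 0" by (rule field_le_epsilon)
  then show ?thesis using l2_norm_nonneg[of \<Omega> z] by linarith
qed

end

section \<open>The weighted inner product and the two estimates\<close>

lemma norm_matrix_vector_le: "norm (A *v x) \<le> 3 * (norm A * norm x)" for A :: "real^3^3"
proof -
  have "norm (A *v x) \<le> (\<Sum>i\<in>UNIV. \<bar>(A *v x) $ i\<bar>)" by (rule norm_le_l1_cart)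
  also have "\<dots> \<le> (\<Sum>i\<in>(UNIV :: 3 set). norm A * norm x)"
  proof (rule sum_mono)
    fix i
    have "\<bar>(A *v x) $ i\<bar> \<le> norm (A $ i) * norm x"
      unfolding matrix_vector_mul_component by (rule Cauchy_Schwarz_ineq2)
    also have "\<dots> \<le> norm A * norm x"
      by (intro mult_right_mono) (simp_all add: Finite_Cartesian_Product.norm_nth_le)
    finally show "\<bar>(A *v x) $ i\<bar> \<le> norm A * norm x" .
  qed
  finally show ?thesis by simp
qed

lemma app_linear:
  "app \<epsilon> (E + X) = app \<epsilon> E + app \<epsilon> X" "app \<epsilon> (c *\<^sub>R E) = c *\<^sub>R app \<epsilon> E"
  "app \<epsilon> (\<lambda>x. 0) = (\<lambda>x. 0)"
  by (auto simp: app_def fun_eq_iff matrix_vector_right_distrib matrix_vector_mult_scaleR)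

text \<open>A coefficient \<open>\<epsilon>\<close> together with \<open>lo\<close> and \<open>up\<close> bounding its integrated quadratic form from below by \<open>1 / lo\<^sup>2\<close> and
  from above by \<open>up\<^sup>2\<close>.\<close>

locale weighted = bounded_open +
  fixes \<epsilon> :: "real^3 \<Rightarrow> real^3^3" and lo up :: real
  assumes coeff: "admissible_coeff \<Omega> \<epsilon>" and lo: "lo > 0" and up: "up > 0"
    and bounds: "E \<in> L2 \<Omega> \<Longrightarrow> (l2_norm \<Omega> E)\<^sup>2 / lo\<^sup>2 \<le> l2_inner \<Omega> (app \<epsilon> E) E \<and>
      l2_inner \<Omega> (app \<epsilon> E) E \<le> up\<^sup>2 * (l2_norm \<Omega> E)\<^sup>2"
begin

lemma app_L2:
  assumes E: "E \<in> L2 \<Omega>" shows "app \<epsilon> E \<in> L2 \<Omega>"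
proof -
  have \<epsilon>m: "\<epsilon> \<in> borel_measurable (lebesgue_on \<Omega>)" using coeff by (simp add: admissible_coeff_def)
  obtain K where K: "AE x in lebesgue_on \<Omega>. norm (\<epsilon> x) \<le> K" using coeff by (auto simp: admissible_coeff_def)
  have cont: "continuous_on UNIV (\<lambda>p. fst p *v snd p :: real^3)" for p :: "(real^3^3) \<times> (real^3)"
    unfolding matrix_vector_mult_def by (intro continuous_intros)
  have m: "app \<epsilon> E \<in> borel_measurable (lebesgue_on \<Omega>)"
    unfolding app_def by (rule borel_measurable_continuous_Pair[OF \<epsilon>m L2_D(1)[OF E] cont])
  have "integrable (lebesgue_on \<Omega>) (\<lambda>x. (norm (app \<epsilon> E x))\<^sup>2)"
  proof (rule Bochner_Integration.integrable_bound)
    show "integrable (lebesgue_on \<Omega>) (\<lambda>x. (3 * K)\<^sup>2 * (norm (E x))\<^sup>2)"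
      by (intro integrable_mult_right L2_D(2)[OF E])
    show "(\<lambda>x. (norm (app \<epsilon> E x))\<^sup>2) \<in> borel_measurable (lebesgue_on \<Omega>)" using m by measurable
    show "AE x in lebesgue_on \<Omega>. norm ((norm (app \<epsilon> E x))\<^sup>2) \<le> norm ((3 * K)\<^sup>2 * (norm (E x))\<^sup>2)"
      using K
    proof eventually_elim
      case (elim x)
      have "norm (app \<epsilon> E x) \<le> 3 * (norm (\<epsilon> x) * norm (E x))"
        unfolding app_def by (rule norm_matrix_vector_le)
      also have "\<dots> \<le> 3 * (K * norm (E x))"
        using elim by (intro mult_left_mono mult_right_mono) auto
      finally have "(norm (app \<epsilon> E x))\<^sup>2 \<le> (3 * K * norm (E x))\<^sup>2"
        by (intro power_mono) (auto simp: mult.assoc)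
      then have "(norm (app \<epsilon> E x))\<^sup>2 \<le> (3 * K)\<^sup>2 * (norm (E x))\<^sup>2"
        by (simp only: power_mult_distrib)
      then show ?case by (simp only: real_norm_def abs_of_nonneg[OF zero_le_power2]
          abs_of_nonneg[OF mult_nonneg_nonneg[OF zero_le_power2 zero_le_power2]])
    qed
  qed
  then show ?thesis using m by (simp add: L2_def)
qed

text \<open>The weighted inner product; its seminorm \<open>Y.nrm\<close> below is \<open>weighted_norm\<close>.\<close>

abbreviation B where "B E X \<equiv> l2_inner \<Omega> (app \<epsilon> E) X"

lemma B_sym:
  assumes "E \<in> L2 \<Omega>" "X \<in> L2 \<Omega>"
  shows "B E X = B X E"
proof -
  have "AE x in lebesgue_on \<Omega>. transpose (\<epsilon> x) = \<epsilon> x" using coeff by (simp add: admissible_coeff_def)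
  then have ae: "AE x in lebesgue_on \<Omega>. app \<epsilon> E x \<bullet> X x = app \<epsilon> X x \<bullet> E x"
  proof eventually_elim
    case (elim x)
    have "(\<epsilon> x *v E x) \<bullet> X x = (E x v* transpose (\<epsilon> x)) \<bullet> X x" by (simp add: vector_transpose_matrix)
    also have "\<dots> = E x \<bullet> (\<epsilon> x *v X x)" unfolding dot_lmul_matrix elim ..
    finally show ?case by (simp add: app_def inner_commute)
  qed
  show ?thesis
    unfolding l2_inner_def
    by (rule integral_cong_AE[OF _ _ ae])
      (use integrable_inner_L2[OF app_L2 assms(2)] integrable_inner_L2[OF app_L2 assms(1)] assms
        in \<open>auto intro: borel_measurable_integrable\<close>)
qed

lemma B_nonneg: "E \<in> L2 \<Omega> \<Longrightarrow> 0 \<le> B E E"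
  using bounds[of E] by (meson divide_nonneg_nonneg order_trans zero_le_power2)

sublocale Y: semi_inner "L2 \<Omega> :: (real^3 \<Rightarrow> real^3) set" B
proof
  show "subspace (L2 \<Omega> :: (real^3 \<Rightarrow> real^3) set)" by (rule subspace_L2)
qed (simp_all add: B_sym B_nonneg app_linear app_L2 X.add_left X.scale_left)

lemma weighted_norm_eq: "weighted_norm \<Omega> \<epsilon> E = Y.nrm E"
  by (simp add: weighted_norm_def Y.nrm_def)

lemma norm_le_weighted:
  assumes "E \<in> L2 \<Omega>" shows "l2_norm \<Omega> E \<le> lo * Y.nrm E"
proof -
  have "(l2_norm \<Omega> E)\<^sup>2 \<le> (lo * Y.nrm E)\<^sup>2"
    using bounds[OF assms] lo by (simp add: power_mult_distrib Y.nrm_sq[OF assms] pos_divide_le_eq mult.commute)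
  then show ?thesis
    by (rule power2_le_imp_le[OF _ mult_nonneg_nonneg[OF less_imp_le[OF lo] Y.nrm_nonneg[OF assms]]])
qed

lemma weighted_le_norm:
  assumes "E \<in> L2 \<Omega>" shows "Y.nrm E \<le> up * l2_norm \<Omega> E"
proof -
  have "(Y.nrm E)\<^sup>2 \<le> (up * l2_norm \<Omega> E)\<^sup>2"
    using bounds[OF assms] by (simp add: power_mult_distrib Y.nrm_sq[OF assms])
  then show ?thesis
    by (rule power2_le_imp_le[OF _ mult_nonneg_nonneg[OF less_imp_le[OF up] l2_norm_nonneg]])
qed

text \<open>The sharper bound is \<open>up |E|\<close>. It implies the stated one since the two bounds on \<open>\<epsilon>\<close> give
  \<open>|E| \<le> lo up |E|\<close>.\<close>

lemma weighted_le_norm':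
  assumes "E \<in> L2 \<Omega>" shows "Y.nrm E \<le> lo * up\<^sup>2 * l2_norm \<Omega> E"
proof -
  have "l2_norm \<Omega> E \<le> lo * (up * l2_norm \<Omega> E)"
    using norm_le_weighted[OF assms] mult_left_mono[OF weighted_le_norm[OF assms], of lo] lo by linarith
  then have "up * l2_norm \<Omega> E \<le> up * (lo * (up * l2_norm \<Omega> E))"
    using up by (intro mult_left_mono) auto
  then show ?thesis
    using weighted_le_norm[OF assms] by (simp add: power2_eq_square mult_ac)
qed

lemma complete_weighted: "Y.complete_on (L2 \<Omega>)"
  unfolding Y.complete_on_def
proof (intro allI impI)
  fix s :: "nat \<Rightarrow> real^3 \<Rightarrow> real^3"
  assume s: "\<forall>n. s n \<in> L2 \<Omega>" and cauchy: "\<forall>e>0. \<exists>N. \<forall>m\<ge>N. \<forall>n\<ge>N. Y.nrm (s m - s n) < e"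
  have d: "s m - s n \<in> L2 \<Omega>" for m n using s by (intro X.mem(4)) auto
  have "\<exists>N. \<forall>m\<ge>N. \<forall>n\<ge>N. X.nrm (s m - s n) < e" if "e > 0" for e
  proof -
    obtain N where N: "\<forall>m\<ge>N. \<forall>n\<ge>N. Y.nrm (s m - s n) < e / lo"
      using cauchy divide_pos_pos[OF \<open>e > 0\<close> lo] by blast
    have "X.nrm (s m - s n) < e" if "m \<ge> N" "n \<ge> N" for m n
    proof -
      have "lo * Y.nrm (s m - s n) < lo * (e / lo)"
        using N that lo by (intro mult_strict_left_mono) auto
      then show ?thesis using norm_le_weighted[OF d[of m n]] lo by (simp add: nrm_L2)
    qed
    then show ?thesis by blast
  qed
  then have "\<forall>e>0. \<exists>N. \<forall>m\<ge>N. \<forall>n\<ge>N. X.nrm (s m - s n) < e" by (intro allI impI)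
  then have "\<exists>l\<in>L2 \<Omega>. (\<lambda>n. X.nrm (s n - l)) \<longlonglongrightarrow> 0"
    using complete_L2[where 'b = "real^3"] s unfolding X.complete_on_def by (elim allE[of _ s] impE)
  then obtain l where l: "l \<in> L2 \<Omega>" "(\<lambda>n. X.nrm (s n - l)) \<longlonglongrightarrow> 0"
    by (elim bexE)
  have "(\<lambda>n. Y.nrm (s n - l)) \<longlonglongrightarrow> 0"
  proof (rule Lim_null_comparison)
    have "norm (Y.nrm (s n - l)) \<le> up * X.nrm (s n - l)" for n
      using weighted_le_norm[OF X.mem(4)[OF s[rule_format, of n] l(1)]]
        Y.nrm_nonneg[OF X.mem(4)[OF s[rule_format, of n] l(1)]] by (simp only: nrm_L2 real_norm_def abs_of_nonneg)
    then show "\<forall>\<^sub>F n in sequentially. norm (Y.nrm (s n - l)) \<le> up * X.nrm (s n - l)" by simp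
    show "(\<lambda>n. up * X.nrm (s n - l)) \<longlonglongrightarrow> 0" by (rule tendsto_mult_right_zero[OF l(2)])
  qed
  then show "\<exists>l\<in>L2 \<Omega>. (\<lambda>n. Y.nrm (s n - l)) \<longlonglongrightarrow> 0" using l(1) by blast
qed

lemma weighted_tendsto_imp_tendsto:
  assumes "\<And>n. t n \<in> L2 \<Omega>" "y \<in> L2 \<Omega>" "(\<lambda>n. Y.nrm (t n - y)) \<longlonglongrightarrow> 0"
  shows "(\<lambda>n. l2_norm \<Omega> (t n - y)) \<longlonglongrightarrow> 0"
proof (rule Lim_null_comparison)
  have "norm (l2_norm \<Omega> (t n - y)) \<le> lo * Y.nrm (t n - y)" for n
    using norm_le_weighted[OF X.mem(4)[OF assms(1,2)]] by (simp only: real_norm_def abs_of_nonneg[OF l2_norm_nonneg])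
  then show "\<forall>\<^sub>F n in sequentially. norm (l2_norm \<Omega> (t n - y)) \<le> lo * Y.nrm (t n - y)" by simp
  show "(\<lambda>n. lo * Y.nrm (t n - y)) \<longlonglongrightarrow> 0" by (rule tendsto_mult_right_zero[OF assms(3)])
qed

lemma weak_graph_L2: "weak_graph \<subseteq> L2 \<Omega> \<times> L2 \<Omega>"
  by (auto simp: weak_graph_def has_weak_grad_def)

lemma graph_space_weak: "graph_space (L2 \<Omega>) (l2_inner \<Omega>) (L2 \<Omega>) B weak_graph"
proof
  show "(x, y) \<in> weak_graph"
    if st: "\<And>n. (s n, t n) \<in> weak_graph" and x: "x \<in> L2 \<Omega>" and y: "y \<in> L2 \<Omega>"
      and lim: "(\<lambda>n. S.nrm (s n - x)) \<longlonglongrightarrow> 0" "(\<lambda>n. Y.nrm (t n - y)) \<longlonglongrightarrow> 0" for s t x y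
  proof (rule closed_weak_graph[OF st x y])
    show "(\<lambda>n. l2_norm \<Omega> (s n - x)) \<longlonglongrightarrow> 0" using lim(1) by (simp only: nrm_L2)
    show "(\<lambda>n. l2_norm \<Omega> (t n - y)) \<longlonglongrightarrow> 0"
      by (rule weighted_tendsto_imp_tendsto[OF _ y lim(2)]) (use st weak_graph_L2 in blast)
  qed
qed (rule complete_L2 complete_weighted subspace_weak_graph weak_graph_L2)+

text \<open>The graph of the gradient with domain \<open>H1_circ\<close>. Both defining properties of \<open>H1_circ\<close> are kept,
  which makes closedness immediate.\<close>

definition circ_graph :: "((real^3 \<Rightarrow> real) \<times> (real^3 \<Rightarrow> real^3)) set" where
  "circ_graph = test_closure grad \<inter> weak_graph"

lemma graph_space_circ: "graph_space (L2 \<Omega>) (l2_inner \<Omega>) (L2 \<Omega>) B circ_graph"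
proof
  show "subspace circ_graph" unfolding circ_graph_def
    by (rule subspace_inter[OF subspace_test_closure_grad subspace_weak_graph])
  show sub: "circ_graph \<subseteq> L2 \<Omega> \<times> L2 \<Omega>" using weak_graph_L2 by (auto simp: circ_graph_def)
  show "(x, y) \<in> circ_graph"
    if st: "\<And>n. (s n, t n) \<in> circ_graph" and x: "x \<in> L2 \<Omega>" and y: "y \<in> L2 \<Omega>"
      and lim: "(\<lambda>n. S.nrm (s n - x)) \<longlonglongrightarrow> 0" "(\<lambda>n. Y.nrm (t n - y)) \<longlonglongrightarrow> 0" for s t x y
  proof -
    have 1: "(\<lambda>n. l2_norm \<Omega> (s n - x)) \<longlonglongrightarrow> 0" using lim(1) by (simp only: nrm_L2)
    have 2: "(\<lambda>n. l2_norm \<Omega> (t n - y)) \<longlonglongrightarrow> 0"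
      by (rule weighted_tendsto_imp_tendsto[OF _ y lim(2)]) (use st sub in blast)
    have st': "(s n, t n) \<in> weak_graph" "(s n, t n) \<in> test_closure grad" for n
      using st[of n] by (simp_all add: circ_graph_def)
    show ?thesis
      unfolding circ_graph_def
      using closed_weak_graph[OF st'(1) x y 1 2] closed_test_closure[OF test_grad st'(2) x y 1 2] by blast
  qed
qed (rule complete_L2 complete_weighted)+

text \<open>The projection of a field orthogonal to \<open>X\<close> is zero only up to a null set, as \<open>eps_proj\<close> chooses an
  arbitrary representative; the weighted norm does not see the difference.\<close>

lemma weighted_norm_minus_proj:
  assumes X: "X \<subseteq> L2 \<Omega>" "(\<lambda>x. 0) \<in> X" and E: "E \<in> L2 \<Omega>" and orth: "\<And>h. h \<in> X \<Longrightarrow> B E h = 0"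
  shows "weighted_norm \<Omega> \<epsilon> (\<lambda>x. E x - eps_proj \<Omega> \<epsilon> X E x) = Y.nrm E"
proof -
  define P where "P = eps_proj \<Omega> \<epsilon> X E"
  have "\<exists>P. P \<in> X \<and> (\<forall>h\<in>X. l2_inner \<Omega> (app \<epsilon> (\<lambda>x. E x - P x)) h = 0)"
    using X(2) orth by (intro exI[of _ "\<lambda>x. 0"]) simp
  from someI_ex[OF this] have P: "P \<in> X" "\<And>h. h \<in> X \<Longrightarrow> B (\<lambda>x. E x - P x) h = 0"
    by (simp_all add: P_def eps_proj_def)
  have PL2: "P \<in> L2 \<Omega>" using P(1) X(1) by blast
  have diff: "(\<lambda>x. E x - P x) = E - P" by (simp add: fun_diff_def)
  have EP: "B (E - P) P = 0" using P(2)[OF P(1)] by (simp only: diff)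
  have "B (E - P) (E - P) = B E E"
    using EP orth[OF P(1)] Y.sym[OF PL2 E] E PL2 by (simp add: Y.diff_left Y.diff_right)
  then show ?thesis unfolding P_def[symmetric] diff weighted_norm_eq by (simp add: Y.nrm_def)
qed

lemma zero_dirichlet: "(\<lambda>x. 0) \<in> dirichlet_fields \<Omega> \<epsilon>"
proof -
  have c0: "curl (\<lambda>x. 0) = (\<lambda>x. 0)"
    by (simp add: curl_def partial_def vec_eq_iff forall_3 fun_eq_iff)
  have "has_weak_rot \<Omega> (\<lambda>x. 0) (\<lambda>x. 0)" "has_weak_div \<Omega> (\<lambda>x. 0) (\<lambda>x. 0)"
    by (simp_all add: has_weak_rot_def has_weak_div_def const_L2)
  moreover have "approx_by_test \<Omega> curl (\<lambda>x. 0) (\<lambda>x. 0)"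
    unfolding approx_by_test_def
    by (intro allI impI bexI[of _ "\<lambda>x. 0"] test_zero) (simp add: c0 graph_norm_def l2_norm_def)
  ultimately show ?thesis
    unfolding dirichlet_fields_def R_circ0_def R_circ_def eps_inv_def D0_def D_def
    by (auto simp: app_linear const_L2)
qed

lemma zero_neumann: "(\<lambda>x. 0) \<in> neumann_fields \<Omega> \<epsilon>"
proof -
  have d0: "divergence (\<lambda>x. 0) = (\<lambda>x. 0)"
    by (simp add: divergence_def partial_def fun_eq_iff)
  have "has_weak_rot \<Omega> (\<lambda>x. 0) (\<lambda>x. 0)" "has_weak_div \<Omega> (\<lambda>x. 0) (\<lambda>x. 0)"
    by (simp_all add: has_weak_rot_def has_weak_div_def const_L2)
  moreover have "approx_by_test \<Omega> divergence (\<lambda>x. 0) (\<lambda>x. 0)"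
    unfolding approx_by_test_def
    by (intro allI impI bexI[of _ "\<lambda>x. 0"] test_zero) (simp add: d0 graph_norm_def l2_norm_def)
  ultimately show ?thesis
    unfolding neumann_fields_def R0_def R_def eps_inv_def D_circ0_def D_circ_def
    by (auto simp: app_linear const_L2)
qed

lemma dirichlet_orthogonal:
  assumes xy: "(x, y) \<in> circ_graph" and h: "h \<in> dirichlet_fields \<Omega> \<epsilon>"
  shows "B y h = 0"
proof -
  have hL2: "h \<in> L2 \<Omega>" and div0: "has_weak_div \<Omega> (app \<epsilon> h) (\<lambda>x. 0)"
    using h by (simp_all add: dirichlet_fields_def eps_inv_def D0_def)
  have cl: "(x, y) \<in> test_closure grad" using xy by (simp add: circ_graph_def)
  have yL2: "y \<in> L2 \<Omega>" using cl by (simp add: test_closure_def)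
  have "l2_inner \<Omega> y (app \<epsilon> h) = l2_inner \<Omega> x (\<lambda>x. 0)"
  proof (rule test_closure_pairing[OF test_grad cl const_L2 app_L2[OF hL2]])
    fix \<phi> :: "real^3 \<Rightarrow> real" assume "\<phi> \<in> test_functions \<Omega>"
    then show "l2_inner \<Omega> (grad \<phi>) (app \<epsilon> h) = l2_inner \<Omega> \<phi> (\<lambda>x. 0)"
      using div0 by (simp add: has_weak_div_def l2_inner_commute[of \<Omega> "grad \<phi>"])
  qed
  then show ?thesis using B_sym[OF yL2 hL2] by (simp add: l2_inner_commute[of \<Omega> y])
qed

text \<open>The field \<open>\<epsilon> h\<close> is approximated by test fields whose divergences converge to some weak divergence
  \<open>d\<close> of \<open>\<epsilon> h\<close>. As weak divergences are unique almost everywhere, \<open>d\<close> has norm zero.\<close>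

lemma neumann_orthogonal:
  assumes xy: "(x, y) \<in> weak_graph" and h: "h \<in> neumann_fields \<Omega> \<epsilon>"
  shows "B y h = 0"
proof -
  have hL2: "h \<in> L2 \<Omega>" and circ: "app \<epsilon> h \<in> D_circ \<Omega>"
    and div0: "has_weak_div \<Omega> (app \<epsilon> h) (\<lambda>x. 0)"
    using h by (simp_all add: neumann_fields_def eps_inv_def D_circ0_def)
  obtain d where d: "has_weak_div \<Omega> (app \<epsilon> h) d" "approx_by_test \<Omega> divergence (app \<epsilon> h) d"
    using circ by (auto simp: D_circ_def)
  have dL2: "d \<in> L2 \<Omega>" using d(1) by (simp add: has_weak_div_def)
  have cl: "(app \<epsilon> h, d) \<in> test_closure divergence"
    using d by (simp add: test_closure_def has_weak_div_def)
  have "l2_inner \<Omega> d d = l2_inner \<Omega> (app \<epsilon> h) (\<lambda>x. 0)"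
  proof (rule test_closure_pairing[OF test_divergence cl const_L2 dL2])
    fix \<Phi> :: "real^3 \<Rightarrow> real^3" assume "\<Phi> \<in> test_functions \<Omega>"
    from test_divergence[OF this]
    have "- l2_inner \<Omega> d (divergence \<Phi>) = - l2_inner \<Omega> (\<lambda>x. 0) (divergence \<Phi>)"
      using d(1) div0 unfolding has_weak_div_def by metis
    then show "l2_inner \<Omega> (divergence \<Phi>) d = l2_inner \<Omega> \<Phi> (\<lambda>x. 0)"
      by (simp add: l2_inner_commute[of \<Omega> _ d])
  qed
  then have d0: "S.nrm d = 0" by (simp add: S.nrm_def)
  have ug: "has_weak_grad \<Omega> x y" using xy by (simp add: weak_graph_def)
  have mem: "x \<in> L2 \<Omega>" "y \<in> L2 \<Omega>" using ug by (simp_all add: has_weak_grad_def)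
  have "l2_inner \<Omega> d x = 0" using S.cauchy_schwarz[OF dL2 mem(1)] d0 by simp
  then have "l2_inner \<Omega> (app \<epsilon> h) y = 0"
    using test_closure_divergence_pairing[OF cl ug] by simp
  then show ?thesis using B_sym[OF mem(2) hL2] by simp
qed

text \<open>The Maxwell inequality is applied to a gradient \<open>y\<close>: it is rotation free, its projection onto the
  Dirichlet fields vanishes, and \<open>adj\<close> tested with test functions says that \<open>- d\<close> is the weak divergence
  of \<open>\<epsilon> y\<close>.\<close>

lemma tangential_bound:
  assumes c: "c \<ge> 0"
    and maxwell: "\<forall>E \<in> R_circ \<Omega> \<inter> eps_inv \<Omega> \<epsilon> (D \<Omega>). \<forall>r d.
     has_weak_rot \<Omega> E r \<longrightarrow> has_weak_div \<Omega> (app \<epsilon> E) d \<longrightarrow>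
     weighted_norm \<Omega> \<epsilon> (\<lambda>x. E x - eps_proj \<Omega> \<epsilon> (dirichlet_fields \<Omega> \<epsilon>) E x)
       \<le> c * sqrt ((l2_norm \<Omega> r)\<^sup>2 + (l2_norm \<Omega> d)\<^sup>2)"
    and u: "u \<in> H1_circ \<Omega>" and g: "has_weak_grad \<Omega> u g"
  shows "l2_norm \<Omega> u \<le> c * (lo * up\<^sup>2) * l2_norm \<Omega> g"
proof -
  interpret W: graph_space "L2 \<Omega>" "l2_inner \<Omega>" "L2 \<Omega>" B circ_graph by (rule graph_space_circ)
  obtain g' where g': "has_weak_grad \<Omega> u g'" "approx_by_test \<Omega> grad u g'"
    using u by (auto simp: H1_circ_def)
  have cl: "(u, g') \<in> test_closure grad" by (rule test_closure_grad_weak[OF g'])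
  have ug': "(u, g') \<in> circ_graph" using cl g'(1) by (simp add: circ_graph_def weak_graph_def)
  have mem: "u \<in> L2 \<Omega>" "g \<in> L2 \<Omega>" "g' \<in> L2 \<Omega>" using g g'(1) by (simp_all add: has_weak_grad_def)
  have "S.nrm u \<le> c * Y.nrm g'"
  proof (rule W.adjoint_bound_imp_bound[OF c _ ug'])
    fix x y d assume xy: "(x, y) \<in> circ_graph" and d: "d \<in> L2 \<Omega>"
      and adj: "\<And>x' y'. (x', y') \<in> circ_graph \<Longrightarrow> B y y' = l2_inner \<Omega> d x'"
    have clxy: "(x, y) \<in> test_closure grad" and wxy: "has_weak_grad \<Omega> x y"
      using xy by (simp_all add: circ_graph_def weak_graph_def)
    have yL2: "y \<in> L2 \<Omega>" using wxy by (simp add: has_weak_grad_def)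
    have rot: "has_weak_rot \<Omega> y (\<lambda>x. 0)" by (rule weak_grad_rot[OF wxy])
    have "approx_by_test \<Omega> curl y (\<lambda>x. 0)"
      unfolding approx_by_test_iff
    proof (intro allI impI)
      fix e :: real assume e: "e > 0"
      obtain \<phi> where \<phi>: "\<phi> \<in> test_functions \<Omega>" "l2_norm \<Omega> (x - \<phi>) < e" "l2_norm \<Omega> (y - grad \<phi>) < e"
        by (rule test_closure_approx[OF clxy e])
      have "l2_norm \<Omega> ((\<lambda>x. 0) - curl (grad \<phi>)) = 0"
        unfolding curl_grad[OF test_smooth[OF \<phi>(1)]] by (simp add: l2_norm_def l2_inner_def)
      then show "\<exists>\<Phi>\<in>test_functions \<Omega>. l2_norm \<Omega> (y - \<Phi>) < e \<and> l2_norm \<Omega> ((\<lambda>x. 0) - curl \<Phi>) < e"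
        using \<phi>(3) e by (intro bexI[of _ "grad \<phi>"] test_grad[OF \<phi>(1)]) simp
    qed
    then have R: "y \<in> R_circ \<Omega>" using rot by (auto simp: R_circ_def)
    have div: "has_weak_div \<Omega> (app \<epsilon> y) (- d)"
      unfolding has_weak_div_def
    proof (intro conjI ballI)
      fix \<phi> :: "real^3 \<Rightarrow> real" assume \<phi>: "\<phi> \<in> test_functions \<Omega>"
      have "(\<phi>, grad \<phi>) \<in> circ_graph"
        using weak_grad_test[OF \<phi>] in_test_closure[of \<phi> grad, OF \<phi> test_grad[OF \<phi>]]
        by (simp add: circ_graph_def weak_graph_def)
      from adj[OF this] show "B y (grad \<phi>) = - l2_inner \<Omega> (- d) \<phi>"
        by (simp only: S.minus_left[OF d test_L2[OF \<phi>]] minus_minus)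
    qed (use app_L2[OF yL2] S.mem(5)[OF d] in auto)
    have "y \<in> eps_inv \<Omega> \<epsilon> (D \<Omega>)" using yL2 div by (auto simp: eps_inv_def D_def)
    with R maxwell rot div
    have "weighted_norm \<Omega> \<epsilon> (\<lambda>x. y x - eps_proj \<Omega> \<epsilon> (dirichlet_fields \<Omega> \<epsilon>) y x)
       \<le> c * sqrt ((l2_norm \<Omega> (\<lambda>x. 0 :: real^3))\<^sup>2 + (l2_norm \<Omega> (- d))\<^sup>2)" by blast
    moreover have "weighted_norm \<Omega> \<epsilon> (\<lambda>x. y x - eps_proj \<Omega> \<epsilon> (dirichlet_fields \<Omega> \<epsilon>) y x) = Y.nrm y"
      by (rule weighted_norm_minus_proj[OF _ zero_dirichlet yL2 dirichlet_orthogonal[OF xy]])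
        (auto simp: dirichlet_fields_def eps_inv_def)
    moreover have "sqrt ((l2_norm \<Omega> (\<lambda>x. 0 :: real^3))\<^sup>2 + (l2_norm \<Omega> (- d))\<^sup>2) = S.nrm d"
      using S.nrm_minus[OF d] S.nrm_nonneg[OF d] by (simp add: nrm_L2 l2_norm_def[of _ "\<lambda>x. 0"])
    ultimately show "Y.nrm y \<le> c * S.nrm d" by simp
  next
    fix z assume "(z, 0) \<in> circ_graph"
    then have z: "(z, 0) \<in> test_closure grad" by (simp add: circ_graph_def)
    have "z \<in> L2 \<Omega>" using z by (simp add: test_closure_def)
    from S.cauchy_schwarz[OF mem(1) this] show "l2_inner \<Omega> u z = 0"
      using test_closure_grad_kernel[OF z] by (simp add: nrm_L2)
  qed
  \<comment> \<open>The given weak gradient \<open>g\<close> and the limit \<open>g'\<close> of test gradients agree almost everywhere; it suffices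
    that \<open>g'\<close>, as such a limit, is orthogonal to \<open>g' - g\<close>.\<close>
  moreover have "l2_norm \<Omega> g' \<le> l2_norm \<Omega> g"
  proof -
    have "l2_inner \<Omega> g' (g' - g) = l2_inner \<Omega> u (\<lambda>x. 0)"
    proof (rule test_closure_pairing[OF test_grad cl const_L2])
      show "g' - g \<in> L2 \<Omega>" using mem by simp
      fix \<phi> :: "real^3 \<Rightarrow> real" assume \<phi>: "\<phi> \<in> test_functions \<Omega>"
      note gr = test_grad[OF \<phi>]
      have "l2_inner \<Omega> g' (grad \<phi>) = l2_inner \<Omega> g (grad \<phi>)"
        using weak_grad_divergence[OF g gr] weak_grad_divergence[OF g'(1) gr] by simp
      then show "l2_inner \<Omega> (grad \<phi>) (g' - g) = l2_inner \<Omega> \<phi> (\<lambda>x. 0)"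
        unfolding l2_inner_commute[of \<Omega> "grad \<phi>"] X.diff_left[OF mem(3,2) test_L2[OF gr]] by simp
    qed
    then have "(l2_norm \<Omega> g')\<^sup>2 = l2_inner \<Omega> g' g"
      using X.nrm_sq[OF mem(3)] mem by (simp add: nrm_L2 X.diff_right)
    also have "\<dots> \<le> l2_norm \<Omega> g' * l2_norm \<Omega> g"
      using X.cauchy_schwarz[OF mem(3,2), unfolded nrm_L2] by linarith
    finally have *: "l2_norm \<Omega> g' * l2_norm \<Omega> g' \<le> l2_norm \<Omega> g' * l2_norm \<Omega> g" by (simp add: power2_eq_square)
    show ?thesis
    proof (cases "l2_norm \<Omega> g' = 0")
      case False
      then have "l2_norm \<Omega> g' > 0" using l2_norm_nonneg[of \<Omega> g'] by linarith
      then show ?thesis using * by (simp only: mult_le_cancel_left_pos)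
    qed simp
  qed
  then have "lo * up\<^sup>2 * l2_norm \<Omega> g' \<le> lo * up\<^sup>2 * l2_norm \<Omega> g"
    using lo by (intro mult_left_mono) auto
  then have "Y.nrm g' \<le> lo * up\<^sup>2 * l2_norm \<Omega> g"
    using weighted_le_norm'[OF mem(3)] by linarith
  from mult_left_mono[OF this c] have "c * Y.nrm g' \<le> c * (lo * up\<^sup>2) * l2_norm \<Omega> g"
    by (simp only: mult.assoc)
  ultimately show ?thesis unfolding nrm_L2 by linarith
qed

text \<open>As in \<open>tangential_bound\<close>; here \<open>adjoint_weak_grad\<close> provides the boundary condition for \<open>\<epsilon> y\<close>, and the
  kernel of the gradient consists of constants instead of zero.\<close>

lemma normal_bound:
  assumes conn: "connected \<Omega>" and c: "c \<ge> 0"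
    and maxwell: "\<forall>H \<in> R \<Omega> \<inter> eps_inv \<Omega> \<epsilon> (D_circ \<Omega>). \<forall>r d.
     has_weak_rot \<Omega> H r \<longrightarrow> has_weak_div \<Omega> (app \<epsilon> H) d \<longrightarrow>
     weighted_norm \<Omega> \<epsilon> (\<lambda>x. H x - eps_proj \<Omega> \<epsilon> (neumann_fields \<Omega> \<epsilon>) H x)
       \<le> c * sqrt ((l2_norm \<Omega> r)\<^sup>2 + (l2_norm \<Omega> d)\<^sup>2)"
    and g: "has_weak_grad \<Omega> u g" and mean: "(LINT x|lebesgue_on \<Omega>. u x) = 0"
  shows "l2_norm \<Omega> u \<le> c * (lo * up\<^sup>2) * l2_norm \<Omega> g"
proof -
  interpret W: graph_space "L2 \<Omega>" "l2_inner \<Omega>" "L2 \<Omega>" B weak_graph by (rule graph_space_weak)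
  have ug: "(u, g) \<in> weak_graph" using g by (simp add: weak_graph_def)
  have mem: "u \<in> L2 \<Omega>" "g \<in> L2 \<Omega>" using g by (simp_all add: has_weak_grad_def)
  have "S.nrm u \<le> c * Y.nrm g"
  proof (rule W.adjoint_bound_imp_bound[OF c _ ug])
    fix x y d assume xy: "(x, y) \<in> weak_graph" and d: "d \<in> L2 \<Omega>"
      and adj: "\<And>x' y'. (x', y') \<in> weak_graph \<Longrightarrow> B y y' = l2_inner \<Omega> d x'"
    have wxy: "has_weak_grad \<Omega> x y" using xy by (simp add: weak_graph_def)
    have yL2: "y \<in> L2 \<Omega>" using wxy by (simp add: has_weak_grad_def)
    have rot: "has_weak_rot \<Omega> y (\<lambda>x. 0)" by (rule weak_grad_rot[OF wxy])
    have md: "- d \<in> L2 \<Omega>" by (rule S.mem(5)[OF d])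
    have adj': "B y X = - l2_inner \<Omega> (- d) q" if "has_weak_grad \<Omega> q X" for q X
    proof -
      have "q \<in> L2 \<Omega>" using that by (simp add: has_weak_grad_def)
      then show ?thesis using adj[of q X] that d by (simp add: weak_graph_def S.minus_left)
    qed
    note div = adjoint_weak_grad[OF app_L2[OF yL2] md adj']
    have "y \<in> R \<Omega>" using rot by (auto simp: R_def)
    moreover have "y \<in> eps_inv \<Omega> \<epsilon> (D_circ \<Omega>)" using yL2 div by (auto simp: eps_inv_def D_circ_def)
    ultimately have "weighted_norm \<Omega> \<epsilon> (\<lambda>x. y x - eps_proj \<Omega> \<epsilon> (neumann_fields \<Omega> \<epsilon>) y x)
       \<le> c * sqrt ((l2_norm \<Omega> (\<lambda>x. 0 :: real^3))\<^sup>2 + (l2_norm \<Omega> (- d))\<^sup>2)"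
      using maxwell rot div(1) by blast
    moreover have "weighted_norm \<Omega> \<epsilon> (\<lambda>x. y x - eps_proj \<Omega> \<epsilon> (neumann_fields \<Omega> \<epsilon>) y x) = Y.nrm y"
      by (rule weighted_norm_minus_proj[OF _ zero_neumann yL2 neumann_orthogonal[OF xy]])
        (auto simp: neumann_fields_def eps_inv_def)
    moreover have "sqrt ((l2_norm \<Omega> (\<lambda>x. 0 :: real^3))\<^sup>2 + (l2_norm \<Omega> (- d))\<^sup>2) = S.nrm d"
      using S.nrm_minus[OF d] S.nrm_nonneg[OF d] by (simp add: nrm_L2 l2_norm_def[of _ "\<lambda>x. 0"])
    ultimately show "Y.nrm y \<le> c * S.nrm d" by simp
  next
    fix z assume "(z, 0) \<in> weak_graph"
    then have z: "has_weak_grad \<Omega> z (\<lambda>x. 0)" by (simp add: weak_graph_def zero_fun_def)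
    obtain \<kappa> where \<kappa>: "AE x in lebesgue_on \<Omega>. z x = \<kappa>"
      using weak_grad_zero_imp_const[OF z conn] by blast
    have zL2: "z \<in> L2 \<Omega>" using z by (simp add: has_weak_grad_def)
    have ae: "AE x in lebesgue_on \<Omega>. u x \<bullet> z x = u x * \<kappa>"
      using \<kappa> by eventually_elim simp
    have "l2_inner \<Omega> u z = (LINT x|lebesgue_on \<Omega>. u x * \<kappa>)"
      unfolding l2_inner_def
    proof (rule integral_cong_AE[OF _ _ ae])
      show "(\<lambda>x. u x \<bullet> z x) \<in> borel_measurable (lebesgue_on \<Omega>)"
        by (rule borel_measurable_integrable[OF integrable_inner_L2[OF mem(1) zL2]])
      show "(\<lambda>x. u x * \<kappa>) \<in> borel_measurable (lebesgue_on \<Omega>)"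
        by (rule borel_measurable_integrable[OF integrable_mult_left[OF integrable_L2[OF mem(1)]]])
    qed
    also have "\<dots> = 0" using mean by simp
    finally show "l2_inner \<Omega> u z = 0" .
  qed
  moreover have "c * Y.nrm g \<le> c * (lo * up\<^sup>2) * l2_norm \<Omega> g"
    using mult_left_mono[OF weighted_le_norm'[OF mem(2)] c] by (simp only: mult.assoc)
  ultimately show ?thesis unfolding nrm_L2 by linarith
qed

end


section \<open>Comparison of the best constants\<close>

lemma best_constant_divide_le:
  assumes k: "k > 0" and imp: "\<And>c. 0 \<le> c \<Longrightarrow> Q c \<Longrightarrow> P (c * k)"
  shows "best_constant P / ennreal k \<le> best_constant Q"
  unfolding best_constant_def[of Q]
proof (rule INF_greatest)
  fix c assume "c \<in> {c. 0 \<le> c \<and> Q c}"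
  then have c: "0 \<le> c" "P (c * k)" using imp by auto
  have "best_constant P \<le> ennreal (c * k)"
    unfolding best_constant_def using c k by (intro INF_lower) simp
  then have "best_constant P / ennreal k \<le> ennreal (c * k) / ennreal k"
    by (rule divide_right_mono_ennreal)
  also have "\<dots> = ennreal c" using c(1) k by (simp add: divide_ennreal)
  finally show "best_constant P / ennreal k \<le> ennreal c" .
qed

theorem theorem7:
  fixes \<Omega> :: "(real^3) set" and \<epsilon> :: "real^3 \<Rightarrow> real^3^3" and eps_lo eps_up :: real
  assumes "lipschitz_domain \<Omega>" and "bounded \<Omega>"
    and "admissible_coeff \<Omega> \<epsilon>"
    and "eps_lo > 0" and "eps_up > 0"
    and "\<And>E. E \<in> L2 \<Omega> \<Longrightarrow>
           (l2_norm \<Omega> E)\<^sup>2 / eps_lo\<^sup>2 \<le> l2_inner \<Omega> (app \<epsilon> E) E \<and>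
           l2_inner \<Omega> (app \<epsilon> E) E \<le> eps_up\<^sup>2 * (l2_norm \<Omega> E)\<^sup>2"
  shows "c_p_circ \<Omega> / ennreal (eps_lo * eps_up\<^sup>2) \<le> c_mt \<Omega> \<epsilon> \<and>
         c_p \<Omega> / ennreal (eps_lo * eps_up\<^sup>2) \<le> c_mn \<Omega> \<epsilon>"
proof -
  interpret weighted \<Omega> \<epsilon> eps_lo eps_up
    by unfold_locales (use assms in \<open>simp_all add: lipschitz_domain_def\<close>)
  have conn: "connected \<Omega>" using assms(1) by (simp add: lipschitz_domain_def)
  have k: "eps_lo * eps_up\<^sup>2 > 0" using assms(4,5) by simp
  show ?thesis
  proof
    show "c_p_circ \<Omega> / ennreal (eps_lo * eps_up\<^sup>2) \<le> c_mt \<Omega> \<epsilon>"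
      unfolding c_p_circ_def c_mt_def
      by (intro best_constant_divide_le[OF k] ballI allI impI) (rule tangential_bound)
    show "c_p \<Omega> / ennreal (eps_lo * eps_up\<^sup>2) \<le> c_mn \<Omega> \<epsilon>"
      unfolding c_p_def c_mn_def
      by (intro best_constant_divide_le[OF k] ballI allI impI) (rule normal_bound[OF conn])
  qed
qed

end
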